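(* Let $A$ be a compact metric space, let $G\colon (I,\mathcal{I},\lambda)\to \mathcal{C}_A\times\mathcal{U}_A$ be a large game on an atomless probability space, and let $\{G^n\}_{n\in\mathbb{Z}_+}$ be a sequence of finite-player games $G^n\colon(I^n,\mathcal{I}^n,\lambda^n)\to\mathcal{C}_A\times\mathcal{U}_A$ with $|I^n|=n$ and $\sup_{i\in I^n}\lambda^n(i)\to 0$, converging to $G$ in the sense that $\{\lambda^n(G^n)^{-1}\}_{n\in\mathbb{Z}_+}$ converges weakly to $\lambda G^{-1}$. Then there exists a Nash equilibrium action distribution $\tau$ of $G$ that is a limit point of Nash equilibria of $\{G^n\}_{n\in\mathbb{Z}_+}$. In particular, if $G$ has a unique Nash equilibrium action distribution $\tau^*$, then for any sequence $\{g^n\}_{n\in\mathbb{Z}_+}$ in which each $g^n$ is a Nash equilibrium of $G^n$, the societal summaries $s(g^n)$ converge weakly to $\tau^*$.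
   Context: "Nash equilibrium" means randomized strategy Nash equilibrium. A Nash equilibrium action distribution of $G$ is a measure of the form $s(g)$ with $g$ a Nash equilibrium of $G$. Convergence of equilibria means weak convergence of their societal summaries: $\tau$ is a limit point of Nash equilibria of $\{G^n\}$ if there are Nash equilibria $g^n$ of $G^n$ ($n\in\mathbb{Z}_+$) such that some subsequence of $\{s(g^n)\}_{n\in\mathbb{Z}_+}$ converges weakly to $\tau$. Probability spaces are complete and countably additive. $A$ is a compact metric space (common action space) with Borel $\sigma$-algebra $\mathcal{B}(A)$. $\mathcal{M}(A)$ is the set of Borel probability measures on $A$ with the topology of weak convergence (and its Borel $\sigma$-algebra). $\mathcal{C}_A$ is the set of nonempty compact subsets of $A$ with the Hausdorff metric. $\mathcal{U}_A$ is the space of bounded continuous real functions on $A\times\mathcal{M}(A)$ with the sup norm. $\mathcal{C}_A\times\mathcal{U}_A$ has the product topology and its Borel $\sigma$-algebra. Large game: a measurable map $G\colon(I,\mathcal{I},\lambda)\to\mathcal{C}_A\times\mathcal{U}_A$, where $(I,\mathcal{I},\lambda)$ is an atomless probability space; write $G(i)=(A_i,u_i)$, where $A_i$ is player $i$'s feasible action set and $u_i$ her payoff function. A randomized strategy profile of $G$ is a measurable $g\colon I\to\mathcal{M}(A)$ with $g(i,A_i)=1$ for $\lambda$-almost all $i$ (where $g(i,B)=g(i)(B)$). Its societal summary is $s(g)=\int_I g(i)\,d\lambda(i)\in\mathcal{M}(A)$, i.e. $s(g)(B)=\int_I g(i,B)\,d\lambda(i)$ for all $B\in\mathcal{B}(A)$.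 It is a Nash equilibrium of $G$ if for $\lambda$-almost all $i\in I$, $\int_{A_i}u_i(a,s(g))\,g(i,da)\ge\int_{A_i}u_i(a,s(g))\,d\mu(a)$ for all $\mu\in\mathcal{M}(A_i)$. Finite-player game: a map $G^n\colon I^n\to\mathcal{C}_A\times\mathcal{U}_A$, $G^n(i)=(A_i^n,u_i^n)$, on a finite probability space $(I^n,\mathcal{I}^n,\lambda^n)$ with $|I^n|=n$ and $\mathcal{I}^n$ the power set. A randomized strategy profile of $G^n$ is a map $g^n\colon I^n\to\mathcal{M}(A)$ with $g^n(i,A_i^n)=1$ for all $i\in I^n$. Player $i$'s expected payoff is $$u_i^n(g^n)=\int_{\prod_{j\in I^n}A_j^n}u_i^n\Bigl(a_i,\sum_{j\in I^n}\lambda^n(j)\delta_{a_j}\Bigr)\bigotimes_{j\in I^n}g^n(j,da_j),$$ with $\delta_a$ the Dirac measure at $a$ and players randomizing independently (product measure). The societal summary is $s(g^n)=\sum_{i\in I^n}\lambda^n(i)g^n(i)$. $g^n$ is a Nash equilibrium of $G^n$ if for all $i\in I^n$, $u_i^n(g^n)\ge u_i^n(\mu,g^n_{-i})$ for all $\mu\in\mathcal{M}(A_i^n)$, where $(\mu,g^n_{-i})$ is the profile in which $i$ plays $\mu$ and each $j\ne i$ plays $g^n(j)$. *)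

theory Defs
  imports "HOL-Probability.Probability"
begin

section \<open>Borel probability measures with the topology of weak convergence\<close>

typedef (overloaded) 'a prob_measure =
  "{M :: 'a::topological_space measure. prob_space M \<and> sets M = sets borel}"
  morphisms as_measure Prob_Measure
proof
  show "return borel undefined \<in> {M :: 'a measure. prob_space M \<and> sets M = sets borel}"
    by (auto intro: prob_space_return)
qed

lemma prob_space_as_measure [simp]: "prob_space (as_measure \<mu>)"
  and sets_as_measure [simp, measurable_cong]: "sets (as_measure \<mu>) = sets borel"
  using as_measure[of \<mu>] by auto

lemma space_as_measure [simp]: "space (as_measure \<mu>) = UNIV"
  using sets_eq_imp_space_eq[OF sets_as_measure, of \<mu>] by simp

text \<open>The weak topology is the coarsest one for which all the maps \<open>\<mu> \<mapsto> \<integral>f d\<mu>\<close>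
  with \<open>f\<close> bounded continuous are continuous.\<close>

instantiation prob_measure :: (topological_space) topological_space
begin

definition open_prob_measure :: "'a prob_measure set \<Rightarrow> bool" where
  "open_prob_measure = generate_topology
     {{\<mu>. (\<integral>x. apply_bcontfun f x \<partial>as_measure \<mu>) \<in> U} | (f :: 'a \<Rightarrow>\<^sub>C real) U. open U}"

instance
  by intro_classes (auto simp: open_prob_measure_def intro: generate_topology.intros)

end

lemma tendsto_prob_measure_iff:
  fixes X :: "'b \<Rightarrow> 'a::topological_space prob_measure"
  shows "(X \<longlongrightarrow> \<mu>) F \<longleftrightarrow>
    (\<forall>f :: 'a \<Rightarrow>\<^sub>C real. ((\<lambda>n. \<integral>x. f x \<partial>as_measure (X n)) \<longlongrightarrow> (\<integral>x. f x \<partial>as_measure \<mu>)) F)"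
    (is "_ \<longleftrightarrow> ?R")
proof
  assume X: "(X \<longlongrightarrow> \<mu>) F"
  show ?R
  proof (intro allI topological_tendstoI)
    fix f :: "'a \<Rightarrow>\<^sub>C real" and U
    assume U: "open U" "(\<integral>x. f x \<partial>as_measure \<mu>) \<in> U"
    have "open {\<nu>. (\<integral>x. f x \<partial>as_measure \<nu>) \<in> U}"
      unfolding open_prob_measure_def using U(1) by (blast intro: generate_topology.Basis)
    from topological_tendstoD[OF X this] U(2)
    show "\<forall>\<^sub>F n in F. (\<integral>x. f x \<partial>as_measure (X n)) \<in> U" by simp
  qed
next
  assume R: ?R
  show "(X \<longlongrightarrow> \<mu>) F"
    unfolding nhds_generated_topology[OF open_prob_measure_def] filterlim_INF filterlim_principal
  proof safe
    fix f :: "'a \<Rightarrow>\<^sub>C real" and U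
    assume "open U" "(\<integral>x. f x \<partial>as_measure \<mu>) \<in> U"
    with R show "\<forall>\<^sub>F n in F. X n \<in> {\<nu>. (\<integral>x. f x \<partial>as_measure \<nu>) \<in> U}"
      by (auto intro: topological_tendstoD)
  qed
qed

definition dirac :: "'a::topological_space \<Rightarrow> 'a prob_measure" where
  "dirac a = Prob_Measure (return borel a)"

lemma as_measure_dirac [simp]: "as_measure (dirac a) = return borel a"
  unfolding dirac_def by (rule Prob_Measure_inverse) (auto intro: prob_space_return)

definition law :: "'i measure \<Rightarrow> ('i \<Rightarrow> 'b::topological_space) \<Rightarrow> 'b prob_measure" where
  "law L X = Prob_Measure (distr L borel X)"

lemma as_measure_law:
  assumes "prob_space L" and "X \<in> borel_measurable L"
  shows "as_measure (law L X) = distr L borel X"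
  unfolding law_def using assms
  by (intro Prob_Measure_inverse) (auto intro: prob_space.prob_space_distr)

text \<open>For a Borel set \<open>K\<close>, the probability measures on \<open>K\<close> are identified with the probability
  measures on the whole space that give full mass to \<open>K\<close>.\<close>

definition prob_measures_on :: "'a::topological_space set \<Rightarrow> 'a prob_measure set" where
  "prob_measures_on K = {\<mu>. measure (as_measure \<mu>) K = 1}"


section \<open>Nonempty compact sets with the Hausdorff metric\<close>

typedef (overloaded) 'a compacts = "{K :: 'a::metric_space set. compact K \<and> K \<noteq> {}}"
  morphisms set_of_compacts Compacts
  by (rule exI[of _ "{undefined}"]) auto

lemma compact_set_of_compacts [simp]: "compact (set_of_compacts K)"
  and set_of_compacts_nonempty [simp]: "set_of_compacts K \<noteq> {}"
  using set_of_compacts[of K] by auto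

instantiation compacts :: (metric_space) metric_space
begin

definition dist_compacts :: "'a compacts \<Rightarrow> 'a compacts \<Rightarrow> real" where
  "dist_compacts K L =
     max (SUP x\<in>set_of_compacts K. infdist x (set_of_compacts L))
         (SUP y\<in>set_of_compacts L. infdist y (set_of_compacts K))"

definition uniformity_compacts :: "('a compacts \<times> 'a compacts) filter" where
  "uniformity_compacts = (INF e\<in>{0 <..}. principal {(x, y). dist x y < e})"

definition open_compacts :: "'a compacts set \<Rightarrow> bool" where
  "open_compacts S = (\<forall>x\<in>S. \<forall>\<^sub>F (x', y) in uniformity. x' = x \<longrightarrow> y \<in> S)"

lemma infdist_le_dist_compacts:
  assumes "x \<in> set_of_compacts K"
  shows "infdist x (set_of_compacts L) \<le> dist K L"
proof -
  have "compact ((\<lambda>x. infdist x (set_of_compacts L)) ` set_of_compacts K)"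
    by (intro compact_continuous_image continuous_intros) simp
  then have "bdd_above ((\<lambda>x. infdist x (set_of_compacts L)) ` set_of_compacts K)"
    by (intro bounded_imp_bdd_above compact_imp_bounded)
  with assms show ?thesis
    unfolding dist_compacts_def by (intro max.coboundedI1 cSUP_upper)
qed

lemma dist_compacts_commute: "dist K L = dist L (K :: 'a compacts)"
  unfolding dist_compacts_def by (rule max.commute)

lemma dist_compacts_le:
  assumes "\<And>x. x \<in> set_of_compacts K \<Longrightarrow> infdist x (set_of_compacts L) \<le> c"
    and "\<And>y. y \<in> set_of_compacts L \<Longrightarrow> infdist y (set_of_compacts K) \<le> c"
  shows "dist K L \<le> c"
  unfolding dist_compacts_def by (intro max.boundedI cSUP_least assms) auto

lemma infdist_compacts_triangle:
  fixes K L M :: "'a compacts"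
  assumes "x \<in> set_of_compacts K"
  shows "infdist x (set_of_compacts L) \<le> dist K M + dist M L"
proof -
  have "continuous_on (set_of_compacts M) (\<lambda>z. dist x z)" by (intro continuous_intros)
  then obtain z where z: "z \<in> set_of_compacts M" "\<forall>y\<in>set_of_compacts M. dist x z \<le> dist x y"
    using continuous_attains_inf[of "set_of_compacts M" "\<lambda>z. dist x z"] by auto
  have "dist x z \<le> infdist x (set_of_compacts M)"
    unfolding infdist_notempty[OF set_of_compacts_nonempty]
    using z by (intro cINF_greatest) auto
  also have "\<dots> \<le> dist K M" by (rule infdist_le_dist_compacts[OF assms])
  finally have "dist x z \<le> dist K M" .
  moreover have "infdist z (set_of_compacts L) \<le> dist M L"
    by (rule infdist_le_dist_compacts[OF z(1)])
  moreover have "infdist x (set_of_compacts L) \<le> infdist z (set_of_compacts L) + dist x z"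
    by (rule infdist_triangle)
  ultimately show ?thesis by linarith
qed

instance
proof
  fix K L M :: "'a compacts"
  show "dist K L = 0 \<longleftrightarrow> K = L"
  proof
    assume *: "dist K L = 0"
    have sub: "set_of_compacts A \<subseteq> set_of_compacts B" if "dist A B = 0" for A B :: "'a compacts"
    proof
      fix x assume "x \<in> set_of_compacts A"
      then have "infdist x (set_of_compacts B) \<le> 0"
        using infdist_le_dist_compacts that by metis
      then have "infdist x (set_of_compacts B) = 0" using infdist_nonneg[of x] by (intro antisym)
      then show "x \<in> set_of_compacts B"
        by (simp add: in_closed_iff_infdist_zero compact_imp_closed)
    qed
    from sub[OF *] sub[of L K] * have "set_of_compacts K = set_of_compacts L"
      by (auto simp: dist_compacts_commute)
    then show "K = L" by (simp add: set_of_compacts_inject)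
  next
    assume "K = L"
    have "dist L L \<le> 0" by (rule dist_compacts_le) auto
    moreover obtain x where "x \<in> set_of_compacts L" using set_of_compacts_nonempty[of L] by blast
    then have "0 \<le> dist L L" using infdist_le_dist_compacts[of x L L] by simp
    ultimately show "dist K L = 0" using \<open>K = L\<close> by simp
  qed
  show "dist K L \<le> dist K M + dist L M"
  proof (rule dist_compacts_le)
    fix x assume "x \<in> set_of_compacts K"
    then show "infdist x (set_of_compacts L) \<le> dist K M + dist L M"
      using infdist_compacts_triangle[of x K L M] by (simp add: dist_compacts_commute)
  next
    fix y assume "y \<in> set_of_compacts L"
    then show "infdist y (set_of_compacts K) \<le> dist K M + dist L M"
      using infdist_compacts_triangle[of y L K M] by (simp add: dist_compacts_commute)
  qed
qed (simp_all add: uniformity_compacts_def open_compacts_def)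

end


section \<open>Games\<close>

type_synonym 'a payoff = "('a \<times> 'a prob_measure) \<Rightarrow>\<^sub>C real"

type_synonym ('i, 'a) game = "'i \<Rightarrow> 'a compacts \<times> 'a payoff"

abbreviation actions :: "('i, 'a::metric_space) game \<Rightarrow> 'i \<Rightarrow> 'a set" where
  "actions G i \<equiv> set_of_compacts (fst (G i))"

abbreviation payoff :: "('i, 'a::metric_space) game \<Rightarrow> 'i \<Rightarrow> 'a \<Rightarrow> 'a prob_measure \<Rightarrow> real" where
  "payoff G i a \<tau> \<equiv> apply_bcontfun (snd (G i)) (a, \<tau>)"


subsection \<open>Large games\<close>

definition atomless :: "'i measure \<Rightarrow> bool" where
  "atomless L \<longleftrightarrow> (\<forall>E\<in>sets L. 0 < emeasure L E \<longrightarrow>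
     (\<exists>F\<in>sets L. F \<subseteq> E \<and> 0 < emeasure L F \<and> emeasure L F < emeasure L E))"

definition large_game :: "'i measure \<Rightarrow> ('i, 'a::metric_space) game \<Rightarrow> bool" where
  "large_game L G \<longleftrightarrow>
     prob_space L \<and> complete_measure L \<and> atomless L \<and> G \<in> borel_measurable L"

definition large_profile ::
    "'i measure \<Rightarrow> ('i, 'a::metric_space) game \<Rightarrow> ('i \<Rightarrow> 'a prob_measure) \<Rightarrow> bool" where
  "large_profile L G g \<longleftrightarrow>
     g \<in> borel_measurable L \<and> (AE i in L. measure (as_measure (g i)) (actions G i) = 1)"

definition large_summary ::
    "'i measure \<Rightarrow> ('i \<Rightarrow> 'a::metric_space prob_measure) \<Rightarrow> 'a prob_measure" where
  "large_summary L g =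
     Prob_Measure (measure_of UNIV (sets borel) (\<lambda>B. \<integral>\<^sup>+ i. emeasure (as_measure (g i)) B \<partial>L))"

definition large_nash ::
    "'i measure \<Rightarrow> ('i, 'a::metric_space) game \<Rightarrow> ('i \<Rightarrow> 'a prob_measure) \<Rightarrow> bool" where
  "large_nash L G g \<longleftrightarrow> large_profile L G g \<and>
     (AE i in L. \<forall>\<mu>\<in>prob_measures_on (actions G i).
        (LINT a:actions G i|as_measure (g i). payoff G i a (large_summary L g))
        \<ge> (LINT a:actions G i|as_measure \<mu>. payoff G i a (large_summary L g)))"

definition nash_action_distributions ::
    "'i measure \<Rightarrow> ('i, 'a::metric_space) game \<Rightarrow> 'a prob_measure set" where
  "nash_action_distributions L G = {large_summary L g | g. large_nash L G g}"


subsection \<open>Finite-player games\<close>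

definition finite_player_space :: "nat \<Rightarrow> 'j measure \<Rightarrow> bool" where
  "finite_player_space n L \<longleftrightarrow>
     prob_space L \<and> finite (space L) \<and> card (space L) = n \<and> sets L = Pow (space L)"

definition finite_profile ::
    "'j measure \<Rightarrow> ('j, 'a::metric_space) game \<Rightarrow> ('j \<Rightarrow> 'a prob_measure) \<Rightarrow> bool" where
  "finite_profile L G g \<longleftrightarrow>
     (\<forall>i\<in>space L. measure (as_measure (g i)) (actions G i) = 1)"

definition finite_summary ::
    "'j measure \<Rightarrow> ('j \<Rightarrow> 'a::metric_space prob_measure) \<Rightarrow> 'a prob_measure" where
  "finite_summary L g = Prob_Measure (measure_of UNIV (sets borel)
     (\<lambda>B. \<Sum>i\<in>space L. emeasure L {i} * emeasure (as_measure (g i)) B))"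

text \<open>The summary of the Dirac profile \<open>j \<mapsto> dirac (a j)\<close> is the realized action
  distribution \<open>\<Sum>j. \<lambda>(j) \<delta>(a j)\<close>.\<close>

definition expected_payoff ::
    "'j measure \<Rightarrow> ('j, 'a::metric_space) game \<Rightarrow> ('j \<Rightarrow> 'a prob_measure) \<Rightarrow> 'j \<Rightarrow> real" where
  "expected_payoff L G g i =
     (LINT a:(\<Pi>\<^sub>E j\<in>space L. actions G j)|(\<Pi>\<^sub>M j\<in>space L. as_measure (g j)).
        payoff G i (a i) (finite_summary L (\<lambda>j. dirac (a j))))"

definition finite_nash ::
    "'j measure \<Rightarrow> ('j, 'a::metric_space) game \<Rightarrow> ('j \<Rightarrow> 'a prob_measure) \<Rightarrow> bool" where
  "finite_nash L G g \<longleftrightarrow> finite_profile L G g \<and>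
     (\<forall>i\<in>space L. \<forall>\<mu>\<in>prob_measures_on (actions G i).
        expected_payoff L G g i \<ge> expected_payoff L G (g(i := \<mu>)) i)"

text \<open>Sequences are indexed by the positive integers, so the value at \<open>0\<close> plays no role.\<close>

definition limit_point_of_equilibria ::
    "(nat \<Rightarrow> 'j measure) \<Rightarrow> (nat \<Rightarrow> ('j, 'a::metric_space) game) \<Rightarrow> 'a prob_measure \<Rightarrow> bool" where
  "limit_point_of_equilibria L G \<tau> \<longleftrightarrow>
     (\<exists>g. (\<forall>n\<ge>1. finite_nash (L n) (G n) (g n)) \<and>
       (\<exists>r. strict_mono r \<and> r 0 \<ge> 1 \<and> (\<lambda>k. finite_summary (L (r k)) (g (r k))) \<longlonglongrightarrow> \<tau>))"


subsection \<open>The societal summaries are probability measures\<close>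

lemma borel_measurable_emeasure_prob_measure:
  fixes B :: "'a::metric_space set"
  assumes "B \<in> sets borel"
  shows "(\<lambda>\<mu>. emeasure (as_measure \<mu>) B) \<in> borel_measurable borel"
proof -
  have int [measurable]: "(\<lambda>\<mu>. \<integral>x. f x \<partial>as_measure \<mu>) \<in> borel_measurable borel" for f :: "'a \<Rightarrow>\<^sub>C real"
  proof (rule borel_measurableI)
    fix U :: "real set" assume "open U"
    then have "open {\<mu> :: 'a prob_measure. (\<integral>x. f x \<partial>as_measure \<mu>) \<in> U}"
      unfolding open_prob_measure_def by (blast intro: generate_topology.Basis)
    then show "(\<lambda>\<mu>. \<integral>x. f x \<partial>as_measure \<mu>) -` U \<inter> space borel \<in> sets borel"
      by (auto simp: vimage_def)
  qed
  have closed: "(\<lambda>\<mu>. measure (as_measure \<mu>) C) \<in> borel_measurable borel" if C: "closed C" for C :: "'a set"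
  proof (cases "C = {}")
    case False
    define h where "h n x = max 0 (1 - real n * infdist x C)" for n x
    have h: "h n \<in> bcontfun" for n
      unfolding bcontfun_def h_def bounded_iff
      by (auto intro!: continuous_intros exI[of _ 1] simp: infdist_nonneg)
    have lim: "(\<lambda>n. h n x) \<longlonglongrightarrow> indicator C x" for x
    proof (cases "x \<in> C")
      case True then show ?thesis by (simp add: h_def)
    next
      case xC: False
      then have pos: "infdist x C > 0" using C False by (intro infdist_pos_not_in_closed)
      then obtain N where N: "1 < real N * infdist x C" using reals_Archimedean3 by blast
      have "h n x = 0" if "n \<ge> N" for n
      proof -
        have "real N * infdist x C \<le> real n * infdist x C"
          using that pos by (intro mult_right_mono) auto
        then show ?thesis using N by (simp add: h_def)
      qed
      then have "\<forall>\<^sub>F n in sequentially. h n x = 0" by (rule eventually_sequentiallyI)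
      then show ?thesis using xC by (simp add: tendsto_eventually)
    qed
    have conv: "(\<lambda>n. \<integral>x. Bcontfun (h n) x \<partial>as_measure \<mu>) \<longlonglongrightarrow> measure (as_measure \<mu>) C" for \<mu>
    proof -
      interpret prob_space "as_measure \<mu>" by simp
      have "(\<lambda>n. \<integral>x. h n x \<partial>as_measure \<mu>) \<longlonglongrightarrow> (\<integral>x. indicator C x \<partial>as_measure \<mu>)"
      proof (rule integral_dominated_convergence[where w="\<lambda>_. 1"])
        show "h n \<in> borel_measurable (as_measure \<mu>)" for n
        proof -
          have "h n \<in> borel_measurable borel"
            using h[of n] by (intro borel_measurable_continuous_onI) (simp add: bcontfun_def)
          then show ?thesis by (simp cong: measurable_cong_sets)
        qed
        show "indicator C \<in> borel_measurable (as_measure \<mu>)"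
          using C by (intro borel_measurable_indicator) (simp add: borel_closed)
      qed (use lim in \<open>auto simp: h_def infdist_nonneg\<close>)
      then show ?thesis using C by (simp add: Bcontfun_inverse[OF h])
    qed
    show ?thesis by (rule borel_measurable_LIMSEQ_real[OF conv int])
  qed simp
  have "(\<lambda>\<mu>. measure (as_measure \<mu>) B) \<in> borel_measurable borel"
  proof -
    have "Int_stable (Collect closed :: 'a set set)" "Collect closed \<subseteq> Pow (UNIV :: 'a set)"
      by (auto simp: Int_stable_def)
    moreover have "B \<in> sigma_sets UNIV (Collect closed)"
      using assms by (simp add: borel_eq_closed)
    ultimately show ?thesis
    proof (induction rule: sigma_sets_induct_disjoint)
      case (compl A)
      then have A: "A \<in> sets borel" by (simp add: borel_eq_closed)
      have "measure (as_measure \<mu>) (UNIV - A) = 1 - measure (as_measure \<mu>) A" for \<mu>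
        using prob_space.prob_compl[of "as_measure \<mu>" A] A by simp
      with compl show ?case by simp
    next
      case (union A)
      then have A: "range A \<subseteq> sets borel" by (simp add: borel_eq_closed)
      have "(\<lambda>n. measure (as_measure \<mu>) (A n)) sums measure (as_measure \<mu>) (\<Union>i. A i)" for \<mu>
      proof -
        interpret prob_space "as_measure \<mu>" by simp
        show ?thesis using A union by (intro finite_measure_UNION) auto
      qed
      then have "measure (as_measure \<mu>) (\<Union>i. A i) = (\<Sum>n. measure (as_measure \<mu>) (A n))" for \<mu>
        by (rule sums_unique)
      with union show ?case by simp
    qed (auto simp: closed)
  qed
  moreover have "emeasure (as_measure \<mu>) B = ennreal (measure (as_measure \<mu>) B)" for \<mu>
  proof -
    interpret prob_space "as_measure \<mu>" by simp
    show ?thesis by (rule emeasure_eq_measure)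
  qed
  ultimately show ?thesis by simp
qed

lemma emeasure_large_summary:
  fixes g :: "'i \<Rightarrow> 'a::metric_space prob_measure"
  assumes "prob_space L" and g: "g \<in> borel_measurable L" and B: "B \<in> sets borel"
  shows "emeasure (as_measure (large_summary L g)) B = (\<integral>\<^sup>+ i. emeasure (as_measure (g i)) B \<partial>L)"
proof -
  interpret prob_space L by fact
  define m where "m B = (\<integral>\<^sup>+ i. emeasure (as_measure (g i)) B \<partial>L)" for B
  have meas: "(\<lambda>i. emeasure (as_measure (g i)) B) \<in> borel_measurable L" if "B \<in> sets borel" for B
    by (rule measurable_compose[OF g borel_measurable_emeasure_prob_measure[OF that]])
  have "countably_additive (sets borel) m"
  proof (rule countably_additiveI)
    fix A :: "nat \<Rightarrow> 'a set" assume A: "range A \<subseteq> sets borel" "disjoint_family A"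
    have "(\<Sum>n. m (A n)) = (\<integral>\<^sup>+ i. (\<Sum>n. emeasure (as_measure (g i)) (A n)) \<partial>L)"
      unfolding m_def using A by (intro nn_integral_suminf[symmetric] meas) auto
    also have "\<dots> = m (\<Union>n. A n)"
      unfolding m_def using A by (intro nn_integral_cong suminf_emeasure) auto
    finally show "(\<Sum>n. m (A n)) = m (\<Union>n. A n)" .
  qed
  moreover have "positive (sets borel) m" by (simp add: positive_def m_def)
  ultimately have em: "emeasure (measure_of UNIV (sets borel) m) C = m C" if "C \<in> sets borel" for C
    using that sets.sigma_algebra_axioms[of "borel :: 'a measure"]
    by (intro emeasure_measure_of_sigma) auto
  have "prob_space (measure_of UNIV (sets borel) m)"
  proof
    have "emeasure (as_measure (g i)) UNIV = 1" for i
      using prob_space.emeasure_space_1[OF prob_space_as_measure, of "g i"] by simp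
    then have "m UNIV = 1" by (simp add: m_def emeasure_space_1)
    then show "emeasure (measure_of UNIV (sets borel) m) (space (measure_of UNIV (sets borel) m)) = 1"
      using em[of UNIV] by (simp add: space_measure_of_conv)
  qed
  moreover have "sets (measure_of UNIV (sets borel) m) = sets (borel :: 'a measure)"
    using sets.sigma_sets_eq[of "borel :: 'a measure"] by (simp add: sets_measure_of_conv)
  ultimately have "as_measure (large_summary L g) = measure_of UNIV (sets borel) m"
    unfolding large_summary_def m_def by (intro Prob_Measure_inverse) simp
  with em[OF B] show ?thesis by (simp add: m_def)
qed

lemma nn_integral_finite_player_space:
  assumes "finite_player_space n L"
  shows "(\<integral>\<^sup>+ i. f i \<partial>L) = (\<Sum>i\<in>space L. emeasure L {i} * f i)"
proof -
  have L: "finite (space L)" "sets L = Pow (space L)"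
    using assms by (auto simp: finite_player_space_def)
  then have "L = point_measure (space L) (\<lambda>i. emeasure L {i})"
    by (intro measure_eqI_finite[of _ "space L"]) (auto simp: sets_point_measure emeasure_point_measure_finite)
  then show ?thesis
    using nn_integral_point_measure_finite[OF L(1), of "\<lambda>i. emeasure L {i}" f] by simp
qed

lemma finite_summary_eq_large_summary:
  assumes "finite_player_space n L"
  shows "finite_summary L g = large_summary L g"
  by (simp add: finite_summary_def large_summary_def nn_integral_finite_player_space[OF assms])

lemma emeasure_finite_summary:
  fixes g :: "'j \<Rightarrow> 'a::metric_space prob_measure"
  assumes L: "finite_player_space n L" and "B \<in> sets borel"
  shows "emeasure (as_measure (finite_summary L g)) B =
    (\<Sum>i\<in>space L. emeasure L {i} * emeasure (as_measure (g i)) B)"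
proof -
  have "prob_space L" and "g \<in> borel_measurable L"
    using L by (auto simp: finite_player_space_def measurable_def)
  from emeasure_large_summary[OF this assms(2)] show ?thesis
    by (simp add: finite_summary_eq_large_summary[OF L] nn_integral_finite_player_space[OF L])
qed

end

theory Submission
  imports Defs
begin

text \<open>Each \<open>G\<^sup>n\<close> has an equilibrium: solve games with finite action nets by Nash's map and refine the
  nets. As \<open>\<M>(A)\<close> is sequentially compact, it remains to show that a limit \<open>\<tau>\<close> of societal summaries
  of equilibria is an equilibrium distribution of \<open>G\<close>. Since no player is large, the realized action
  distribution concentrates at \<open>\<tau>\<close> (Chebyshev), so the average loss of the players of \<open>G\<^sup>n\<close> from not
  playing a best reply to \<open>\<tau>\<close> tends to \<open>0\<close>. Averaging the profiles of \<open>G\<^sup>n\<close> over a partition of unity on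
  the characteristics yields profiles of \<open>G\<close> with summary near \<open>\<tau>\<close> and small average loss. The
  profiles with error at most \<open>1/k\<close> form decreasing convex sets; minimizing a strictly convex
  functional on them produces an almost surely convergent sequence, whose limit has summary \<open>\<tau>\<close> and
  no loss. Randomized profiles may be averaged freely, so no purification is needed.\<close>

section \<open>Integrals and mixtures of probability measures\<close>

text \<open>The profiles of the finite games live on unrelated player spaces, and weak convergence
  of the laws of characteristics controls only averages of bounded continuous functions of the
  characteristic. So everything carried to the limit is written as such an average. This dictates
  the form of \<open>penalty\<close>: it is continuous in the characteristic, its mean is affine in
  the strategy, it vanishes exactly at feasible best replies, and it is cut off at 1 because the
  payoffs of all players share no common bound. A weak limit of the joint laws of characteristic and
  action would still have to be disintegrated over the given space \<open>L\<close>; averaging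
  followed by convex minimization builds a profile on \<open>L\<close> directly. Minimization enters
  because approximate profiles may oscillate from one index to the next, while the mean penalties of
  the players are passed to the limit player by player. The weak topology is handled without a
  metric: a dense sequence of test functions supplies neighbourhoods, measurability and
  convergence.\<close>

abbreviation mean :: "'a::topological_space prob_measure \<Rightarrow> ('a \<Rightarrow> real) \<Rightarrow> real" where
  "mean \<mu> f \<equiv> \<integral>x. f x \<partial>as_measure \<mu>"

lemma continuous_imp_bcontfun:
  fixes f :: "'a::metric_space \<Rightarrow> real"
  assumes "compact (UNIV :: 'a set)" and "continuous_on UNIV f"
  shows "f \<in> bcontfun"
  using compact_imp_bounded[OF compact_continuous_image[OF assms(2,1)]] assms(2)
  by (simp add: bcontfun_def)

lemma integrable_bounded_borel:
  fixes f :: "'a::topological_space \<Rightarrow> real"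
  assumes "f \<in> borel_measurable borel" and "\<And>x. \<bar>f x\<bar> \<le> B"
  shows "integrable (as_measure \<mu>) f"
proof -
  interpret prob_space "as_measure \<mu>" by simp
  have "f \<in> borel_measurable (as_measure \<mu>)"
    using assms(1) by (simp cong: measurable_cong_sets)
  then show ?thesis
    by (rule integrable_const_bound[rotated, where B=B]) (simp add: assms(2))
qed

lemma bcontfun_bound: "\<bar>apply_bcontfun f x\<bar> \<le> norm f" for f :: "'a::topological_space \<Rightarrow>\<^sub>C real"
  using norm_bounded[of f x] by simp

lemma borel_measurable_bcontfun: "apply_bcontfun f \<in> borel_measurable borel"
  by (intro borel_measurable_continuous_onI) simp

lemma integrable_bcontfun: "integrable (as_measure \<mu>) (apply_bcontfun f)" for f :: "_ \<Rightarrow>\<^sub>C real"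
  by (rule integrable_bounded_borel[OF borel_measurable_bcontfun bcontfun_bound])

lemma integrable_continuous:
  fixes f :: "'a::metric_space \<Rightarrow> real"
  assumes "compact (UNIV :: 'a set)" and "continuous_on UNIV f"
  shows "integrable (as_measure \<mu>) f"
  using integrable_bcontfun[of \<mu> "Bcontfun f"] continuous_imp_bcontfun[OF assms]
  by (simp add: Bcontfun_inverse)

lemma measure_as_measure_UNIV [simp]: "measure (as_measure \<mu>) UNIV = 1"
  and emeasure_as_measure_UNIV [simp]: "emeasure (as_measure \<mu>) UNIV = 1"
  using prob_space.prob_space[OF prob_space_as_measure, of \<mu>]
    prob_space.emeasure_space_1[OF prob_space_as_measure, of \<mu>] by simp_all

lemma mean_dirac:
  assumes "f \<in> borel_measurable borel"
  shows "mean (dirac a) f = f a"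
  using assms by (simp add: integral_return)

lemma integrable_const_as_measure [simp]: "integrable (as_measure \<mu>) (\<lambda>_. c :: real)"
  by (simp add: finite_measure.integrable_const prob_space.finite_measure)

lemma tendsto_mean:
  fixes X :: "'b \<Rightarrow> 'a::metric_space prob_measure"
  assumes "compact (UNIV :: 'a set)" and "continuous_on UNIV f" and "(X \<longlongrightarrow> \<mu>) F"
  shows "((\<lambda>n. mean (X n) f) \<longlongrightarrow> mean \<mu> f) F"
  using assms(3)[unfolded tendsto_prob_measure_iff, rule_format, of "Bcontfun f"]
    continuous_imp_bcontfun[OF assms(1,2)]
  by (simp add: Bcontfun_inverse)

lemma abs_mean_diff_le:
  assumes "integrable (as_measure \<mu>) f" "integrable (as_measure \<mu>) g" and "\<And>x. \<bar>f x - g x\<bar> \<le> c"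
  shows "\<bar>mean \<mu> f - mean \<mu> g\<bar> \<le> c"
proof -
  have "mean \<mu> f - mean \<mu> g = mean \<mu> (\<lambda>x. f x - g x)"
    using assms by simp
  also have "\<bar>\<dots>\<bar> \<le> mean \<mu> (\<lambda>x. \<bar>f x - g x\<bar>)" by (rule integral_abs_bound)
  also have "\<dots> \<le> mean \<mu> (\<lambda>_. c)"
    using assms prob_space.finite_measure[OF prob_space_as_measure, of \<mu>]
    by (intro integral_mono) (auto simp: finite_measure.integrable_const)
  finally show ?thesis by simp
qed

lemma abs_mean_le:
  assumes "\<And>x. \<bar>f x\<bar> \<le> c"
  shows "\<bar>mean \<mu> f\<bar> \<le> c"
proof (cases "integrable (as_measure \<mu>) f")
  case True
  then show ?thesis using abs_mean_diff_le[of \<mu> f "\<lambda>_. 0" c] assms by simp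
next
  case False
  then show ?thesis using assms order_trans[OF abs_ge_zero assms] by (simp add: not_integrable_integral_eq)
qed

section \<open>Measures are determined by their test integrals\<close>

lemma indicator_closed_approx:
  fixes C :: "'a::metric_space set"
  assumes C: "closed C"
  obtains h :: "nat \<Rightarrow> 'a \<Rightarrow> real"
  where "\<And>n. continuous_on UNIV (h n)" "\<And>n x. 0 \<le> h n x" "\<And>n x. h n x \<le> 1"
    "\<And>x. (\<lambda>n. h n x) \<longlonglongrightarrow> indicator C x"
proof (cases "C = {}")
  case True
  show thesis by (rule that[of "\<lambda>_ _. 0"]) (auto simp: True)
next
  case False
  define h where "h n x = max 0 (1 - real n * infdist x C)" for n x
  have lim: "(\<lambda>n. h n x) \<longlonglongrightarrow> indicator C x" for x
  proof (cases "x \<in> C")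
    case True then show ?thesis by (simp add: h_def)
  next
    case xC: False
    then have pos: "infdist x C > 0" using C False by (intro infdist_pos_not_in_closed)
    then obtain N where N: "1 < real N * infdist x C" using reals_Archimedean3 by blast
    have "h n x = 0" if "n \<ge> N" for n
    proof -
      have "real N * infdist x C \<le> real n * infdist x C"
        using that pos by (intro mult_right_mono) auto
      then show ?thesis using N by (simp add: h_def)
    qed
    then have "\<forall>\<^sub>F n in sequentially. h n x = 0" by (rule eventually_sequentiallyI)
    then show ?thesis using xC by (simp add: tendsto_eventually)
  qed
  show thesis
    by (rule that[of h]) (auto simp: h_def infdist_nonneg lim[unfolded h_def] intro!: continuous_intros)
qed

text \<open>Continuous functions decreasing to the indicator recover the mass of each closed set,
  and the closed sets form an intersection-stable generator of the Borel sets.\<close>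

lemma prob_measure_eqI:
  fixes \<mu> \<nu> :: "'a::metric_space prob_measure"
  assumes eq: "\<And>f :: 'a \<Rightarrow>\<^sub>C real. mean \<mu> f = mean \<nu> f"
  shows "\<mu> = \<nu>"
proof -
  have closed: "emeasure (as_measure \<mu>) C = emeasure (as_measure \<nu>) C" if C: "closed C" for C :: "'a set"
  proof -
    obtain h :: "nat \<Rightarrow> 'a \<Rightarrow> real" where h: "\<And>n. continuous_on UNIV (h n)" "\<And>n x. 0 \<le> h n x" "\<And>n x. h n x \<le> 1"
        "\<And>x. (\<lambda>n. h n x) \<longlonglongrightarrow> indicator C x"
      using indicator_closed_approx[OF C] by blast
    have conv: "(\<lambda>n. mean \<mu> (h n)) \<longlonglongrightarrow> measure (as_measure \<mu>) C" for \<mu>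
    proof -
      interpret prob_space "as_measure \<mu>" by simp
      have "(\<lambda>n. mean \<mu> (h n)) \<longlonglongrightarrow> mean \<mu> (indicator C)"
      proof (rule integral_dominated_convergence[where w="\<lambda>_. 1"])
        show "h n \<in> borel_measurable (as_measure \<mu>)" for n
          using borel_measurable_continuous_onI[OF h(1)] by (simp cong: measurable_cong_sets)
        show "indicator C \<in> borel_measurable (as_measure \<mu>)"
          using C by (intro borel_measurable_indicator) (simp add: borel_closed)
      qed (use h in auto)
      then show ?thesis using C by simp
    qed
    have "h n \<in> bcontfun" for n
      using h by (intro bcontfun_normI[of _ 1]) auto
    then have "mean \<mu> (h n) = mean \<nu> (h n)" for n
      using eq[of "Bcontfun (h n)"] by (simp add: Bcontfun_inverse)
    then have "measure (as_measure \<mu>) C = measure (as_measure \<nu>) C"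
      using LIMSEQ_unique conv[of \<mu>] conv[of \<nu>] by simp
    then show ?thesis
      by (simp add: finite_measure.emeasure_eq_measure prob_space.finite_measure)
  qed
  have "as_measure \<mu> = as_measure \<nu>"
  proof (rule measure_eqI_generator_eq[where E="Collect closed" and \<Omega>=UNIV and A="\<lambda>_. UNIV"])
    show "Int_stable (Collect closed :: 'a set set)" by (auto simp: Int_stable_def)
    show "sets (as_measure \<mu>) = sigma_sets UNIV (Collect closed)"
      and "sets (as_measure \<nu>) = sigma_sets UNIV (Collect closed)"
      by (simp_all add: borel_eq_closed)
    show "emeasure (as_measure \<mu>) UNIV \<noteq> \<infinity>"
      by simp
  qed (auto simp: closed)
  then show ?thesis by (simp add: as_measure_inject)
qed

lemma tendsto_prob_measure_unique:
  fixes X :: "nat \<Rightarrow> 'a::metric_space prob_measure"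
  assumes "X \<longlonglongrightarrow> \<mu>" "X \<longlonglongrightarrow> \<nu>"
  shows "\<mu> = \<nu>"
  using assms unfolding tendsto_prob_measure_iff
  by (intro prob_measure_eqI) (blast intro: LIMSEQ_unique)

section \<open>Integration against societal summaries and finite mixtures\<close>

lemma measurable_as_measure_subprob:
  fixes g :: "'i \<Rightarrow> 'a::metric_space prob_measure"
  assumes "g \<in> borel_measurable L"
  shows "(\<lambda>i. as_measure (g i)) \<in> measurable L (subprob_algebra borel)"
proof (rule measurable_subprob_algebra)
  fix B :: "'a set" assume "B \<in> sets borel"
  then show "(\<lambda>i. emeasure (as_measure (g i)) B) \<in> borel_measurable L"
    using measurable_compose[OF assms borel_measurable_emeasure_prob_measure] by blast
qed (auto intro: prob_space_imp_subprob_space)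

lemma borel_measurable_mean:
  fixes g :: "'i \<Rightarrow> 'a::metric_space prob_measure"
  assumes "g \<in> borel_measurable L" and "f \<in> borel_measurable borel"
  shows "(\<lambda>i. mean (g i) f) \<in> borel_measurable L"
  using measurable_compose[OF measurable_as_measure_subprob[OF assms(1)]
      integral_measurable_subprob_algebra[OF assms(2)]] .

text \<open>Summation over players is the bind of the Giry monad, so integrals against a summary
  become iterated integrals through \<open>integral_bind\<close>.\<close>

lemma as_measure_large_summary:
  fixes g :: "'i \<Rightarrow> 'a::metric_space prob_measure"
  assumes L: "prob_space L" and g: "g \<in> borel_measurable L"
  shows "as_measure (large_summary L g) = L \<bind> (\<lambda>i. as_measure (g i))"
proof (rule measure_eqI)
  have ne: "space L \<noteq> {}" using L by (simp add: prob_space.not_empty)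
  note m = measurable_as_measure_subprob[OF g]
  show "sets (as_measure (large_summary L g)) = sets (L \<bind> (\<lambda>i. as_measure (g i)))"
    using sets_bind[OF _ ne, of "\<lambda>i. as_measure (g i)" borel] by simp
  fix B assume "B \<in> sets (as_measure (large_summary L g))"
  then have B: "B \<in> sets borel" by simp
  show "emeasure (as_measure (large_summary L g)) B = emeasure (L \<bind> (\<lambda>i. as_measure (g i))) B"
    by (simp add: emeasure_large_summary[OF L g B] emeasure_bind[OF ne m B])
qed

lemma mean_large_summary:
  fixes g :: "'i \<Rightarrow> 'a::metric_space prob_measure"
  assumes L: "prob_space L" and g: "g \<in> borel_measurable L"
    and f: "f \<in> borel_measurable borel" "\<And>x. \<bar>f x\<bar> \<le> B"
  shows "mean (large_summary L g) f = (\<integral>i. mean (g i) f \<partial>L)"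
  unfolding as_measure_large_summary[OF L g]
proof (rule integral_bind[where K=borel and B=B and B'=1])
  show "(\<lambda>i. as_measure (g i)) \<in> measurable L (subprob_algebra borel)"
    by (rule measurable_as_measure_subprob[OF g])
  show "finite_measure L" using L by (rule prob_space.finite_measure)
qed (use f in auto)

lemma finite_player_spaceD:
  assumes "finite_player_space n L"
  shows "prob_space L" "finite (space L)" "sets L = Pow (space L)"
    and "\<And>i. i \<in> space L \<Longrightarrow> 0 \<le> measure L {i}"
    and "(\<Sum>i\<in>space L. measure L {i}) = 1"
    and "\<And>f :: _ \<Rightarrow> 'b::topological_space. f \<in> borel_measurable L"
    and "\<And>f :: _ \<Rightarrow> real. (\<integral>i. f i \<partial>L) = (\<Sum>i\<in>space L. measure L {i} * f i)"
proof -
  show L: "prob_space L" "finite (space L)" "sets L = Pow (space L)"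
    using assms by (auto simp: finite_player_space_def)
  then interpret prob_space L by simp
  show "f \<in> borel_measurable L" for f :: "_ \<Rightarrow> 'b::topological_space"
    using L by (auto simp: measurable_def)
  show int: "(\<integral>i. f i \<partial>L) = (\<Sum>i\<in>space L. measure L {i} * f i)" for f :: "_ \<Rightarrow> real"
  proof -
    have "L = point_measure (space L) (\<lambda>i. measure L {i})"
      using L by (intro measure_eqI_finite[of _ "space L"])
        (auto simp: sets_point_measure emeasure_point_measure_finite emeasure_eq_measure)
    then have "(\<integral>i. f i \<partial>L) = (\<integral>i. f i \<partial>point_measure (space L) (\<lambda>i. measure L {i}))" by simp
    also have "\<dots> = (\<Sum>i\<in>space L. measure L {i} * f i)"
      using L by (subst lebesgue_integral_point_measure_finite) auto
    finally show ?thesis .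
  qed
  show "(\<Sum>i\<in>space L. measure L {i}) = 1" using int[of "\<lambda>_. 1"] by (simp add: prob_space)
qed simp

lemma mean_finite_summary:
  fixes g :: "'j \<Rightarrow> 'a::metric_space prob_measure"
  assumes L: "finite_player_space n L"
    and f: "f \<in> borel_measurable borel" "\<And>x. \<bar>f x\<bar> \<le> B"
  shows "mean (finite_summary L g) f = (\<Sum>i\<in>space L. measure L {i} * mean (g i) f)"
  unfolding finite_summary_eq_large_summary[OF L]
  by (subst mean_large_summary[where B=B]) (use finite_player_spaceD[OF L] f in auto)

text \<open>A convex combination, encoded as the summary of the profile \<open>m\<close> over the
  weighted finite set \<open>C\<close>, so that its integrals come from
  \<open>mean_large_summary\<close>. It has this meaning only for nonnegative weights with sum
  1.\<close>

definition mix :: "'c set \<Rightarrow> ('c \<Rightarrow> real) \<Rightarrow> ('c \<Rightarrow> 'a::metric_space prob_measure) \<Rightarrow> 'a prob_measure" where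
  "mix C w m = large_summary (point_measure C w) m"

lemma mean_mix:
  assumes C: "finite C" "\<And>c. c \<in> C \<Longrightarrow> 0 \<le> w c" "(\<Sum>c\<in>C. w c) = 1"
    and f: "f \<in> borel_measurable borel" "\<And>x. \<bar>f x\<bar> \<le> B"
  shows "mean (mix C w m) f = (\<Sum>c\<in>C. w c * mean (m c) f)"
proof -
  have "mean (mix C w m) f = (\<integral>c. mean (m c) f \<partial>point_measure C w)"
    unfolding mix_def
    by (rule mean_large_summary[OF _ _ f]) (use C in \<open>auto intro: prob_space_point_measure\<close>)
  also have "\<dots> = (\<Sum>c\<in>C. w c * mean (m c) f)"
    using C by (subst lebesgue_integral_point_measure_finite) auto
  finally show ?thesis .
qed

lemma mean_mix_continuous:
  fixes m :: "'c \<Rightarrow> 'a::metric_space prob_measure"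
  assumes "compact (UNIV :: 'a set)" "continuous_on UNIV f"
    and C: "finite C" "\<And>c. c \<in> C \<Longrightarrow> 0 \<le> w c" "(\<Sum>c\<in>C. w c) = 1"
  shows "mean (mix C w m) f = (\<Sum>c\<in>C. w c * mean (m c) f)"
proof -
  have "mean (mix C w m) (Bcontfun f) = (\<Sum>c\<in>C. w c * mean (m c) (Bcontfun f))"
    by (rule mean_mix[OF C borel_measurable_bcontfun bcontfun_bound])
  then show ?thesis using continuous_imp_bcontfun[OF assms(1,2)] by (simp add: Bcontfun_inverse)
qed

text \<open>Feasibility becomes the vanishing of one bounded continuous test integral and hence
  survives weak limits; a condition on the mass of \<open>K\<close> would not visibly do so.\<close>

lemma measure_eq_1_iff_mean_infdist:
  fixes K :: "'a::metric_space set"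
  assumes K: "closed K" "K \<noteq> {}"
  shows "measure (as_measure \<mu>) K = 1 \<longleftrightarrow> mean \<mu> (\<lambda>a. min 1 (infdist a K)) = 0"
proof -
  interpret prob_space "as_measure \<mu>" by simp
  have "continuous_on UNIV (\<lambda>a. min 1 (infdist a K))" by (intro continuous_intros)
  then have int: "integrable (as_measure \<mu>) (\<lambda>a. min 1 (infdist a K))"
    by (intro integrable_bounded_borel[where B=1] borel_measurable_continuous_onI)
      (auto simp: infdist_nonneg min_def abs_le_iff intro: order_trans[OF infdist_nonneg])
  have "mean \<mu> (\<lambda>a. min 1 (infdist a K)) = 0 \<longleftrightarrow> (AE a in as_measure \<mu>. min 1 (infdist a K) = 0)"
    using int by (intro integral_nonneg_eq_0_iff_AE) (auto simp: infdist_nonneg)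
  also have "\<dots> \<longleftrightarrow> (AE a in as_measure \<mu>. a \<in> K)"
    using K by (intro AE_cong) (auto simp: in_closed_iff_infdist_zero min_def)
  also have "\<dots> \<longleftrightarrow> measure (as_measure \<mu>) K = 1"
    using K by (simp add: prob_eq_1 borel_closed)
  finally show ?thesis ..
qed

lemma measure_eq_1_imp_AE:
  fixes K :: "'a::metric_space set"
  assumes "closed K" "measure (as_measure \<mu>) K = 1"
  shows "AE a in as_measure \<mu>. a \<in> K"
  using assms prob_space.prob_eq_1[OF prob_space_as_measure, of K \<mu>] by (simp add: borel_closed)

lemma measure_eq_1_tendsto:
  fixes K :: "'a::metric_space set"
  assumes "compact (UNIV :: 'a set)" "closed K" "K \<noteq> {}" "X \<longlonglongrightarrow> \<mu>"
    and "\<And>n::nat. measure (as_measure (X n)) K = 1"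
  shows "measure (as_measure \<mu>) K = 1"
proof -
  have "(\<lambda>n. mean (X n) (\<lambda>a. min 1 (infdist a K))) \<longlonglongrightarrow> mean \<mu> (\<lambda>a. min 1 (infdist a K))"
    using assms by (intro tendsto_mean) (auto intro!: continuous_intros)
  moreover have "mean (X n) (\<lambda>a. min 1 (infdist a K)) = 0" for n
    using assms by (simp flip: measure_eq_1_iff_mean_infdist)
  ultimately show ?thesis
    using assms by (simp add: measure_eq_1_iff_mean_infdist LIMSEQ_const_iff)
qed

section \<open>Test functions and the weak topology\<close>

definition partition_of_unity ::
    "'a::metric_space set \<Rightarrow> real \<Rightarrow> 'a set \<Rightarrow> ('a \<Rightarrow> 'a \<Rightarrow> real) \<Rightarrow> bool" where
  "partition_of_unity K \<delta> C \<phi> \<longleftrightarrow> finite C \<and> C \<subseteq> K \<and> K \<subseteq> (\<Union>c\<in>C. ball c \<delta>) \<and>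
     (\<forall>c. continuous_on UNIV (\<phi> c)) \<and> (\<forall>c a. 0 \<le> \<phi> c a) \<and>
     (\<forall>a\<in>K. (\<Sum>c\<in>C. \<phi> c a) = 1) \<and> (\<forall>c a. \<phi> c a > 0 \<longrightarrow> dist a c < \<delta>)"

lemma partition_of_unityD:
  assumes "partition_of_unity K \<delta> C \<phi>"
  shows "finite C" "C \<subseteq> K" "K \<subseteq> (\<Union>c\<in>C. ball c \<delta>)" "\<And>c. continuous_on UNIV (\<phi> c)"
    "\<And>c a. 0 \<le> \<phi> c a" "\<And>a. a \<in> K \<Longrightarrow> (\<Sum>c\<in>C. \<phi> c a) = 1"
    "\<And>c a. \<phi> c a > 0 \<Longrightarrow> dist a c < \<delta>"
  using assms by (auto simp: partition_of_unity_def)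

lemma ex_partition_of_unity:
  fixes K :: "'a::metric_space set"
  assumes K: "compact K" and \<delta>: "\<delta> > 0"
  shows "\<exists>C \<phi>. partition_of_unity K \<delta> C \<phi>"
proof -
  obtain C where C: "C \<subseteq> K" "finite C" "K \<subseteq> (\<Union>c\<in>C. ball c (\<delta>/2))"
    by (rule compactE_image[OF K, of K "\<lambda>c. ball c (\<delta>/2)"]) (use \<delta> in auto)
  define b where "b c a = max 0 (\<delta> - dist a c)" for c a :: 'a
  \<comment> \<open>The bound \<delta>/2 keeps the denominator positive where no centre is near. On
    \<open>K\<close> some centre lies within \<delta>/2, so the sum is at least \<delta>/2 and the
    quotients add up to 1.\<close>
  define \<phi> where "\<phi> c a = b c a / max (\<Sum>c\<in>C. b c a) (\<delta>/2)" for c a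
  have b: "0 \<le> b c a" for c a by (simp add: b_def)
  have pos: "max (\<Sum>c\<in>C. b c a) (\<delta>/2) > 0" for a using \<delta> by (simp add: less_max_iff_disj)
  show ?thesis
    unfolding partition_of_unity_def
  proof (intro exI[of _ C] exI[of _ \<phi>] conjI allI ballI impI)
    have "continuous_on UNIV (b c)" for c unfolding b_def by (intro continuous_intros)
    then show "continuous_on UNIV (\<phi> c)" for c
      unfolding \<phi>_def using pos by (intro continuous_intros) (auto simp: less_imp_neq[symmetric])
    show "0 \<le> \<phi> c a" for c a using b pos[of a] by (simp add: \<phi>_def)
    show "(\<Sum>c\<in>C. \<phi> c a) = 1" if "a \<in> K" for a
    proof -
      have "a \<in> (\<Union>c\<in>C. ball c (\<delta>/2))" using that C(3) by (rule subsetD[rotated])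
      then obtain c where "c \<in> C" "a \<in> ball c (\<delta>/2)" by blast
      then have c: "c \<in> C" "dist c a < \<delta>/2" by (simp_all only: mem_ball)
      then have "\<delta>/2 \<le> \<delta> - dist a c" by (simp add: dist_commute field_simps)
      also have "\<dots> \<le> b c a" by (simp add: b_def)
      also have "b c a \<le> (\<Sum>c\<in>C. b c a)" using c C b by (intro member_le_sum) auto
      finally show ?thesis using pos[of a] \<delta> by (simp add: \<phi>_def flip: sum_divide_distrib)
    qed
    show "dist a c < \<delta>" if "\<phi> c a > 0" for c a
    proof -
      have "b c a > 0" using that b[of c a] by (cases "b c a = 0") (auto simp: \<phi>_def)
      then show ?thesis by (simp add: b_def less_max_iff_disj)
    qed
    show "K \<subseteq> (\<Union>c\<in>C. ball c \<delta>)"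
      using C(3) subset_ball[of "\<delta>/2" \<delta>] \<delta> by force
  qed (use C in auto)
qed

text \<open>Closeness is demanded only at indices of positive weight, which is what the support
  clause of a partition of unity provides.\<close>

lemma weighted_sum_diff_le:
  fixes x :: real
  assumes "\<And>c. c \<in> C \<Longrightarrow> 0 \<le> w c" "(\<Sum>c\<in>C. w c) = 1"
    and "\<And>c. c \<in> C \<Longrightarrow> 0 < w c \<Longrightarrow> \<bar>y c - x\<bar> \<le> e"
  shows "\<bar>(\<Sum>c\<in>C. w c * y c) - x\<bar> \<le> e"
proof -
  have "(\<Sum>c\<in>C. w c * (y c - x)) = (\<Sum>c\<in>C. w c * y c) - (\<Sum>c\<in>C. w c) * x"
    by (simp only: right_diff_distrib sum_subtractf sum_distrib_right)
  then have "(\<Sum>c\<in>C. w c * y c) - x = (\<Sum>c\<in>C. w c * (y c - x))"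
    using assms(2) by simp
  also have "\<bar>\<dots>\<bar> \<le> (\<Sum>c\<in>C. w c * e)"
  proof (intro order_trans[OF sum_abs] sum_mono)
    fix c assume c: "c \<in> C"
    show "\<bar>w c * (y c - x)\<bar> \<le> w c * e"
    proof (cases "w c = 0")
      case False
      then have "0 < w c" using assms(1)[OF c] by simp
      with assms(3)[OF c this] show ?thesis by (simp add: abs_mult)
    qed simp
  qed
  also have "(\<Sum>c\<in>C. w c * e) = e"
    using assms(2) by (simp only: sum_distrib_right[symmetric] mult_1)
  finally show ?thesis .
qed

lemma compact_UNIV_uniformly_continuous:
  fixes f :: "'a::metric_space \<Rightarrow> real"
  assumes "compact (UNIV :: 'a set)" "continuous_on UNIV f" "e > 0"
  obtains d where "d > 0" "\<And>a b. dist a b < d \<Longrightarrow> \<bar>f a - f b\<bar> < e"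
proof -
  have "uniformly_continuous_on UNIV f" by (rule compact_uniformly_continuous[OF assms(2,1)])
  then obtain d where d: "d > 0" "\<forall>a\<in>UNIV. \<forall>b\<in>UNIV. dist b a < d \<longrightarrow> dist (f b) (f a) < e"
    unfolding uniformly_continuous_on_def by (elim allE[of _ e] impE exE conjE) (use assms(3) in auto)
  show thesis by (rule that[OF d(1)]) (use d(2) in \<open>simp add: dist_real_def\<close>)
qed

definition dense_seq :: "(nat \<Rightarrow> ('a::metric_space \<Rightarrow>\<^sub>C real)) \<Rightarrow> bool" where
  "dense_seq F \<longleftrightarrow> (\<forall>f. \<forall>e>0. \<exists>n. dist (F n) f < e)"

text \<open>On a fine partition of unity \<open>f\<close> is uniformly close to its interpolation
  with coefficients \<open>f c\<close>, and these finitely many coefficients may be moved to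
  rationals. Extensional coefficient families over a finite net are countable in number.\<close>

lemma ex_dense_seq:
  assumes cpt: "compact (UNIV :: 'a::metric_space set)"
  shows "\<exists>F :: nat \<Rightarrow> ('a \<Rightarrow>\<^sub>C real). dense_seq F"
proof -
  have "\<forall>n. \<exists>C \<phi>. partition_of_unity (UNIV :: 'a set) (inverse (real (Suc n))) C \<phi>"
    by (intro allI ex_partition_of_unity[OF cpt]) simp
  then obtain C :: "nat \<Rightarrow> 'a set" and \<phi>
    where "\<And>n. partition_of_unity UNIV (inverse (real (Suc n))) (C n) (\<phi> n)" by metis
  note C = partition_of_unityD(1,4,5,6,7)[OF this]
  define D where "D = (\<Union>n. (\<lambda>q. Bcontfun (\<lambda>a. \<Sum>c\<in>C n. \<phi> n c a * q c)) ` PiE (C n) (\<lambda>_. \<rat>))"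
  have "countable D"
    unfolding D_def using C(1) by (intro countable_UN countable_image countable_PiE) (auto simp: countable_rat)
  have dense: "\<exists>g\<in>D. dist g f < e" if "e > 0" for f :: "'a \<Rightarrow>\<^sub>C real" and e
  proof -
    obtain d where d: "d > 0" "\<And>a b. dist a b < d \<Longrightarrow> \<bar>f a - f b\<bar> < e/4"
      using compact_UNIV_uniformly_continuous[OF cpt, of f "e/4"] \<open>e > 0\<close> by auto
    obtain n where n: "inverse (real (Suc n)) < d" using reals_Archimedean[OF d(1)] by auto
    have "\<exists>q\<in>\<rat>. \<bar>q - f c\<bar> < e/4" for c
    proof -
      obtain q where "q \<in> \<rat>" "f c - e/4 < q" "q < f c + e/4"
        using Rats_dense_in_real[of "f c - e/4" "f c + e/4"] \<open>e > 0\<close> by auto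
      then show ?thesis by (intro bexI[of _ q]) linarith+
    qed
    then obtain q where q: "\<And>c. q c \<in> \<rat>" "\<And>c. \<bar>q c - f c\<bar> < e/4" by metis
    let ?g = "\<lambda>a. \<Sum>c\<in>C n. \<phi> n c a * restrict q (C n) c"
    have "continuous_on UNIV ?g" by (intro continuous_intros C(2))
    then have g: "apply_bcontfun (Bcontfun ?g) = ?g"
      by (intro Bcontfun_inverse continuous_imp_bcontfun[OF cpt])
    have "\<bar>?g a - f a\<bar> \<le> e/2" for a
    proof (rule weighted_sum_diff_le)
      fix c assume c: "c \<in> C n" "0 < \<phi> n c a"
      then have "dist a c < d" using C(5)[OF c(2)] n by linarith
      then have "\<bar>f a - f c\<bar> < e/4" by (rule d)
      with q(2)[of c] have "\<bar>q c - f a\<bar> \<le> e/2" by linarith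
      with c show "\<bar>restrict q (C n) c - f a\<bar> \<le> e/2" by simp
    qed (simp_all add: C(3,4))
    then have "dist (Bcontfun ?g) f \<le> e/2" by (intro dist_bound) (simp only: g dist_real_def)
    moreover have "Bcontfun ?g \<in> D"
      unfolding D_def using q by (intro UN_I[of n] imageI) auto
    ultimately show ?thesis using \<open>e > 0\<close> by (intro bexI[of _ "Bcontfun ?g"]) auto
  qed
  have "D \<noteq> {}" using dense[of 1] by auto
  have "dense_seq (from_nat_into D)"
    unfolding dense_seq_def
    using dense from_nat_into_surj[OF \<open>countable D\<close>] by metis
  then show ?thesis by blast
qed

section \<open>Sequential compactness of the space of probability measures\<close>

text \<open>Base 3 with digits 0 and 1, as in the Cantor set: the tail behind a digit contributes at
  most half of that digit's value, so that close codes have equal initial digits. Base 2 would not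
  separate them.\<close>

definition ternary :: "(nat \<Rightarrow> bool) \<Rightarrow> real" where
  "ternary x = (\<Sum>k. (1/3)^k * of_bool (x k))"

lemma summable_ternary: "summable (\<lambda>k. (1/3)^k * of_bool (x k) :: real)"
  by (rule summable_comparison_test'[of "\<lambda>k. (1/3)^k" 0]) (auto simp: summable_geometric)

lemma ternary_bounds: "0 \<le> ternary x" "ternary x \<le> 3/2"
proof -
  show "0 \<le> ternary x" unfolding ternary_def by (intro suminf_nonneg summable_ternary) simp
  have "ternary x \<le> (\<Sum>k. (1/3)^k)"
    unfolding ternary_def by (intro suminf_le summable_ternary summable_geometric) auto
  also have "\<dots> = 3/2" by (subst suminf_geometric) auto
  finally show "ternary x \<le> 3/2" .
qed

lemma ternary_Suc: "ternary x = of_bool (x 0) + ternary (\<lambda>k. x (Suc k)) / 3"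
proof -
  have "ternary x = (\<Sum>k. (1/3)^Suc k * of_bool (x (Suc k))) + of_bool (x 0)"
    using suminf_split_head[OF summable_ternary, of x] by (simp add: ternary_def)
  also have "(\<Sum>k. (1/3)^Suc k * of_bool (x (Suc k))) = (\<Sum>k. (1/3) * ((1/3)^k * of_bool (x (Suc k))) :: real)"
    by (simp add: mult.assoc)
  also have "\<dots> = ternary (\<lambda>k. x (Suc k)) / 3"
    by (subst suminf_mult[OF summable_ternary]) (simp add: ternary_def)
  finally show ?thesis by simp
qed

text \<open>Codes with different first digits are at least 1/2 apart, and the threshold is at most
  1/2 once \<open>N\<close> is positive. Removing a common first digit triples both the difference
  and the threshold, which is the induction step.\<close>

lemma ternary_close_imp_agree:
  assumes "\<bar>ternary x - ternary y\<bar> < 3/2 * (1/3)^N" and "k < N"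
  shows "x k = y k"
  using assms
proof (induction N arbitrary: x y k)
  case (Suc N)
  let ?x = "\<lambda>k. x (Suc k)" and ?y = "\<lambda>k. y (Suc k)"
  have "(1/3::real)^N \<le> 1" by (intro power_le_one) auto
  then have lt: "\<bar>ternary x - ternary y\<bar> < 1/2" using Suc.prems(1) by simp
  have eq: "x 0 = y 0"
  proof (rule ccontr)
    assume "x 0 \<noteq> y 0"
    then show False
      using lt ternary_bounds[of ?x] ternary_bounds[of ?y]
      by (cases "x 0"; cases "y 0") (auto simp: ternary_Suc[of x] ternary_Suc[of y])
  qed
  show ?case
  proof (cases k)
    case 0 then show ?thesis using eq by simp
  next
    case (Suc k')
    have "\<bar>ternary ?x - ternary ?y\<bar> < 3/2 * (1/3)^N"
      using Suc.prems(1) eq by (simp add: ternary_Suc[of x] ternary_Suc[of y] flip: diff_divide_distrib)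
    from Suc.IH[OF this, of k'] Suc.prems(2) \<open>k = Suc k'\<close> show ?thesis by simp
  qed
qed simp

text \<open>The digits of the code record which balls of a countable family contain the point. The
  code is Borel but in general not continuous; its inverse is uniformly continuous because points
  with close codes lie in a common small ball.\<close>

lemma ex_real_code:
  assumes cpt: "compact (UNIV :: 'a::metric_space set)"
  obtains s :: "'a::metric_space \<Rightarrow> real" where "s \<in> borel_measurable borel" "\<And>a. 0 \<le> s a" "\<And>a. s a \<le> 3/2"
    "\<And>e. e > 0 \<Longrightarrow> \<exists>d>0. \<forall>a b. \<bar>s a - s b\<bar> < d \<longrightarrow> dist a b < e"
proof -
  have "\<forall>n. \<exists>C \<phi>. partition_of_unity (UNIV :: 'a set) (inverse (real (Suc n))) C \<phi>"
    by (intro allI ex_partition_of_unity[OF cpt]) simp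
  then obtain C :: "nat \<Rightarrow> 'a set" and \<phi>
    where C': "\<And>n. partition_of_unity UNIV (inverse (real (Suc n))) (C n) (\<phi> n)" by metis
  note C = partition_of_unityD(1,3)[OF C']
  define \<B> where "\<B> = (\<Union>n. (\<lambda>c. ball c (inverse (real (Suc n)))) ` C n)"
  have "countable \<B>" unfolding \<B>_def using C(1) by (auto intro: countable_finite)
  have "C 0 \<noteq> {}" using C(2)[of 0] by auto
  then have "\<B> \<noteq> {}" by (auto simp: \<B>_def)
  define B where "B = from_nat_into \<B>"
  have B: "open (B k)" for k
    using from_nat_into[OF \<open>\<B> \<noteq> {}\<close>, of k] by (auto simp: B_def \<B>_def)
  define s where "s a = ternary (\<lambda>k. a \<in> B k)" for a
  show thesis
  proof (rule that[of s])
    show "s \<in> borel_measurable borel"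
      unfolding s_def ternary_def
      by (intro borel_measurable_suminf borel_measurable_times borel_measurable_const)
        (use B in \<open>auto simp: of_bool_def intro!: measurable_If\<close>)
    show "\<exists>d>0. \<forall>a b. \<bar>s a - s b\<bar> < d \<longrightarrow> dist a b < e" if "e > 0" for e
    proof -
      obtain n where n: "inverse (real (Suc n)) < e/2" using reals_Archimedean[of "e/2"] \<open>e > 0\<close> by auto
      have "\<forall>c\<in>C n. \<exists>k. B k = ball c (inverse (real (Suc n)))"
        unfolding B_def using from_nat_into_surj[OF \<open>countable \<B>\<close>] by (auto simp: \<B>_def)
      then obtain idx where idx: "\<And>c. c \<in> C n \<Longrightarrow> B (idx c) = ball c (inverse (real (Suc n)))"
        by metis
      \<comment> \<open>Larger than the index of every ball of the net \<open>C n\<close>, so codes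
        this close agree on membership in all of these balls.\<close>
      define N where "N = Suc (Max (idx ` C n))"
      show ?thesis
      proof (intro exI[of _ "3/2 * (1/3)^N"] conjI allI impI)
        fix a b assume ab: "\<bar>s a - s b\<bar> < 3/2 * (1/3)^N"
        obtain c where c: "c \<in> C n" "a \<in> ball c (inverse (real (Suc n)))" using C(2)[of n] by blast
        have "idx c < N" unfolding N_def using C(1) c by (simp add: le_imp_less_Suc)
        from ternary_close_imp_agree[OF ab[unfolded s_def] this]
        have "b \<in> ball c (inverse (real (Suc n)))" using idx[OF c(1)] c(2) by simp
        with c(2) n show "dist a b < e" using dist_triangle_half_r[of c a e b] by auto
      qed simp
    qed
  qed (use ternary_bounds in \<open>auto simp: s_def\<close>)
qed

text \<open>Coding the compact space \<open>A\<close> by reals through a Borel map whose inverse is uniformly continuous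
  reduces the claim to Helly's selection theorem.\<close>

theorem seq_compact_prob_measure:
  assumes cpt: "compact (UNIV :: 'a::metric_space set)"
  shows "seq_compact (UNIV :: 'a prob_measure set)"
proof (rule seq_compactI)
  fix X :: "nat \<Rightarrow> 'a prob_measure"
  obtain s :: "'a \<Rightarrow> real" where s [measurable]: "s \<in> borel_measurable borel"
    and s01: "\<And>a. 0 \<le> s a" "\<And>a. s a \<le> 3/2"
    and inv: "\<And>e. e > 0 \<Longrightarrow> \<exists>d>0. \<forall>a b. \<bar>s a - s b\<bar> < d \<longrightarrow> dist a b < e"
    using ex_real_code[OF cpt] by blast
  define \<nu> where "\<nu> n = distr (as_measure (X n)) borel s" for n
  have s_meas: "s \<in> borel_measurable (as_measure \<mu>)" for \<mu> by measurable
  have rd: "real_distribution (\<nu> n)" for n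
    unfolding real_distribution_def real_distribution_axioms_def \<nu>_def
    using s_meas by (auto intro: prob_space.prob_space_distr)
  have "tight \<nu>"
    unfolding tight_def
  proof (intro conjI allI impI rd)
    fix \<epsilon> :: real assume "\<epsilon> > 0"
    have "measure (\<nu> n) {-1<..2} = 1" for n
    proof -
      have "s -` {-1<..2} = UNIV"
      proof (intro equalityI subset_UNIV subsetI)
        fix a show "a \<in> s -` {-1<..2}" using s01[of a] by simp
      qed
      then show ?thesis unfolding \<nu>_def using s_meas by (subst measure_distr) auto
    qed
    with \<open>\<epsilon> > 0\<close> show "\<exists>a b. a < b \<and> (\<forall>n. 1 - \<epsilon> < measure (\<nu> n) {a<..b})"
      by (intro exI[of _ "-1"] exI[of _ 2]) auto
  qed
  then obtain r M where r: "strict_mono (r :: nat \<Rightarrow> nat)" and M: "real_distribution M"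
    and conv: "weak_conv_m (\<nu> \<circ> id \<circ> r) M"
    using tight_imp_convergent_subsubsequence[of \<nu> id] by (auto simp: strict_mono_def)
  interpret M: real_distribution M by fact
  interpret \<nu>: real_distribution "\<nu> n" for n by (rule rd)
  have int_conv: "(\<lambda>n. \<integral>x. f x \<partial>\<nu> (r n)) \<longlonglongrightarrow> (\<integral>x. f x \<partial>M)"
    if "continuous_on UNIV f" "\<And>x. norm (f x) \<le> B" for f :: "real \<Rightarrow> real" and B
    using weak_conv_imp_integral_bdd_continuous_conv[OF _ M conv, of f B] that rd
    by (simp add: continuous_on_eq_continuous_at)
  \<comment> \<open>The limit law on the line may charge points that code nothing, but none outside
    the closure of the codes: the truncated distance to \<open>K\<close> has integral 0 along the
    sequence, hence also in the limit.\<close>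
  define K where "K = closure (range s)"
  have K: "closed K" "K \<noteq> {}" "s a \<in> K" for a
    using closure_subset[of "range s"] by (auto simp: K_def)
  have \<nu>_int: "(\<integral>x. f x \<partial>\<nu> n) = mean (X n) (\<lambda>a. f (s a))" if "f \<in> borel_measurable borel" for f :: "real \<Rightarrow> real" and n
    unfolding \<nu>_def using that s_meas by (subst integral_distr) auto
  have AE_K: "AE x in M. x \<in> K"
  proof -
    let ?f = "\<lambda>x. min 1 (infdist x K)"
    have f: "continuous_on UNIV ?f" by (intro continuous_intros)
    have "(\<lambda>n. \<integral>x. ?f x \<partial>\<nu> (r n)) \<longlonglongrightarrow> (\<integral>x. ?f x \<partial>M)"
      by (rule int_conv[OF f, of 1]) (auto simp: infdist_nonneg min_def abs_le_iff intro: order_trans[OF infdist_nonneg])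
    moreover have "(\<integral>x. ?f x \<partial>\<nu> (r n)) = 0" for n
      using K(3) by (subst \<nu>_int[OF borel_measurable_continuous_onI[OF f]]) simp
    ultimately have "(\<integral>x. ?f x \<partial>M) = 0" by (simp add: LIMSEQ_const_iff)
    moreover have "integrable M ?f"
    proof (rule M.integrable_const_bound[of _ 1])
      show "?f \<in> borel_measurable M"
        using borel_measurable_continuous_onI[OF f] by (simp cong: measurable_cong_sets)
    qed (auto simp: infdist_nonneg)
    ultimately have "AE x in M. ?f x = 0"
      by (subst (asm) integral_nonneg_eq_0_iff_AE) (auto simp: infdist_nonneg)
    then show ?thesis
      by eventually_elim (use K(1,2) in \<open>auto simp: in_closed_iff_infdist_zero min_def split: if_splits\<close>)
  qed
  \<comment> \<open>Extends the inverse of \<open>s\<close> to a limit \<open>x\<close> of codes.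
    Take a cluster point \<open>p\<close> of points whose codes tend to \<open>x\<close>; uniform
    continuity of the inverse then forces every point with code near \<open>x\<close> to be near
    \<open>p\<close>, and one \<open>p\<close> serves all \<open>e\<close>.\<close>
  have "\<exists>p. \<forall>e>0. \<exists>d>0. \<forall>a. \<bar>s a - x\<bar> < d \<longrightarrow> dist a p < e" if x: "x \<in> K" for x
  proof -
    obtain y where y: "\<And>n. y n \<in> range s" "y \<longlonglongrightarrow> x" using x unfolding K_def closure_sequential by blast
    then have "\<forall>n. \<exists>c. y n = s c" by auto
    then obtain c where c: "\<And>n. y n = s (c n)" by metis
    obtain p q where q: "strict_mono (q :: nat \<Rightarrow> nat)" "(c \<circ> q) \<longlonglongrightarrow> p"
      using cpt[unfolded compact_eq_seq_compact_metric seq_compact_def, rule_format, of c] by auto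
    have sc: "(\<lambda>n. s (c (q n))) \<longlonglongrightarrow> x"
      using LIMSEQ_subseq_LIMSEQ[OF y(2) q(1)] by (simp add: c comp_def)
    show ?thesis
    proof (intro exI[of _ p] allI impI)
      fix e :: real assume "e > 0"
      then obtain d where d: "d > 0" "\<And>a b. \<bar>s a - s b\<bar> < d \<Longrightarrow> dist a b < e/2"
        using inv[of "e/2"] by auto
      have "\<forall>\<^sub>F n in sequentially. dist (s (c (q n))) x < d/2"
        using sc d(1) by (intro tendstoD) auto
      moreover have "\<forall>\<^sub>F n in sequentially. dist (c (q n)) p < e/2"
        using tendstoD[OF q(2), of "e/2"] \<open>e > 0\<close> by simp
      ultimately have "\<forall>\<^sub>F n in sequentially. dist (s (c (q n))) x < d/2 \<and> dist (c (q n)) p < e/2"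
        by eventually_elim simp
      then obtain n where n: "\<bar>s (c (q n)) - x\<bar> < d/2" "dist (c (q n)) p < e/2"
        by (auto simp: dist_real_def eventually_sequentially)
      show "\<exists>d>0. \<forall>a. \<bar>s a - x\<bar> < d \<longrightarrow> dist a p < e"
      proof (intro exI[of _ "d/2"] conjI allI impI)
        fix a assume "\<bar>s a - x\<bar> < d/2"
        then have "\<bar>s a - s (c (q n))\<bar> < d" using n(1) by linarith
        from d(2)[OF this] n(2) show "dist a p < e"
          using dist_triangle_half_r[of "c (q n)" a e p] by (simp add: dist_commute)
      qed (use d in simp)
    qed
  qed
  then obtain \<phi> where \<phi>: "\<And>x e. x \<in> K \<Longrightarrow> e > 0 \<Longrightarrow> \<exists>d>0. \<forall>a. \<bar>s a - x\<bar> < d \<longrightarrow> dist a (\<phi> x) < e"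
    by metis
  have \<phi>s: "\<phi> (s a) = a" for a
  proof (rule ccontr)
    assume "\<phi> (s a) \<noteq> a"
    then have "dist a (\<phi> (s a)) > 0" by simp
    from \<phi>[OF K(3) this] show False by (metis abs_zero diff_self less_irrefl)
  qed
  have cont: "continuous_on K \<phi>"
    unfolding continuous_on_iff
  proof (intro ballI allI impI)
    fix x e assume x: "x \<in> K" and "(e::real) > 0"
    then obtain d where d: "d > 0" "\<And>a. \<bar>s a - x\<bar> < d \<Longrightarrow> dist a (\<phi> x) < e/2" using \<phi>[OF x, of "e/2"] by auto
    show "\<exists>d>0. \<forall>y\<in>K. dist y x < d \<longrightarrow> dist (\<phi> y) (\<phi> x) < e"
    proof (intro exI[of _ "d/2"] conjI ballI impI)
      fix y assume y: "y \<in> K" "dist y x < d/2"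
      obtain d' where d': "d' > 0" "\<And>a. \<bar>s a - y\<bar> < d' \<Longrightarrow> dist a (\<phi> y) < e/2"
        using \<phi>[OF y(1), of "e/2"] \<open>e > 0\<close> by auto
      obtain a where a: "dist (s a) y < min (d/2) d'"
      proof -
        have m: "min (d/2) d' > 0" using d(1) d'(1) by simp
        have "\<forall>e>0. \<exists>z\<in>range s. dist z y < e"
          using y(1) unfolding K_def closure_approachable .
        from this[THEN spec, THEN mp, OF m] obtain a where "dist (s a) y < min (d/2) d'" by (elim bexE imageE) simp
        then show thesis by (rule that)
      qed
      have "\<bar>s a - y\<bar> < d/2" "\<bar>y - x\<bar> < d/2" using a y(2) by (simp_all only: dist_real_def min_less_iff_conj)
      then have "\<bar>s a - x\<bar> < d" by linarith
      then have "dist a (\<phi> x) < e/2" by (rule d)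
      moreover have "dist a (\<phi> y) < e/2" using a by (intro d') (auto simp: dist_real_def)
      ultimately show "dist (\<phi> y) (\<phi> x) < e" using dist_triangle_half_r[of a "\<phi> y" e "\<phi> x"] by simp
    qed (use d in simp)
  qed
  define \<psi> where "\<psi> x = (if x \<in> K then \<phi> x else undefined)" for x
  have \<psi>: "\<psi> \<in> borel_measurable M"
    unfolding \<psi>_def using K cont
    by (simp cong: measurable_cong_sets) (intro borel_measurable_continuous_on_if; auto simp: borel_closed)
  have "(X \<circ> r) \<longlonglongrightarrow> law M \<psi>"
    unfolding tendsto_prob_measure_iff
  proof
    fix f :: "'a \<Rightarrow>\<^sub>C real"
    \<comment> \<open>Weak convergence on the line tests functions continuous everywhere, while this
      composition is known to be continuous only on \<open>K\<close>. Tietze's theorem extends it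
      with the same bound.\<close>
    have "continuous_on K (\<lambda>x. f (\<phi> x))"
      by (rule continuous_on_compose2[of UNIV f, OF _ cont]) auto
    moreover have "closedin (top_of_set UNIV) K" using K(1) by simp
    ultimately obtain g :: "real \<Rightarrow> real" where g: "continuous_on UNIV g" "\<And>x. x \<in> K \<Longrightarrow> g x = f (\<phi> x)"
      and g_le: "\<And>x. x \<in> UNIV \<Longrightarrow> norm (g x) \<le> norm f"
      by (rule Tietze[OF _ _ norm_ge_zero[of f] norm_bounded]) (rule that)
    have "mean ((X \<circ> r) n) f = (\<integral>x. g x \<partial>\<nu> (r n))" for n
      by (subst \<nu>_int[OF borel_measurable_continuous_onI[OF g(1)]]) (simp add: g(2)[OF K(3)] \<phi>s)
    moreover have "(\<integral>x. g x \<partial>M) = mean (law M \<psi>) f"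
    proof -
      have "mean (law M \<psi>) f = (\<integral>x. f (\<psi> x) \<partial>M)"
        unfolding as_measure_law[OF M.prob_space_axioms \<psi>]
        by (rule integral_distr[OF \<psi> borel_measurable_bcontfun])
      also have "\<dots> = (\<integral>x. g x \<partial>M)"
      proof (rule integral_cong_AE)
        show "AE x in M. f (\<psi> x) = g x"
          using AE_K by eventually_elim (simp add: g(2) \<psi>_def)
        show "(\<lambda>x. f (\<psi> x)) \<in> borel_measurable M"
          by (rule measurable_compose[OF \<psi> borel_measurable_bcontfun])
        show "g \<in> borel_measurable M"
          using borel_measurable_continuous_onI[OF g(1)] by (simp cong: measurable_cong_sets)
      qed
      finally show ?thesis ..
    qed
    ultimately show "(\<lambda>n. mean ((X \<circ> r) n) f) \<longlonglongrightarrow> mean (law M \<psi>) f"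
      using int_conv[OF g(1) g_le[OF UNIV_I]] by simp
  qed
  with r show "\<exists>l\<in>UNIV. \<exists>r. strict_mono r \<and> (X \<circ> r) \<longlonglongrightarrow> l" by blast
qed


section \<open>Convergence and measurability through countably many test functions\<close>

lemma dense_seq_tendstoI:
  fixes X :: "'b \<Rightarrow> 'a::metric_space prob_measure"
  assumes F: "dense_seq F" and lim: "\<And>j. ((\<lambda>n. mean (X n) (F j)) \<longlongrightarrow> mean \<mu> (F j)) net"
  shows "(X \<longlongrightarrow> \<mu>) net"
  unfolding tendsto_prob_measure_iff
proof (intro allI tendstoI)
  fix f :: "'a \<Rightarrow>\<^sub>C real" and e :: real assume e: "e > 0"
  obtain j where j: "dist (F j) f < e/3" using F e unfolding dense_seq_def by (meson divide_pos_pos zero_less_numeral)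
  have close: "\<bar>mean \<nu> (F j) - mean \<nu> f\<bar> < e/3" for \<nu>
  proof -
    have "\<bar>mean \<nu> (F j) - mean \<nu> f\<bar> \<le> dist (F j) f"
      using dist_bounded[of "F j" _ f] by (intro abs_mean_diff_le integrable_bcontfun) (simp add: dist_real_def)
    then show ?thesis using j by simp
  qed
  have "\<forall>\<^sub>F n in net. dist (mean (X n) (F j)) (mean \<mu> (F j)) < e/3"
    using lim[of j] e by (intro tendstoD) auto
  then show "\<forall>\<^sub>F n in net. dist (mean (X n) f) (mean \<mu> f) < e"
  proof eventually_elim
    case (elim n)
    then show ?case using close[of "X n"] close[of \<mu>] unfolding dist_real_def by linarith
  qed
qed

text \<open>A countable neighbourhood base at \<tau>, standing in for balls of a metric. The single
  index \<open>k\<close> governs both the number of tests and the tolerance.\<close>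

definition nbhd_seq :: "(nat \<Rightarrow> ('a::metric_space \<Rightarrow>\<^sub>C real)) \<Rightarrow> 'a prob_measure \<Rightarrow> nat \<Rightarrow> 'a prob_measure set" where
  "nbhd_seq F \<tau> k = {\<nu>. \<forall>j\<le>k. \<bar>mean \<nu> (F j) - mean \<tau> (F j)\<bar> < 1 / real (Suc k)}"

lemma nbhd_seq_self [simp]: "\<tau> \<in> nbhd_seq F \<tau> k"
  by (simp add: nbhd_seq_def)

lemma tendsto_of_mem_nbhd_seq:
  assumes F: "dense_seq F" and \<nu>: "\<And>k. \<nu> k \<in> nbhd_seq F \<tau> k"
  shows "\<nu> \<longlonglongrightarrow> \<tau>"
proof (rule dense_seq_tendstoI[OF F])
  fix j
  have "(\<lambda>k. mean (\<nu> k) (F j) - mean \<tau> (F j)) \<longlonglongrightarrow> 0"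
  proof (rule Lim_null_comparison)
    show "\<forall>\<^sub>F k in sequentially. norm (mean (\<nu> k) (F j) - mean \<tau> (F j)) \<le> 1 / real (Suc k)"
      using eventually_ge_at_top[of j]
    proof eventually_elim
      case (elim k)
      then show ?case using \<nu>[of k] by (simp add: nbhd_seq_def less_imp_le)
    qed
    show "(\<lambda>k. 1 / real (Suc k)) \<longlonglongrightarrow> 0" using LIMSEQ_inverse_real_of_nat by (simp add: inverse_eq_divide)
  qed
  then show "(\<lambda>k. mean (\<nu> k) (F j)) \<longlonglongrightarrow> mean \<tau> (F j)" by (simp add: LIM_zero_iff)
qed

text \<open>Otherwise measures chosen from these sets but outside \<open>W\<close> would converge to
  \<tau>, a point of the open set \<open>W\<close>.\<close>

lemma nbhd_seq_subset_open:
  assumes F: "dense_seq F" and W: "open W" "\<tau> \<in> W"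
  shows "\<exists>k. nbhd_seq F \<tau> k \<subseteq> W"
proof (rule ccontr)
  assume "\<not> ?thesis"
  then have "\<forall>k. \<exists>\<nu>. \<nu> \<in> nbhd_seq F \<tau> k \<and> \<nu> \<notin> W" by blast
  then obtain \<nu> where \<nu>: "\<And>k. \<nu> k \<in> nbhd_seq F \<tau> k" "\<And>k. \<nu> k \<notin> W" by metis
  from topological_tendstoD[OF tendsto_of_mem_nbhd_seq[OF F \<nu>(1)] W] \<nu>(2) show False by simp
qed

text \<open>Every open set \<open>W\<close> of measures is the preimage, under the map
  \<open>h\<close> to the sequence of test integrals, of an open set \<open>O'\<close> of real
  sequences. One inclusion is the neighbourhood base, the other the choice of \<open>O'\<close>.
  Coordinatewise measurability then suffices.\<close>

lemma measurable_prob_measureI: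
  fixes g :: "'i \<Rightarrow> 'a::metric_space prob_measure"
  assumes F: "dense_seq F" and meas: "\<And>j. (\<lambda>i. mean (g i) (F j)) \<in> borel_measurable L"
  shows "g \<in> borel_measurable L"
proof (rule borel_measurableI)
  fix W :: "'a prob_measure set" assume W: "open W"
  define h where "h \<nu> = (\<lambda>j. mean \<nu> (F j))" for \<nu>
  define O' where "O' = \<Union>{B :: (nat \<Rightarrow> real) set. open B \<and> h -` B \<subseteq> W}"
  have "W \<subseteq> h -` O'"
  proof
    fix \<tau> assume "\<tau> \<in> W"
    then obtain k where k: "nbhd_seq F \<tau> k \<subseteq> W" using nbhd_seq_subset_open[OF F W] by blast
    let ?B = "\<Inter>j\<in>{..k}. {y. \<bar>y j - h \<tau> j\<bar> < 1 / real (Suc k)}"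
    have "open ?B"
    proof (intro open_INT ballI finite_atMost)
      fix j
      have "continuous_on UNIV (\<lambda>y :: nat \<Rightarrow> real. y j)" by (rule continuous_on_product_coordinates)
      then show "open {y. \<bar>y j - h \<tau> j\<bar> < 1 / real (Suc k)}"
        by (intro open_Collect_less continuous_intros)
    qed
    moreover have "h -` ?B \<subseteq> W" using k by (auto simp: nbhd_seq_def h_def)
    moreover have "h \<tau> \<in> ?B" by simp
    ultimately show "\<tau> \<in> h -` O'" unfolding O'_def by blast
  qed
  then have eq: "g -` W \<inter> space L = (\<lambda>i. h (g i)) -` O' \<inter> space L" by (auto simp: O'_def)
  have "open O'" unfolding O'_def by auto
  moreover have "(\<lambda>i. h (g i)) \<in> borel_measurable L"
    by (rule measurable_coordinatewise_then_product) (simp add: h_def meas)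
  ultimately show "g -` W \<inter> space L \<in> sets L"
    unfolding eq by (intro measurable_sets) (auto simp: borel_open)
qed

text \<open>Compactness supplies a cluster point, and the Cauchy property makes the test integrals
  of the whole sequence follow those of the subsequence.\<close>

lemma tendsto_of_tendsto_means:
  fixes X :: "nat \<Rightarrow> 'a::metric_space prob_measure"
  assumes cpt: "compact (UNIV :: 'a set)" and F: "dense_seq F"
    and conv: "\<And>j. Cauchy (\<lambda>n. mean (X n) (F j))"
  obtains \<mu> where "X \<longlonglongrightarrow> \<mu>"
proof -
  obtain \<mu> r where r: "strict_mono r" "(X \<circ> r) \<longlonglongrightarrow> \<mu>"
    using seq_compact_prob_measure[OF cpt] unfolding seq_compact_def by (metis UNIV_I)
  have "X \<longlonglongrightarrow> \<mu>"
  proof (rule dense_seq_tendstoI[OF F])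
    fix j
    obtain l where l: "(\<lambda>n. mean (X n) (F j)) \<longlonglongrightarrow> l"
      using conv[of j] by (auto simp: Cauchy_convergent_iff convergent_def)
    have "(\<lambda>n. mean (X (r n)) (F j)) \<longlonglongrightarrow> mean \<mu> (F j)"
      using r(2) unfolding tendsto_prob_measure_iff by simp
    with LIMSEQ_subseq_LIMSEQ[OF l r(1)] have "l = mean \<mu> (F j)" by (simp add: LIMSEQ_unique comp_def)
    with l show "(\<lambda>n. mean (X n) (F j)) \<longlonglongrightarrow> mean \<mu> (F j)" by simp
  qed
  then show thesis by (rule that)
qed

section \<open>Equilibria of finite strategic games\<close>

lemma seq_compact_finite_family:
  fixes x :: "nat \<Rightarrow> 'j \<Rightarrow> 'b::topological_space"
  assumes "finite J" and "\<And>j. j \<in> J \<Longrightarrow> seq_compact (K j)" and "\<And>n j. j \<in> J \<Longrightarrow> x n j \<in> K j"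
  shows "\<exists>l r. strict_mono (r :: nat \<Rightarrow> nat) \<and> (\<forall>j\<in>J. l j \<in> K j \<and> (\<lambda>n. x (r n) j) \<longlonglongrightarrow> l j)"
  using assms
proof (induction J rule: finite_induct)
  case empty
  have "strict_mono (id :: nat \<Rightarrow> nat)" by (simp add: strict_mono_def)
  then show ?case by blast
next
  case (insert i J)
  then obtain l r where r: "strict_mono (r :: nat \<Rightarrow> nat)"
    and l: "\<forall>j\<in>J. l j \<in> K j \<and> (\<lambda>n. x (r n) j) \<longlonglongrightarrow> l j" by auto
  have "seq_compact (K i)" "\<forall>n. x (r n) i \<in> K i" using insert.prems by auto
  then obtain b q where q: "b \<in> K i" "strict_mono (q :: nat \<Rightarrow> nat)" "((\<lambda>n. x (r n) i) \<circ> q) \<longlonglongrightarrow> b"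
    by (rule seq_compactE)
  show ?case
  proof (intro exI[of _ "l(i := b)"] exI[of _ "r \<circ> q"] conjI ballI)
    show "strict_mono (r \<circ> q)" using r q(2) by (rule strict_mono_o)
    fix j assume j: "j \<in> insert i J"
    show "(l(i := b)) j \<in> K j" using j l q(1) by auto
    show "(\<lambda>n. x ((r \<circ> q) n) j) \<longlonglongrightarrow> (l(i := b)) j"
    proof (cases "j = i")
      case True then show ?thesis using q(3) by (simp add: comp_def)
    next
      case False
      then have "(\<lambda>n. x (r n) j) \<longlonglongrightarrow> l j" using j l by auto
      from LIMSEQ_subseq_LIMSEQ[OF this q(2)] False show ?thesis by (simp add: comp_def)
    qed
  qed
qed

text \<open>The dimension is a number rather than a type because it will be the count of
  player-action pairs of a given game. Continuity is therefore stated sequentially in the first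
  \<open>n\<close> coordinates. The proof applies Kuhn's lemma to finer and finer grids.\<close>

lemma brouwer_unit_cube:
  fixes f :: "(nat \<Rightarrow> real) \<Rightarrow> nat \<Rightarrow> real"
  assumes into: "\<And>x i. \<forall>i<n. x i \<in> {0..1} \<Longrightarrow> i < n \<Longrightarrow> f x i \<in> {0..1}"
    and cont: "\<And>X x i. \<forall>k. \<forall>i<n. X k i \<in> {0..1} \<Longrightarrow> \<forall>i<n. x i \<in> {0..1} \<Longrightarrow>
      \<forall>i<n. (\<lambda>k::nat. X k i) \<longlonglongrightarrow> x i \<Longrightarrow> i < n \<Longrightarrow> (\<lambda>k. f (X k) i) \<longlonglongrightarrow> f x i"
  shows "\<exists>x. (\<forall>i<n. x i \<in> {0..1}) \<and> (\<forall>i<n. f x i = x i)"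
proof -
  define g where "g k y = (\<lambda>i. real (y i) / real (Suc k))" for k :: nat and y :: "nat \<Rightarrow> nat"
  have g_cube: "\<forall>i<n. g k y i \<in> {0..1}" if "\<forall>i<n. y i \<le> Suc k" for k y
    using that by (auto simp: g_def)
  have "\<exists>q. (\<forall>i<n. q i < Suc k) \<and> (\<forall>i<n. \<exists>a b. (\<forall>j<n. q j \<le> a j \<and> a j \<le> q j + 1) \<and>
      (\<forall>j<n. q j \<le> b j \<and> b j \<le> q j + 1) \<and> g k a i \<le> f (g k a) i \<and> f (g k b) i \<le> g k b i)" for k
  proof -
    \<comment> \<open>Label 0 certifies that \<open>f\<close> does not decrease the coordinate,
      label 1 that it does not increase it. The upper face is labelled 1 by decree, as Kuhn's
      boundary condition asks; this is sound there because \<open>f\<close> stays in the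
      cube.\<close>
    define label where "label y i = (if y i = Suc k \<or> f (g k y) i < g k y i then 1 else 0 :: nat)" for y i
    have l0: "g k y i \<le> f (g k y) i" if "label y i = 0" for y i
      using that by (auto simp: label_def split: if_splits)
    have l1: "f (g k y) i \<le> g k y i" if "label y i \<noteq> 0" "\<forall>i<n. y i \<le> Suc k" "i < n" for y i
    proof (cases "y i = Suc k")
      case True
      then show ?thesis using into[OF g_cube[OF that(2)] that(3)] by (simp add: g_def)
    next
      case False
      then show ?thesis using that(1) by (simp add: label_def split: if_splits)
    qed
    have label0: "label x i = 0" if x: "\<forall>i<n. x i \<le> Suc k" "i < n" "x i = 0" for x i
      using into[OF g_cube[OF x(1)] x(2)] x(3) by (simp add: label_def g_def)
    obtain q where q: "\<forall>i<n. q i < Suc k"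
      and rs: "\<forall>i<n. \<exists>r s. (\<forall>j<n. q j \<le> r j \<and> r j \<le> q j + 1) \<and> (\<forall>j<n. q j \<le> s j \<and> s j \<le> q j + 1) \<and> label r i \<noteq> label s i"
    proof (rule kuhn_lemma[of "Suc k" n label])
      show "\<forall>x. (\<forall>i<n. x i \<le> Suc k) \<longrightarrow> (\<forall>i<n. x i = 0 \<longrightarrow> label x i = 0)"
        using label0 by blast
    qed (auto simp: label_def intro: that)
    show ?thesis
    proof (rule exI[of _ q], intro conjI allI impI)
      fix i assume i: "i < n"
      then obtain r s where r: "\<forall>j<n. q j \<le> r j \<and> r j \<le> q j + 1" and s: "\<forall>j<n. q j \<le> s j \<and> s j \<le> q j + 1"
        and ne: "label r i \<noteq> label s i" using rs by blast
      have rb: "\<forall>j<n. r j \<le> Suc k" and sb: "\<forall>j<n. s j \<le> Suc k" using r s q by fastforce+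
      show "\<exists>a b. (\<forall>j<n. q j \<le> a j \<and> a j \<le> q j + 1) \<and> (\<forall>j<n. q j \<le> b j \<and> b j \<le> q j + 1) \<and>
          g k a i \<le> f (g k a) i \<and> f (g k b) i \<le> g k b i"
      proof (cases "label r i = 0")
        case True
        then have "label s i \<noteq> 0" using ne by simp
        then show ?thesis using r s l0[OF True] l1[OF _ sb i] by blast
      next
        case False
        then have "label s i = 0" using ne by (auto simp: label_def split: if_splits)
        then show ?thesis using r s l0 l1[OF False rb i] by blast
      qed
    qed (use q in simp)
  qed
  then obtain q where q: "\<And>k i. i < n \<Longrightarrow> q k i < Suc k"
    and q': "\<And>k i. i < n \<Longrightarrow> \<exists>a b. (\<forall>j<n. q k j \<le> a j \<and> a j \<le> q k j + 1) \<and>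
      (\<forall>j<n. q k j \<le> b j \<and> b j \<le> q k j + 1) \<and> g k a i \<le> f (g k a) i \<and> f (g k b) i \<le> g k b i"
    by metis
  have "\<exists>l r. strict_mono (r :: nat \<Rightarrow> nat) \<and> (\<forall>j\<in>{..<n}. l j \<in> {0..1::real} \<and> (\<lambda>k. g (r k) (q (r k)) j) \<longlonglongrightarrow> l j)"
    by (rule seq_compact_finite_family)
      (use g_cube less_imp_le[OF q] in \<open>auto simp: compact_imp_seq_compact\<close>)
  then obtain x r where r: "strict_mono (r :: nat \<Rightarrow> nat)" and x: "\<forall>i<n. x i \<in> {0..1}"
    and lim: "\<And>j. j < n \<Longrightarrow> (\<lambda>k. g (r k) (q (r k)) j) \<longlonglongrightarrow> x j" by auto
  have inv0: "(\<lambda>k. 1 / real (Suc (r k))) \<longlonglongrightarrow> 0"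
    using LIMSEQ_subseq_LIMSEQ[OF LIMSEQ_inverse_real_of_nat r] by (simp add: comp_def inverse_eq_divide)
  \<comment> \<open>All vertices of the Kuhn cell at \<open>q (r k)\<close> lie within one grid step
    of it in each coordinate and so share the limit \<open>x\<close>. The two vertices with opposite
    labels then yield opposite inequalities at \<open>x\<close>.\<close>
  have near: "(\<lambda>k. g (r k) (y k) j) \<longlonglongrightarrow> x j"
    if y: "\<And>k j. j < n \<Longrightarrow> q (r k) j \<le> y k j \<and> y k j \<le> q (r k) j + 1" and j: "j < n" for y j
  proof (rule tendsto_sandwich[OF _ _ lim[OF j]])
    show "(\<lambda>k. g (r k) (q (r k)) j + 1 / real (Suc (r k))) \<longlonglongrightarrow> x j"
      using tendsto_add[OF lim[OF j] inv0] by simp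
    have "real (y k j) \<le> real (q (r k) j) + 1" for k
      using y[OF j, of k] by linarith
    then show "\<forall>\<^sub>F k in sequentially. g (r k) (y k) j \<le> g (r k) (q (r k)) j + 1 / real (Suc (r k))"
      unfolding g_def add_divide_distrib[symmetric]
      by (intro always_eventually allI divide_right_mono) auto
    show "\<forall>\<^sub>F k in sequentially. g (r k) (q (r k)) j \<le> g (r k) (y k) j"
    proof (rule always_eventually, rule allI)
      fix k
      have "real (q (r k) j) \<le> real (y k j)" using y[OF j, of k] by simp
      then show "g (r k) (q (r k)) j \<le> g (r k) (y k) j" unfolding g_def by (rule divide_right_mono) simp
    qed
  qed
  have cube: "\<forall>k. \<forall>i<n. g (r k) (y k) i \<in> {0..1}"
    if "\<And>k j. j < n \<Longrightarrow> q (r k) j \<le> y k j \<and> y k j \<le> q (r k) j + 1" for y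
  proof
    fix k show "\<forall>i<n. g (r k) (y k) i \<in> {0..1}"
      by (rule g_cube) (use that[of _ k] q[of _ "r k"] in fastforce)
  qed
  show ?thesis
  proof (intro exI[of _ x] conjI allI impI)
    fix i assume i: "i < n"
    have "\<forall>k. \<exists>a. (\<forall>j<n. q (r k) j \<le> a j \<and> a j \<le> q (r k) j + 1) \<and> g (r k) a i \<le> f (g (r k) a) i"
      using q'[OF i] by blast
    then obtain a where a: "\<And>k j. j < n \<Longrightarrow> q (r k) j \<le> a k j \<and> a k j \<le> q (r k) j + 1"
      "\<And>k. g (r k) (a k) i \<le> f (g (r k) (a k)) i" by metis
    have "\<forall>k. \<exists>b. (\<forall>j<n. q (r k) j \<le> b j \<and> b j \<le> q (r k) j + 1) \<and> f (g (r k) b) i \<le> g (r k) b i"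
      using q'[OF i] by blast
    then obtain b where b: "\<And>k j. j < n \<Longrightarrow> q (r k) j \<le> b k j \<and> b k j \<le> q (r k) j + 1"
      "\<And>k. f (g (r k) (b k)) i \<le> g (r k) (b k) i" by metis
    have "x i \<le> f x i"
      by (rule LIMSEQ_le[OF near[OF a(1) i] cont[OF cube[OF a(1)] x _ i]]) (use near[OF a(1)] a(2) in auto)
    moreover have "f x i \<le> x i"
      by (rule LIMSEQ_le[OF cont[OF cube[OF b(1)] x _ i] near[OF b(1) i]]) (use near[OF b(1)] b(2) in auto)
    ultimately show "f x i = x i" by simp
  qed (use x in auto)
qed

definition mixed_profiles :: "'j set \<Rightarrow> ('j \<Rightarrow> 's set) \<Rightarrow> ('j \<Rightarrow> 's \<Rightarrow> real) set" where
  "mixed_profiles J S = {p. \<forall>j\<in>J. (\<forall>s\<in>S j. 0 \<le> p j s) \<and> (\<Sum>s\<in>S j. p j s) = 1}"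

text \<open>Brouwer's theorem is applied to Nash's map, precomposed with a retraction of the cube onto
  the product of simplices.\<close>

theorem finite_equilibrium:
  fixes V :: "'j \<Rightarrow> 's \<Rightarrow> ('j \<Rightarrow> 's \<Rightarrow> real) \<Rightarrow> real"
  assumes J: "finite J" and S: "\<And>j. j \<in> J \<Longrightarrow> finite (S j)" "\<And>j. j \<in> J \<Longrightarrow> S j \<noteq> {}"
    and cont: "\<And>P p i s. \<forall>k. P k \<in> mixed_profiles J S \<Longrightarrow> p \<in> mixed_profiles J S \<Longrightarrow>
      \<forall>j\<in>J. \<forall>t\<in>S j. (\<lambda>k::nat. P k j t) \<longlonglongrightarrow> p j t \<Longrightarrow> i \<in> J \<Longrightarrow> s \<in> S i \<Longrightarrow> (\<lambda>k. V i s (P k)) \<longlonglongrightarrow> V i s p"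
  shows "\<exists>p\<in>mixed_profiles J S. \<forall>i\<in>J. \<forall>s\<in>S i. V i s p \<le> (\<Sum>t\<in>S i. p i t * V i t p)"
proof -
  define T where "T = Sigma J S"
  have "finite T" using J S by (simp add: T_def)
  then obtain e where "bij_betw e {0..<card T} T" using ex_bij_betw_nat_finite by blast
  then have e: "bij_betw e {..<card T} T" by (simp add: atLeast0LessThan)
  define n where "n = card T"
  define e' where "e' = the_inv_into {..<n} e"
  have ee': "e (e' t) = t" "e' t < n" if "t \<in> T" for t
    using f_the_inv_into_f_bij_betw[OF e, of t] bij_betwE[OF bij_betw_the_inv_into[OF e], rule_format, of t] that
    by (auto simp: e'_def n_def)
  have e'e: "e' (e i) = i" "e i \<in> T" if "i < n" for i
    using the_inv_into_f_f[OF bij_betw_imp_inj_on[OF e], of i] bij_betwE[OF e] that by (auto simp: e'_def n_def)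
  define Y where "Y x j s = x (e' (j, s))" for x :: "nat \<Rightarrow> real" and j s
  define \<sigma> where "\<sigma> x j = (\<Sum>s\<in>S j. Y x j s)" for x j
  \<comment> \<open>Missing mass is spread evenly over the actions and excess mass is scaled away; a
    nonnegative vector that already sums to 1 is left unchanged.\<close>
  define R where "R x j s = (Y x j s + max 0 (1 - \<sigma> x j) / card (S j)) / max 1 (\<sigma> x j)" for x j s
  define avg where "avg p j = (\<Sum>t\<in>S j. p j t * V j t p)" for p j
  define \<phi> where "\<phi> p j s = max 0 (V j s p - avg p j)" for p j s
  define N where "N p j s = (p j s + \<phi> p j s) / (1 + (\<Sum>t\<in>S j. \<phi> p j t))" for p j s
  define f where "f x i = N (R x) (fst (e i)) (snd (e i))" for x i
  have R: "R x \<in> mixed_profiles J S" if x: "\<forall>i<n. x i \<in> {0..1}" for x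
    unfolding mixed_profiles_def
  proof (intro CollectI ballI conjI)
    fix j assume j: "j \<in> J"
    have Y: "0 \<le> Y x j s" if "s \<in> S j" for s
      using x ee'(2)[of "(j, s)"] j that by (auto simp: Y_def T_def)
    then show "0 \<le> R x j s" if "s \<in> S j" for s using that by (simp add: R_def)
    have "(\<Sum>s\<in>S j. R x j s) = (\<sigma> x j + max 0 (1 - \<sigma> x j)) / max 1 (\<sigma> x j)"
      using S[OF j] by (simp add: R_def sum.distrib \<sigma>_def flip: sum_divide_distrib)
    also have "\<sigma> x j + max 0 (1 - \<sigma> x j) = max 1 (\<sigma> x j)" by simp
    finally show "(\<Sum>s\<in>S j. R x j s) = 1" by simp
  qed
  have \<phi>: "0 \<le> \<phi> p j s" for p j s by (simp add: \<phi>_def)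
  have \<phi>_sum: "0 < 1 + (\<Sum>t\<in>S j. \<phi> p j t)" for p j
    using sum_nonneg[of "S j" "\<phi> p j"] \<phi> by (simp add: add_pos_nonneg)
  have N: "N p \<in> mixed_profiles J S" if p: "p \<in> mixed_profiles J S" for p
    unfolding mixed_profiles_def
  proof (intro CollectI ballI conjI)
    fix j assume j: "j \<in> J"
    show "0 \<le> N p j s" if "s \<in> S j" for s
      using that j p \<phi>[of p j s] \<phi>_sum[of p j] by (simp add: N_def mixed_profiles_def)
    show "(\<Sum>s\<in>S j. N p j s) = 1"
      using j p \<phi>_sum[of p j] by (simp add: N_def sum.distrib mixed_profiles_def flip: sum_divide_distrib)
  qed
  have le1: "p j s \<le> 1" if "p \<in> mixed_profiles J S" "j \<in> J" "s \<in> S j" for p j s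
    using that S(1)[of j] member_le_sum[of s "S j" "p j"] by (auto simp: mixed_profiles_def)
  have "\<exists>x. (\<forall>i<n. x i \<in> {0..1::real}) \<and> (\<forall>i<n. f x i = x i)"
  proof (rule brouwer_unit_cube)
    fix x :: "nat \<Rightarrow> real" and i assume x: "\<forall>i<n. x i \<in> {0..1}" and i: "i < n"
    have "fst (e i) \<in> J" "snd (e i) \<in> S (fst (e i))" using e'e(2)[OF i] by (auto simp: T_def)
    then show "f x i \<in> {0..1}"
      using N[OF R[OF x]] le1[OF N[OF R[OF x]]] by (auto simp: f_def mixed_profiles_def)
  next
    fix X :: "nat \<Rightarrow> nat \<Rightarrow> real" and x i
    assume X: "\<forall>k. \<forall>i<n. X k i \<in> {0..1}" and x: "\<forall>i<n. x i \<in> {0..1}"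
      and lim: "\<forall>i<n. (\<lambda>k. X k i) \<longlonglongrightarrow> x i" and i: "i < n"
    have Y: "(\<lambda>k. Y (X k) j s) \<longlonglongrightarrow> Y x j s" if "j \<in> J" "s \<in> S j" for j s
      unfolding Y_def using lim ee'(2)[of "(j, s)"] that by (simp add: T_def)
    have \<sigma>: "(\<lambda>k. \<sigma> (X k) j) \<longlonglongrightarrow> \<sigma> x j" if "j \<in> J" for j
      unfolding \<sigma>_def using that Y by (intro tendsto_sum) auto
    have R_lim: "(\<lambda>k. R (X k) j s) \<longlonglongrightarrow> R x j s" if "j \<in> J" "s \<in> S j" for j s
      unfolding R_def using that S(2)[of j] S(1)[of j] by (intro tendsto_intros Y \<sigma>) auto
    have V_lim: "(\<lambda>k. V j s (R (X k))) \<longlonglongrightarrow> V j s (R x)" if "j \<in> J" "s \<in> S j" for j s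
      using that R_lim by (intro cont) (use X x R in auto)
    have avg_lim: "(\<lambda>k. avg (R (X k)) j) \<longlonglongrightarrow> avg (R x) j" if "j \<in> J" for j
      unfolding avg_def using that by (intro tendsto_sum tendsto_mult R_lim V_lim)
    have \<phi>_lim: "(\<lambda>k. \<phi> (R (X k)) j s) \<longlonglongrightarrow> \<phi> (R x) j s" if "j \<in> J" "s \<in> S j" for j s
      unfolding \<phi>_def using that by (intro tendsto_intros V_lim avg_lim)
    have "fst (e i) \<in> J" "snd (e i) \<in> S (fst (e i))" using e'e(2)[OF i] by (auto simp: T_def)
    then show "(\<lambda>k. f (X k) i) \<longlonglongrightarrow> f x i"
      unfolding f_def N_def using \<phi>_sum[of "R x" "fst (e i)"]
      by (intro tendsto_divide tendsto_add tendsto_sum tendsto_const R_lim \<phi>_lim) auto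
  qed
  then obtain x where x: "\<forall>i<n. x i \<in> {0..1}" and fixp: "\<And>i. i < n \<Longrightarrow> f x i = x i" by blast
  define p where "p = R x"
  have p: "p \<in> mixed_profiles J S" unfolding p_def by (rule R[OF x])
  have Np_Y: "N p j s = Y x j s" if "j \<in> J" "s \<in> S j" for j s
    using fixp[of "e' (j, s)"] ee'[of "(j, s)"] that by (simp add: f_def T_def p_def Y_def)
  \<comment> \<open>At the fixed point the raw coordinates equal \<open>N p\<close> and therefore
    sum to 1. The retraction acts there as the identity, so \<open>p\<close> itself is fixed by
    Nash's map.\<close>
  have Np: "N p j s = p j s" if j: "j \<in> J" and s: "s \<in> S j" for j s
  proof -
    have "\<sigma> x j = 1"
    proof -
      have "\<sigma> x j = (\<Sum>s\<in>S j. N p j s)"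
        unfolding \<sigma>_def by (rule sum.cong) (simp_all add: Np_Y[OF j])
      then show ?thesis using N[OF p] j by (simp add: mixed_profiles_def)
    qed
    then show ?thesis using Np_Y[OF j s] by (simp add: p_def R_def)
  qed
  show ?thesis
  proof (intro bexI[OF _ p] ballI)
    fix i s assume i: "i \<in> J" and s: "s \<in> S i"
    have p0: "\<And>t. t \<in> S i \<Longrightarrow> 0 \<le> p i t" and p1: "(\<Sum>t\<in>S i. p i t) = 1"
      using p i by (auto simp: mixed_profiles_def)
    \<comment> \<open>The actions in use cannot all beat their own average. For one that does not,
      \<open>\<phi> p i t\<close> is 0, so invariance under \<open>N\<close> forces the denominator
      to be 1 and every gain \<open>\<phi> p i s\<close> to vanish.\<close>
    obtain t where t: "t \<in> S i" "p i t > 0" "V i t p \<le> avg p i"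
    proof (rule ccontr)
      assume "\<not> thesis"
      then have gt: "p i t = 0 \<or> avg p i < V i t p" if "t \<in> S i" for t
        using that p0[of t] \<open>\<And>t. t \<in> S i \<Longrightarrow> 0 < p i t \<Longrightarrow> V i t p \<le> avg p i \<Longrightarrow> thesis\<close> by force
      have "avg p i = (\<Sum>t\<in>S i. p i t * avg p i)" using p1 by (simp flip: sum_distrib_right)
      also have "\<dots> < (\<Sum>t\<in>S i. p i t * V i t p)"
      proof (rule sum_strict_mono_ex1)
        show "\<forall>t\<in>S i. p i t * avg p i \<le> p i t * V i t p"
          using gt p0 by (metis less_imp_le mult_left_mono mult_zero_left order_refl)
        obtain t where "t \<in> S i" "p i t \<noteq> 0" using p1 by (metis sum.neutral zero_neq_one)
        then show "\<exists>t\<in>S i. p i t * avg p i < p i t * V i t p"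
          using gt[of t] p0[of t] by (intro bexI[of _ t]) auto
      qed (use S i in auto)
      finally show False by (simp add: avg_def)
    qed
    have "p i t = p i t / (1 + (\<Sum>t\<in>S i. \<phi> p i t))"
      using Np[OF i t(1)] t(3) by (simp add: N_def \<phi>_def)
    then have "(\<Sum>t\<in>S i. \<phi> p i t) = 0"
      using t(2) \<phi>_sum[of p i] by (simp add: field_simps)
    then have "\<phi> p i s = 0" using S(1)[OF i] s \<phi> by (simp add: sum_nonneg_eq_0_iff)
    then show "V i s p \<le> (\<Sum>t\<in>S i. p i t * V i t p)" by (simp add: \<phi>_def avg_def)
  qed
qed

section \<open>Independent randomization\<close>

abbreviation profile_measure :: "'j set \<Rightarrow> ('j \<Rightarrow> 'a::metric_space prob_measure) \<Rightarrow> ('j \<Rightarrow> 'a) measure" where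
  "profile_measure J h \<equiv> \<Pi>\<^sub>M j\<in>J. as_measure (h j)"

lemma prob_space_profile_measure: "prob_space (profile_measure J h)"
  by (rule prob_space_PiM) simp

lemma product_prob_space_as_measure: "product_prob_space (\<lambda>j. as_measure (h j))"
  by (simp add: product_prob_space_def product_prob_space_axioms_def product_sigma_finite_def
      prob_space_imp_sigma_finite)

lemma integral_profile_measure_prod:
  fixes f :: "'j \<Rightarrow> 'a::metric_space \<Rightarrow> real"
  assumes "compact (UNIV :: 'a set)" "finite J" "\<And>j. j \<in> J \<Longrightarrow> continuous_on UNIV (f j)"
  shows "(\<integral>a. (\<Prod>j\<in>J. f j (a j)) \<partial>profile_measure J h) = (\<Prod>j\<in>J. mean (h j) (f j))"
    and "integrable (profile_measure J h) (\<lambda>a. \<Prod>j\<in>J. f j (a j))"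
proof -
  interpret product_prob_space "\<lambda>j. as_measure (h j)" by (rule product_prob_space_as_measure)
  show "(\<integral>a. (\<Prod>j\<in>J. f j (a j)) \<partial>profile_measure J h) = (\<Prod>j\<in>J. mean (h j) (f j))"
    by (intro product_integral_prod integrable_continuous assms)
  show "integrable (profile_measure J h) (\<lambda>a. \<Prod>j\<in>J. f j (a j))"
    by (intro product_integrable_prod integrable_continuous assms)
qed

lemma integral_profile_measure_component:
  fixes f :: "'a::metric_space \<Rightarrow> real"
  assumes "compact (UNIV :: 'a set)" "finite J" "continuous_on UNIV f" "i \<in> J"
  shows "(\<integral>a. f (a i) \<partial>profile_measure J h) = mean (h i) f"
    and "integrable (profile_measure J h) (\<lambda>a. f (a i))"
proof -
  define F where "F j = (if j = i then f else (\<lambda>_. 1))" for j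
  have cont: "continuous_on UNIV (F j)" for j using assms(3) by (simp add: F_def)
  have 1: "(\<Prod>j\<in>J. F j (a j)) = f (a i)" for a
  proof -
    have "(\<Prod>j\<in>J. F j (a j)) = (\<Prod>j\<in>J. if j = i then f (a j) else 1)"
      by (rule prod.cong) (auto simp: F_def)
    then show ?thesis using assms(2,4) by simp
  qed
  have 2: "(\<Prod>j\<in>J. mean (h j) (F j)) = mean (h i) f"
  proof -
    have "(\<Prod>j\<in>J. mean (h j) (F j)) = (\<Prod>j\<in>J. if j = i then mean (h j) f else 1)"
      by (rule prod.cong) (auto simp: F_def)
    then show ?thesis using assms(2,4) by simp
  qed
  show "(\<integral>a. f (a i) \<partial>profile_measure J h) = mean (h i) f"
    using integral_profile_measure_prod(1)[OF assms(1,2), of F h, OF cont] unfolding 1 2 .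
  show "integrable (profile_measure J h) (\<lambda>a. f (a i))"
    using integral_profile_measure_prod(2)[OF assms(1,2), of F h, OF cont] unfolding 1 .
qed

text \<open>Uniform continuity for the largest distance over \<open>J\<close>. It also forces
  \<open>U\<close> to depend on the coordinates in \<open>J\<close> alone, which legitimates
  evaluating \<open>U\<close> at extensional profiles below.\<close>

definition uniform_on_profiles :: "'j set \<Rightarrow> (('j \<Rightarrow> 'a::metric_space) \<Rightarrow> real) \<Rightarrow> bool" where
  "uniform_on_profiles J U \<longleftrightarrow> (\<forall>e>0. \<exists>d>0. \<forall>a b. (\<forall>j\<in>J. dist (a j) (b j) < d) \<longrightarrow> \<bar>U a - U b\<bar> < e)"

text \<open>Products of one-player partitions of unity form a partition of unity on profiles. The
  resulting finite sums of products are the functions that independence integrates factor by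
  factor.\<close>

lemma uniform_on_profiles_approx:
  fixes U :: "('j \<Rightarrow> 'a::metric_space) \<Rightarrow> real"
  assumes cpt: "compact (UNIV :: 'a set)" and J: "finite J" and U: "uniform_on_profiles J U" and "e > 0"
  obtains C :: "'a set" and \<phi> :: "'a \<Rightarrow> 'a \<Rightarrow> real"
  where "finite C" "\<And>c. continuous_on UNIV (\<phi> c)"
    "\<And>a. \<bar>(\<Sum>c\<in>J \<rightarrow>\<^sub>E C. (\<Prod>j\<in>J. \<phi> (c j) (a j)) * U c) - U a\<bar> \<le> e"
proof -
  have "\<exists>d>0. \<forall>a b. (\<forall>j\<in>J. dist (a j) (b j) < d) \<longrightarrow> \<bar>U a - U b\<bar> < e"
    by (rule U[unfolded uniform_on_profiles_def, THEN spec, THEN mp, OF \<open>e > 0\<close>])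
  then obtain d where d: "d > 0" "\<forall>a b. (\<forall>j\<in>J. dist (a j) (b j) < d) \<longrightarrow> \<bar>U a - U b\<bar> < e"
    by (elim exE conjE) (rule that)
  obtain C and \<phi> :: "'a \<Rightarrow> 'a \<Rightarrow> real" where "partition_of_unity (UNIV :: 'a set) d C \<phi>"
    using ex_partition_of_unity[OF cpt d(1)] by blast
  note C = partition_of_unityD[OF this]
  show thesis
  proof (rule that[of C \<phi>])
    fix a
    show "\<bar>(\<Sum>c\<in>J \<rightarrow>\<^sub>E C. (\<Prod>j\<in>J. \<phi> (c j) (a j)) * U c) - U a\<bar> \<le> e"
    proof (rule weighted_sum_diff_le)
      fix c
      show nn: "0 \<le> (\<Prod>j\<in>J. \<phi> (c j) (a j))" by (intro prod_nonneg ballI C(5))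
      assume "0 < (\<Prod>j\<in>J. \<phi> (c j) (a j))"
      then have "\<phi> (c j) (a j) \<noteq> 0" if "j \<in> J" for j using that J by (metis less_irrefl prod_zero)
      then have "\<phi> (c j) (a j) > 0" if "j \<in> J" for j using that C(5)[of "c j" "a j"] by fastforce
      then have "\<forall>j\<in>J. dist (a j) (c j) < d" by (auto intro: C(7))
      then have "\<bar>U a - U c\<bar> < e" by (rule d(2)[THEN spec, THEN spec, THEN mp])
      then show "\<bar>U c - U a\<bar> \<le> e" by (simp add: abs_minus_commute)
    next
      have "(\<Sum>c\<in>J \<rightarrow>\<^sub>E C. \<Prod>j\<in>J. \<phi> (c j) (a j)) = (\<Prod>j\<in>J. \<Sum>c\<in>C. \<phi> c (a j))"
        using J C(1) by (simp add: prod_sum_PiE)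
      also have "\<dots> = 1" using C(6) by simp
      finally show "(\<Sum>c\<in>J \<rightarrow>\<^sub>E C. \<Prod>j\<in>J. \<phi> (c j) (a j)) = 1" .
    qed
  qed (use C(1,4) in auto)
qed

lemma uniform_on_profiles_measurable:
  fixes U :: "('j \<Rightarrow> 'a::metric_space) \<Rightarrow> real"
  assumes cpt: "compact (UNIV :: 'a set)" and J: "finite J" and U: "uniform_on_profiles J U"
  shows "U \<in> borel_measurable (profile_measure J h)"
proof -
  have "\<exists>A. A \<in> borel_measurable (profile_measure J h) \<and> (\<forall>a. \<bar>A a - U a\<bar> \<le> inverse (real (Suc k)))" for k
  proof (rule uniform_on_profiles_approx[OF cpt J U, of "inverse (real (Suc k))"])
    fix C :: "'a set" and \<phi> :: "'a \<Rightarrow> 'a \<Rightarrow> real"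
    let ?A = "\<lambda>a. \<Sum>c\<in>J \<rightarrow>\<^sub>E C. (\<Prod>j\<in>J. \<phi> (c j) (a j)) * U c"
    assume \<phi>: "\<And>c. continuous_on UNIV (\<phi> c)" and "\<And>a. \<bar>?A a - U a\<bar> \<le> inverse (real (Suc k))"
    moreover have "?A \<in> borel_measurable (profile_measure J h)"
    proof (intro borel_measurable_sum borel_measurable_times borel_measurable_const)
      show "(\<lambda>a. \<Prod>j\<in>J. \<phi> (c j) (a j)) \<in> borel_measurable (profile_measure J h)" for c
        using integral_profile_measure_prod(2)[OF cpt J, of "\<lambda>j. \<phi> (c j)" h] \<phi>
        by (simp add: borel_measurable_integrable)
    qed
    ultimately show ?thesis by blast
  qed simp
  then obtain A where A: "\<And>k. A k \<in> borel_measurable (profile_measure J h)"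
    "\<And>k a. \<bar>A k a - U a\<bar> \<le> inverse (real (Suc k))" by metis
  have "(\<lambda>k. A k a) \<longlonglongrightarrow> U a" for a
  proof -
    have "(\<lambda>k. A k a - U a) \<longlonglongrightarrow> 0"
      by (rule Lim_null_comparison[OF _ LIMSEQ_inverse_real_of_nat]) (use A(2) in auto)
    then show ?thesis by (simp add: LIM_zero_iff)
  qed
  then show ?thesis by (rule borel_measurable_LIMSEQ_real[OF _ A(1)])
qed

lemma integrable_uniform_on_profiles:
  fixes U :: "('j \<Rightarrow> 'a::metric_space) \<Rightarrow> real"
  assumes "compact (UNIV :: 'a set)" "finite J" "uniform_on_profiles J U" "\<And>a. \<bar>U a\<bar> \<le> B"
  shows "integrable (profile_measure J h) U"
proof -
  interpret prob_space "profile_measure J h" by (rule prob_space_profile_measure)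
  show ?thesis
    using uniform_on_profiles_measurable[OF assms(1-3)] assms(4)
    by (intro integrable_const_bound[where B=B]) auto
qed

text \<open>\<open>C\<close> and \<phi> are chosen before \<open>h\<close>: one multilinear
  polynomial in the players' means approximates the integral for all profiles at once. Weak
  continuity in the profile and affinity in each single strategy are both inherited from it.\<close>

lemma integral_profile_measure_approx:
  fixes U :: "('j \<Rightarrow> 'a::metric_space) \<Rightarrow> real"
  assumes cpt: "compact (UNIV :: 'a set)" and J: "finite J" and U: "uniform_on_profiles J U"
    and B: "\<And>a. \<bar>U a\<bar> \<le> B" and "e > 0"
  obtains C :: "'a set" and \<phi> :: "'a \<Rightarrow> 'a \<Rightarrow> real"
  where "finite C" "\<And>c. continuous_on UNIV (\<phi> c)"
    "\<And>h. \<bar>(\<Sum>c\<in>J \<rightarrow>\<^sub>E C. (\<Prod>j\<in>J. mean (h j) (\<phi> (c j))) * U c) - (\<integral>a. U a \<partial>profile_measure J h)\<bar> \<le> e"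
proof -
  obtain C and \<phi> :: "'a \<Rightarrow> 'a \<Rightarrow> real" where C: "finite C" "\<And>c. continuous_on UNIV (\<phi> c)"
    and le: "\<And>a. \<bar>(\<Sum>c\<in>J \<rightarrow>\<^sub>E C. (\<Prod>j\<in>J. \<phi> (c j) (a j)) * U c) - U a\<bar> \<le> e"
    using uniform_on_profiles_approx[OF cpt J U \<open>e > 0\<close>] by blast
  show thesis
  proof (rule that[OF C])
    fix h :: "'j \<Rightarrow> 'a prob_measure"
    interpret prob_space "profile_measure J h" by (rule prob_space_profile_measure)
    let ?A = "\<lambda>a. \<Sum>c\<in>J \<rightarrow>\<^sub>E C. (\<Prod>j\<in>J. \<phi> (c j) (a j)) * U c"
    have prod: "integrable (profile_measure J h) (\<lambda>a. \<Prod>j\<in>J. \<phi> (c j) (a j))" for c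
      by (rule integral_profile_measure_prod(2)[OF cpt J]) (rule C(2))
    have A: "integrable (profile_measure J h) ?A"
      by (intro Bochner_Integration.integrable_sum integrable_mult_left prod)
    have U_int: "integrable (profile_measure J h) U"
      by (rule integrable_uniform_on_profiles[OF cpt J U B])
    have "(\<integral>a. ?A a \<partial>profile_measure J h) = (\<Sum>c\<in>J \<rightarrow>\<^sub>E C. (\<Prod>j\<in>J. mean (h j) (\<phi> (c j))) * U c)"
      using prod by (simp add: integral_profile_measure_prod(1)[OF cpt J C(2)])
    then have "\<bar>(\<Sum>c\<in>J \<rightarrow>\<^sub>E C. (\<Prod>j\<in>J. mean (h j) (\<phi> (c j))) * U c) - (\<integral>a. U a \<partial>profile_measure J h)\<bar>
        = \<bar>\<integral>a. ?A a - U a \<partial>profile_measure J h\<bar>"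
      using A U_int by simp
    also have "\<dots> \<le> (\<integral>a. \<bar>?A a - U a\<bar> \<partial>profile_measure J h)" by (rule integral_abs_bound)
    also have "\<dots> \<le> (\<integral>a. e \<partial>profile_measure J h)"
      using A U_int le by (intro integral_mono) auto
    also have "\<dots> = e" by (simp add: prob_space)
    finally show "\<bar>(\<Sum>c\<in>J \<rightarrow>\<^sub>E C. (\<Prod>j\<in>J. mean (h j) (\<phi> (c j))) * U c) - (\<integral>a. U a \<partial>profile_measure J h)\<bar> \<le> e" .
  qed
qed

lemma tendsto_integral_profile_measure:
  fixes U :: "('j \<Rightarrow> 'a::metric_space) \<Rightarrow> real"
  assumes cpt: "compact (UNIV :: 'a set)" and J: "finite J" and U: "uniform_on_profiles J U"
    and B: "\<And>a. \<bar>U a\<bar> \<le> B" and lim: "\<And>j. j \<in> J \<Longrightarrow> (\<lambda>k::nat. X k j) \<longlonglongrightarrow> h j"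
  shows "(\<lambda>k. \<integral>a. U a \<partial>profile_measure J (X k)) \<longlonglongrightarrow> (\<integral>a. U a \<partial>profile_measure J h)"
proof (rule tendstoI)
  fix e :: real assume e: "e > 0"
  let ?I = "\<lambda>h. \<integral>a. U a \<partial>profile_measure J h"
  obtain C and \<phi> :: "'a \<Rightarrow> 'a \<Rightarrow> real" where C: "finite C" "\<And>c. continuous_on UNIV (\<phi> c)"
    and le: "\<And>h. \<bar>(\<Sum>c\<in>J \<rightarrow>\<^sub>E C. (\<Prod>j\<in>J. mean (h j) (\<phi> (c j))) * U c) - ?I h\<bar> \<le> e/4"
    using integral_profile_measure_approx[OF cpt J U B, of "e/4"] e by auto
  let ?A = "\<lambda>h. \<Sum>c\<in>J \<rightarrow>\<^sub>E C. (\<Prod>j\<in>J. mean (h j) (\<phi> (c j))) * U c"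
  have "(\<lambda>k. ?A (X k)) \<longlonglongrightarrow> ?A h"
    by (intro tendsto_sum tendsto_mult tendsto_prod tendsto_const tendsto_mean[OF cpt C(2) lim])
  then have "\<forall>\<^sub>F k in sequentially. dist (?A (X k)) (?A h) < e/4" using e by (intro tendstoD) auto
  then show "\<forall>\<^sub>F k in sequentially. dist (?I (X k)) (?I h) < e"
  proof eventually_elim
    case (elim k)
    then show ?case using le[of "X k"] le[of h] e unfolding dist_real_def by linarith
  qed
qed

text \<open>The approximating polynomial is affine in the strategy of player \<open>i\<close>, so
  the two sides differ by at most any positive \<open>e\<close>.\<close>

lemma integral_profile_measure_mix:
  fixes U :: "('j \<Rightarrow> 'a::metric_space) \<Rightarrow> real"
  assumes cpt: "compact (UNIV :: 'a set)" and J: "finite J" "i \<in> J" and U: "uniform_on_profiles J U"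
    and B: "\<And>a. \<bar>U a\<bar> \<le> B" and S: "finite S" "\<And>s. s \<in> S \<Longrightarrow> 0 \<le> w s" "(\<Sum>s\<in>S. w s) = 1"
  shows "(\<integral>a. U a \<partial>profile_measure J (h(i := mix S w m))) =
    (\<Sum>s\<in>S. w s * (\<integral>a. U a \<partial>profile_measure J (h(i := m s))))" (is "?I (mix S w m) = ?R")
proof -
  have "\<bar>?I (mix S w m) - ?R\<bar> \<le> 0 + e" if "e > 0" for e
  proof -
    obtain C and \<phi> :: "'a \<Rightarrow> 'a \<Rightarrow> real" where C: "finite C" "\<And>c. continuous_on UNIV (\<phi> c)"
      and le: "\<And>h. \<bar>(\<Sum>c\<in>J \<rightarrow>\<^sub>E C. (\<Prod>j\<in>J. mean (h j) (\<phi> (c j))) * U c) - (\<integral>a. U a \<partial>profile_measure J h)\<bar> \<le> e/2"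
      using integral_profile_measure_approx[OF cpt J(1) U B, of "e/2"] \<open>e > 0\<close> by auto
    define A where "A \<mu> = (\<Sum>c\<in>J \<rightarrow>\<^sub>E C. (\<Prod>j\<in>J. mean ((h(i := \<mu>)) j) (\<phi> (c j))) * U c)" for \<mu>
    have A: "A \<mu> = (\<Sum>c\<in>J \<rightarrow>\<^sub>E C. mean \<mu> (\<phi> (c i)) * ((\<Prod>j\<in>J - {i}. mean (h j) (\<phi> (c j))) * U c))" for \<mu>
    proof -
      have "(\<Prod>j\<in>J. mean ((h(i := \<mu>)) j) (\<phi> (c j))) =
          mean \<mu> (\<phi> (c i)) * (\<Prod>j\<in>J - {i}. mean (h j) (\<phi> (c j)))" for c
        by (subst prod.remove[OF J]) (auto intro!: prod.cong)
      then show ?thesis by (simp add: A_def mult.assoc)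
    qed
    have "A (mix S w m) = (\<Sum>c\<in>J \<rightarrow>\<^sub>E C. \<Sum>s\<in>S. w s * (mean (m s) (\<phi> (c i)) * ((\<Prod>j\<in>J - {i}. mean (h j) (\<phi> (c j))) * U c)))"
    proof -
      have "mean (mix S w m) (\<phi> c) = (\<Sum>s\<in>S. w s * mean (m s) (\<phi> c))" for c
        by (rule mean_mix_continuous[OF cpt C(2) S])
      then show ?thesis by (simp only: A sum_distrib_right mult.assoc)
    qed
    also have "\<dots> = (\<Sum>s\<in>S. w s * A (m s))"
      unfolding A by (subst sum.swap) (simp add: sum_distrib_left)
    finally have eq: "A (mix S w m) = (\<Sum>s\<in>S. w s * A (m s))" .
    have close: "\<bar>A \<mu> - ?I \<mu>\<bar> \<le> e/2" for \<mu> unfolding A_def by (rule le)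
    have "\<bar>(\<Sum>s\<in>S. w s * A (m s)) - ?R\<bar> = \<bar>\<Sum>s\<in>S. w s * (A (m s) - ?I (m s))\<bar>"
      by (simp add: right_diff_distrib sum_subtractf)
    also have "\<dots> \<le> (\<Sum>s\<in>S. w s * (e/2))"
    proof (intro order_trans[OF sum_abs] sum_mono)
      fix s assume "s \<in> S"
      then show "\<bar>w s * (A (m s) - ?I (m s))\<bar> \<le> w s * (e/2)"
        unfolding abs_mult abs_of_nonneg[OF S(2)[OF \<open>s \<in> S\<close>]] by (intro mult_left_mono close S(2))
    qed
    also have "\<dots> = e/2" unfolding sum_distrib_right[symmetric] S(3) by simp
    finally show ?thesis using close[of "mix S w m"] eq by linarith
  qed
  then have "\<bar>?I (mix S w m) - ?R\<bar> \<le> 0" by (rule field_le_epsilon)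
  then show ?thesis by simp
qed

section \<open>Nash equilibria of finite-player games\<close>

lemma mean_finite_summary_dirac:
  assumes L: "finite_player_space n L"
    and f: "f \<in> borel_measurable borel" "\<And>x. \<bar>f x\<bar> \<le> B"
  shows "mean (finite_summary L (\<lambda>j. dirac (a j))) f = (\<Sum>j\<in>space L. measure L {j} * f (a j))"
  by (subst mean_finite_summary[OF L f]) (simp add: integral_return f(1))

definition realized_payoff ::
    "'j measure \<Rightarrow> ('j, 'a::metric_space) game \<Rightarrow> 'j \<Rightarrow> ('j \<Rightarrow> 'a) \<Rightarrow> real" where
  "realized_payoff L G i a = payoff G i (a i) (finite_summary L (\<lambda>j. dirac (a j)))"

lemma realized_payoff_bound: "\<bar>realized_payoff L G i a\<bar> \<le> norm (snd (G i))"
  unfolding realized_payoff_def by (rule bcontfun_bound)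

text \<open>Without a metric on measures no modulus of the payoff is at hand. Instead, sequences
  violating uniformity are thinned out until both tend to the same profile \<open>l\<close>; the
  realized distributions then converge as well, contradicting continuity of the payoff.\<close>

lemma uniform_on_profiles_realized_payoff:
  fixes G :: "('j, 'a::metric_space) game"
  assumes cpt: "compact (UNIV :: 'a set)" and L: "finite_player_space n L" and i: "i \<in> space L"
  shows "uniform_on_profiles (space L) (realized_payoff L G i)"
  unfolding uniform_on_profiles_def
proof (rule allI, rule impI, rule ccontr)
  fix e :: real assume e: "e > 0"
  let ?J = "space L" and ?U = "realized_payoff L G i"
  assume neg: "\<not> (\<exists>d>0. \<forall>a b. (\<forall>j\<in>?J. dist (a j) (b j) < d) \<longrightarrow> \<bar>?U a - ?U b\<bar> < e)"
  have "\<exists>a b. (\<forall>j\<in>?J. dist (a j) (b j) < inverse (real (Suc k))) \<and> \<not> \<bar>?U a - ?U b\<bar> < e" for k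
  proof -
    have "0 < inverse (real (Suc k))" by simp
    with neg show ?thesis by blast
  qed
  then obtain a b where ab: "\<And>k j. j \<in> ?J \<Longrightarrow> dist (a k j) (b k j) < inverse (real (Suc k))"
    "\<And>k. e \<le> \<bar>?U (a k) - ?U (b k)\<bar>" by (metis not_less)
  have fin: "finite ?J" by (rule finite_player_spaceD[OF L])
  have "\<exists>l r. strict_mono (r :: nat \<Rightarrow> nat) \<and> (\<forall>j\<in>?J. l j \<in> UNIV \<and> (\<lambda>k. a (r k) j) \<longlonglongrightarrow> l j)"
    using cpt by (intro seq_compact_finite_family fin) (simp_all add: compact_eq_seq_compact_metric)
  then obtain l r where r: "strict_mono (r :: nat \<Rightarrow> nat)"
    and a_lim: "\<And>j. j \<in> ?J \<Longrightarrow> (\<lambda>k. a (r k) j) \<longlonglongrightarrow> l j" by auto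
  have inv: "(\<lambda>k. inverse (real (Suc (r k)))) \<longlonglongrightarrow> 0"
    using LIMSEQ_subseq_LIMSEQ[OF LIMSEQ_inverse_real_of_nat r] by (simp add: comp_def)
  have b_lim: "(\<lambda>k. b (r k) j) \<longlonglongrightarrow> l j" if j: "j \<in> ?J" for j
  proof -
    have "(\<lambda>k. dist (a (r k) j) (l j)) \<longlonglongrightarrow> 0" using a_lim[OF j] by (simp add: tendsto_dist_iff[of _ "l j"])
    from tendsto_add[OF this inv] have lim0: "(\<lambda>k. dist (a (r k) j) (l j) + inverse (real (Suc (r k)))) \<longlonglongrightarrow> 0" by simp
    have "norm (dist (b (r k) j) (l j)) \<le> dist (a (r k) j) (l j) + inverse (real (Suc (r k)))" for k
      using ab(1)[OF j, of "r k"] dist_triangle3[of "b (r k) j" "l j" "a (r k) j"] by simp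
    then have "(\<lambda>k. dist (b (r k) j) (l j)) \<longlonglongrightarrow> 0"
      by (intro Lim_null_comparison[OF always_eventually lim0] allI)
    then show ?thesis by (simp add: tendsto_dist_iff[of _ "l j"])
  qed
  have U_lim: "(\<lambda>k. ?U (c k)) \<longlonglongrightarrow> ?U l" if c: "\<And>j. j \<in> ?J \<Longrightarrow> (\<lambda>k. c k j) \<longlonglongrightarrow> l j" for c :: "nat \<Rightarrow> 'j \<Rightarrow> 'a"
  proof -
    have "(\<lambda>k. finite_summary L (\<lambda>j. dirac (c k j))) \<longlonglongrightarrow> finite_summary L (\<lambda>j. dirac (l j))"
      unfolding tendsto_prob_measure_iff
    proof
      fix f :: "'a \<Rightarrow>\<^sub>C real"
      have "(\<lambda>k. f (c k j)) \<longlonglongrightarrow> f (l j)" if "j \<in> ?J" for j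
        by (rule continuous_on_tendsto_compose[OF continuous_on_apply_bcontfun[where T=UNIV] c[OF that]]) auto
      note f_lim = this
      show "(\<lambda>k. mean (finite_summary L (\<lambda>j. dirac (c k j))) f) \<longlonglongrightarrow> mean (finite_summary L (\<lambda>j. dirac (l j))) f"
        unfolding mean_finite_summary_dirac[OF L borel_measurable_bcontfun bcontfun_bound]
        by (rule tendsto_sum, rule tendsto_mult_left, rule f_lim)
    qed
    then have "(\<lambda>k. (c k i, finite_summary L (\<lambda>j. dirac (c k j)))) \<longlonglongrightarrow> (l i, finite_summary L (\<lambda>j. dirac (l j)))"
      by (rule tendsto_Pair[OF c[OF i]])
    then show ?thesis
      unfolding realized_payoff_def
      by (rule continuous_on_tendsto_compose[OF continuous_on_apply_bcontfun[where T=UNIV]]) auto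
  qed
  have "(\<lambda>k. \<bar>?U (a (r k)) - ?U (b (r k))\<bar>) \<longlonglongrightarrow> \<bar>?U l - ?U l\<bar>"
    by (intro tendsto_rabs tendsto_diff U_lim a_lim b_lim)
  then have "\<forall>\<^sub>F k in sequentially. \<bar>?U (a (r k)) - ?U (b (r k))\<bar> < e"
    using e by (intro order_tendstoD) auto
  then obtain k where "\<bar>?U (a (r k)) - ?U (b (r k))\<bar> < e" by (auto simp: eventually_sequentially)
  with ab(2)[of "r k"] show False by simp
qed

text \<open>The product measure gives full mass to the box of feasible actions, so the restricted
  integral is the unrestricted one, to which the continuity and affinity results apply.\<close>

lemma expected_payoff_eq:
  fixes G :: "('j, 'a::metric_space) game"
  assumes cpt: "compact (UNIV :: 'a set)" and L: "finite_player_space n L" and i: "i \<in> space L"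
    and g: "finite_profile L G g"
  shows "expected_payoff L G g i = (\<integral>a. realized_payoff L G i a \<partial>profile_measure (space L) g)"
proof -
  let ?J = "space L" and ?E = "\<Pi>\<^sub>E j\<in>space L. actions G j"
  have fin: "finite ?J" by (rule finite_player_spaceD[OF L])
  interpret product_prob_space "\<lambda>j. as_measure (g j)" ?J by (rule product_prob_space_as_measure)
  have E: "?E \<in> sets (profile_measure ?J g)"
    using fin by (intro sets_PiM_I_finite) (auto intro!: borel_closed compact_imp_closed)
  have "emeasure (profile_measure ?J g) ?E = (\<Prod>j\<in>?J. emeasure (as_measure (g j)) (actions G j))"
    using fin by (intro emeasure_PiM) (auto intro!: borel_closed compact_imp_closed)
  also have "\<dots> = 1"
    using g by (simp add: finite_profile_def finite_measure.emeasure_eq_measure prob_space.finite_measure)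
  finally have "measure (profile_measure ?J g) ?E = 1" by (simp add: measure_def)
  then have "AE a in profile_measure ?J g. a \<in> ?E"
    using prob_space.prob_eq_1[OF prob_space_profile_measure E] by simp
  then show ?thesis
    unfolding expected_payoff_def set_lebesgue_integral_def realized_payoff_def[symmetric]
    using E uniform_on_profiles_measurable[OF cpt fin uniform_on_profiles_realized_payoff[OF cpt L i]]
    by (intro integral_cong_AE) auto
qed

text \<open>Discretization: the mass of \<mu> near a net point is moved onto it, over a distance
  below the mesh. The weights sum to 1 because \<mu> lives on \<open>K\<close>, where the partition
  functions do.\<close>

lemma tendsto_partition_mix:
  fixes \<mu> :: "'a::metric_space prob_measure"
  assumes cpt: "compact (UNIV :: 'a set)" and K: "compact K" "measure (as_measure \<mu>) K = 1"
    and pou: "\<And>k. partition_of_unity K (inverse (real (Suc k))) (C k) (\<phi> k)"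
  shows "(\<lambda>k. mix (C k) (\<lambda>c. mean \<mu> (\<phi> k c)) dirac) \<longlonglongrightarrow> \<mu>"
    and "\<And>k c. 0 \<le> mean \<mu> (\<phi> k c)" and "\<And>k. (\<Sum>c\<in>C k. mean \<mu> (\<phi> k c)) = 1"
proof -
  note C = partition_of_unityD[OF pou]
  have int: "integrable (as_measure \<mu>) (\<phi> k c)" for k c
    by (rule integrable_continuous[OF cpt C(4)])
  have AE: "AE a in as_measure \<mu>. a \<in> K"
    using K by (intro measure_eq_1_imp_AE compact_imp_closed)
  show nn: "0 \<le> mean \<mu> (\<phi> k c)" for k c by (rule Bochner_Integration.integral_nonneg) (rule C(5))
  show one: "(\<Sum>c\<in>C k. mean \<mu> (\<phi> k c)) = 1" for k
  proof -
    have "(\<Sum>c\<in>C k. mean \<mu> (\<phi> k c)) = mean \<mu> (\<lambda>a. \<Sum>c\<in>C k. \<phi> k c a)" using int by simp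
    also have "\<dots> = mean \<mu> (\<lambda>_. 1)"
    proof (rule integral_cong_AE)
      show "AE a in as_measure \<mu>. (\<Sum>c\<in>C k. \<phi> k c a) = 1" using AE by eventually_elim (rule C(6))
    qed (use int in auto)
    finally show ?thesis by simp
  qed
  show "(\<lambda>k. mix (C k) (\<lambda>c. mean \<mu> (\<phi> k c)) dirac) \<longlonglongrightarrow> \<mu>"
    unfolding tendsto_prob_measure_iff
  proof (intro allI LIMSEQ_I)
    fix f :: "'a \<Rightarrow>\<^sub>C real" and e :: real assume e: "e > 0"
    obtain d where d: "d > 0" "\<And>a b. dist a b < d \<Longrightarrow> \<bar>f a - f b\<bar> < e/2"
      by (rule compact_UNIV_uniformly_continuous[OF cpt, of f "e/2"]) (use e in auto)
    obtain N where N: "inverse (real (Suc N)) < d" using reals_Archimedean[OF d(1)] by auto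
    have "norm (mean (mix (C k) (\<lambda>c. mean \<mu> (\<phi> k c)) dirac) f - mean \<mu> f) < e" if "k \<ge> N" for k
    proof -
      have "inverse (real (Suc k)) \<le> inverse (real (Suc N))" using that by (intro le_imp_inverse_le) auto
      from this N have kd: "inverse (real (Suc k)) < d" by (rule le_less_trans)
      let ?s = "\<lambda>a. \<Sum>c\<in>C k. \<phi> k c a * f c"
      have "mean (mix (C k) (\<lambda>c. mean \<mu> (\<phi> k c)) dirac) f = (\<Sum>c\<in>C k. mean \<mu> (\<phi> k c) * f c)"
        by (simp add: mean_mix[OF C(1) nn one borel_measurable_bcontfun bcontfun_bound]
              integral_return borel_measurable_bcontfun)
      also have "\<dots> = mean \<mu> ?s" using int by simp
      finally have "mean (mix (C k) (\<lambda>c. mean \<mu> (\<phi> k c)) dirac) f - mean \<mu> f = mean \<mu> (\<lambda>a. ?s a - f a)"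
        using int integrable_bcontfun[of \<mu> f] by simp
      also have "norm \<dots> \<le> mean \<mu> (\<lambda>a. norm (?s a - f a))" by (rule integral_norm_bound)
      also have "\<dots> \<le> mean \<mu> (\<lambda>a. e/2)"
      proof (rule integral_mono_AE)
        show "integrable (as_measure \<mu>) (\<lambda>a. norm (?s a - f a))"
          using int integrable_bcontfun[of \<mu> f] by (intro integrable_norm) simp
        show "integrable (as_measure \<mu>) (\<lambda>a. e/2)"
          by (simp add: finite_measure.integrable_const prob_space.finite_measure)
        show "AE a in as_measure \<mu>. norm (?s a - f a) \<le> e/2"
          using AE
        proof eventually_elim
          case (elim a)
          have "\<bar>?s a - f a\<bar> \<le> e/2"
          proof (rule weighted_sum_diff_le)
            fix c assume "0 < \<phi> k c a"
            then have "dist a c < d" using C(7)[of k c a] kd by linarith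
            then have "\<bar>f a - f c\<bar> < e/2" by (rule d(2))
            then show "\<bar>f c - f a\<bar> \<le> e/2" by linarith
          qed (use elim C(5,6) in auto)
          then show ?case by simp
        qed
      qed
      also have "\<dots> < e" using e by simp
      finally show ?thesis .
    qed
    then show "\<exists>N. \<forall>k\<ge>N. norm (mean (mix (C k) (\<lambda>c. mean \<mu> (\<phi> k c)) dirac) f - mean \<mu> f) < e" by blast
  qed
qed

lemma measure_mix_dirac:
  fixes K :: "'a::metric_space set"
  assumes cpt: "compact (UNIV :: 'a set)" and K: "closed K" "K \<noteq> {}"
    and C: "finite C" "C \<subseteq> K" "\<And>c. c \<in> C \<Longrightarrow> 0 \<le> w c" "(\<Sum>c\<in>C. w c) = 1"
  shows "measure (as_measure (mix C w dirac)) K = 1"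
proof -
  have cont: "continuous_on UNIV (\<lambda>a. min 1 (infdist a K))" by (intro continuous_intros)
  have "mean (mix C w dirac) (\<lambda>a. min 1 (infdist a K)) = (\<Sum>c\<in>C. w c * min 1 (infdist c K))"
    by (simp add: mean_mix_continuous[OF cpt cont C(1,3,4)]
        integral_return[OF _ borel_measurable_continuous_onI[OF cont]])
  also have "\<dots> = 0" using C(2) by (intro sum.neutral) auto
  finally show ?thesis using measure_eq_1_iff_mean_infdist[OF K] by simp
qed

theorem ex_finite_nash:
  fixes G :: "('j, 'a::metric_space) game"
  assumes cpt: "compact (UNIV :: 'a set)" and L: "finite_player_space n L"
  shows "\<exists>g. finite_nash L G g"
proof -
  let ?J = "space L"
  define F where "F i h = (\<integral>a. realized_payoff L G i a \<partial>profile_measure ?J h)" for i h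
  have J: "finite ?J" by (rule finite_player_spaceD[OF L])
  note U = uniform_on_profiles_realized_payoff[OF cpt L]
  have F_lim: "(\<lambda>k::nat. F i (X k)) \<longlonglongrightarrow> F i h" if "i \<in> ?J" "\<And>j. j \<in> ?J \<Longrightarrow> (\<lambda>k. X k j) \<longlonglongrightarrow> h j" for i X h
    unfolding F_def by (rule tendsto_integral_profile_measure[OF cpt J U[OF that(1)] realized_payoff_bound that(2)])
  have F_mix: "F i (h(i := mix S w m)) = (\<Sum>s\<in>S. w s * F i (h(i := m s)))"
    if "i \<in> ?J" "finite S" "\<And>s. s \<in> S \<Longrightarrow> 0 \<le> w s" "(\<Sum>s\<in>S. w s) = 1"
    for i h w and S :: "'a set" and m
    unfolding F_def by (rule integral_profile_measure_mix[OF cpt J that(1) U[OF that(1)] realized_payoff_bound that(2-4)])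
  have "\<forall>k j. \<exists>C \<phi>. partition_of_unity (actions G j) (inverse (real (Suc k))) C \<phi>"
    by (intro allI ex_partition_of_unity) auto
  then obtain C :: "nat \<Rightarrow> 'j \<Rightarrow> 'a set" and \<phi>
    where pou: "\<And>k j. partition_of_unity (actions G j) (inverse (real (Suc k))) (C k j) (\<phi> k j)"
    unfolding choice_iff by blast
  note C = partition_of_unityD[OF pou]
  have C_ne: "C k j \<noteq> {}" for k j using partition_of_unityD(3)[OF pou[of j k]] by auto
  have "\<exists>p\<in>mixed_profiles ?J (C k). \<forall>i\<in>?J. \<forall>s\<in>C k i.
      F i ((\<lambda>j. mix (C k j) (p j) dirac)(i := dirac s)) \<le>
      (\<Sum>t\<in>C k i. p i t * F i ((\<lambda>j. mix (C k j) (p j) dirac)(i := dirac t)))" for k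
  proof (rule finite_equilibrium[where V="\<lambda>i s p. F i ((\<lambda>j. mix (C k j) (p j) dirac)(i := dirac s))"])
    fix P p i s
    assume P: "\<forall>m::nat. P m \<in> mixed_profiles ?J (C k)" and p: "p \<in> mixed_profiles ?J (C k)"
      and lim: "\<forall>j\<in>?J. \<forall>t\<in>C k j. (\<lambda>m. P m j t) \<longlonglongrightarrow> p j t" and i: "i \<in> ?J"
    show "(\<lambda>m. F i ((\<lambda>j. mix (C k j) (P m j) dirac)(i := dirac s))) \<longlonglongrightarrow>
        F i ((\<lambda>j. mix (C k j) (p j) dirac)(i := dirac s))"
    proof (rule F_lim[OF i])
      fix j assume j: "j \<in> ?J"
      have "(\<lambda>m. mix (C k j) (P m j) dirac) \<longlonglongrightarrow> mix (C k j) (p j) dirac"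
        unfolding tendsto_prob_measure_iff
      proof
        fix f :: "'a \<Rightarrow>\<^sub>C real"
        have mm: "mean (mix (C k j) (q j) dirac) f = (\<Sum>c\<in>C k j. q j c * f c)" if "q \<in> mixed_profiles ?J (C k)" for q
          using that j C(1)
          by (subst mean_mix[OF _ _ _ borel_measurable_bcontfun bcontfun_bound])
            (auto simp: mixed_profiles_def borel_measurable_bcontfun integral_return)
        show "(\<lambda>m. mean (mix (C k j) (P m j) dirac) f) \<longlonglongrightarrow> mean (mix (C k j) (p j) dirac) f"
        proof -
          have "(\<lambda>m. \<Sum>c\<in>C k j. P m j c * f c) \<longlonglongrightarrow> (\<Sum>c\<in>C k j. p j c * f c)"
            using lim j by (intro tendsto_sum tendsto_mult_right) auto
          then show ?thesis using P p by (simp add: mm)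
        qed
      qed
      then show "(\<lambda>m. ((\<lambda>j. mix (C k j) (P m j) dirac)(i := dirac s)) j) \<longlonglongrightarrow>
          ((\<lambda>j. mix (C k j) (p j) dirac)(i := dirac s)) j" by simp
    qed
  qed (use J C(1) C_ne in auto)
  note ex_p = this
  have "\<forall>k. \<exists>p. p \<in> mixed_profiles ?J (C k) \<and> (\<forall>i\<in>?J. \<forall>s\<in>C k i.
      F i ((\<lambda>j. mix (C k j) (p j) dirac)(i := dirac s)) \<le>
      (\<Sum>t\<in>C k i. p i t * F i ((\<lambda>j. mix (C k j) (p j) dirac)(i := dirac t))))"
    by (rule allI, rule ex_p[unfolded Bex_def])
  from choice[OF this] obtain p where "\<forall>k. p k \<in> mixed_profiles ?J (C k) \<and> (\<forall>i\<in>?J. \<forall>s\<in>C k i.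
      F i ((\<lambda>j. mix (C k j) (p k j) dirac)(i := dirac s)) \<le>
      (\<Sum>t\<in>C k i. p k i t * F i ((\<lambda>j. mix (C k j) (p k j) dirac)(i := dirac t))))" ..
  note p = this[THEN spec, THEN conjunct1] and eq = this[THEN spec, THEN conjunct2]
  have p0: "\<And>k j t. j \<in> ?J \<Longrightarrow> t \<in> C k j \<Longrightarrow> 0 \<le> p k j t" and p1: "\<And>k j. j \<in> ?J \<Longrightarrow> (\<Sum>t\<in>C k j. p k j t) = 1"
    using p by (auto simp: mixed_profiles_def)
  define h where "h k = (\<lambda>j. mix (C k j) (p k j) dirac)" for k
  \<comment> \<open>Nash's inequality compares a pure deviation with an average over pure actions;
    by affinity that average is the payoff of \<open>h k\<close> itself.\<close>
  have h_eq: "F i ((h k)(i := dirac s)) \<le> F i (h k)" if "i \<in> ?J" "s \<in> C k i" for k i s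
  proof -
    have "(h k)(i := mix (C k i) (p k i) dirac) = h k" by (rule ext) (simp add: h_def)
    then have "F i (h k) = F i ((h k)(i := mix (C k i) (p k i) dirac))" by simp
    also have "\<dots> = (\<Sum>t\<in>C k i. p k i t * F i ((h k)(i := dirac t)))"
      using that C(1) p0 p1 by (intro F_mix) auto
    finally show ?thesis using eq[THEN bspec, THEN bspec, OF that] by (simp add: h_def)
  qed
  have "\<exists>l r. strict_mono (r :: nat \<Rightarrow> nat) \<and> (\<forall>j\<in>?J. l j \<in> UNIV \<and> (\<lambda>k. h (r k) j) \<longlonglongrightarrow> l j)"
    using seq_compact_prob_measure[OF cpt] by (intro seq_compact_finite_family J) simp_all
  then obtain g r where r: "strict_mono (r :: nat \<Rightarrow> nat)"
    and lim: "\<And>j. j \<in> ?J \<Longrightarrow> (\<lambda>k. h (r k) j) \<longlonglongrightarrow> g j" by auto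
  have g: "finite_profile L G g"
    unfolding finite_profile_def
  proof
    fix j assume j: "j \<in> ?J"
    show "measure (as_measure (g j)) (actions G j) = 1"
    proof (rule measure_eq_1_tendsto[OF cpt _ _ lim[OF j]])
      show "measure (as_measure (h (r k) j)) (actions G j) = 1" for k
        unfolding h_def using C(1,2) p0[OF j] p1[OF j]
        by (intro measure_mix_dirac[OF cpt]) (auto intro: compact_imp_closed)
    qed (auto intro: compact_imp_closed)
  qed
  have "expected_payoff L G (g(i := \<mu>)) i \<le> expected_payoff L G g i"
    if i: "i \<in> ?J" and \<mu>: "\<mu> \<in> prob_measures_on (actions G i)" for i \<mu>
  proof -
    have \<mu>1: "measure (as_measure \<mu>) (actions G i) = 1" using \<mu> by (simp add: prob_measures_on_def)
    have pou_i: "\<And>k. partition_of_unity (actions G i) (inverse (real (Suc k))) (C k i) (\<phi> k i)" by (rule pou)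
    \<comment> \<open>An arbitrary deviation is discretized on the net of player \<open>i\<close>.
      At stage \<open>k\<close> it is then a mixture of pure deviations that \<open>h_eq\<close>
      rules out, and the inequality passes to the limit along \<open>r\<close>.\<close>
    define m where "m k = mix (C k i) (\<lambda>c. mean \<mu> (\<phi> k i c)) dirac" for k
    note m = tendsto_partition_mix[OF cpt _ \<mu>1 pou_i, simplified, folded m_def]
    have "F i ((h k)(i := m k)) \<le> F i (h k)" for k
    proof -
      have "F i ((h k)(i := m k)) = (\<Sum>s\<in>C k i. mean \<mu> (\<phi> k i s) * F i ((h k)(i := dirac s)))"
        unfolding m_def using i C(1) m(2,3) by (intro F_mix) auto
      also have "\<dots> \<le> (\<Sum>s\<in>C k i. mean \<mu> (\<phi> k i s) * F i (h k))"
        using h_eq[OF i] m(2) by (intro sum_mono mult_left_mono) auto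
      also have "\<dots> = F i (h k)" unfolding sum_distrib_right[symmetric] m(3) by simp
      finally show ?thesis .
    qed
    moreover have "(\<lambda>k. F i ((h (r k))(i := m (r k)))) \<longlonglongrightarrow> F i (g(i := \<mu>))"
    proof (rule F_lim[OF i])
      show "(\<lambda>k. ((h (r k))(i := m (r k))) j) \<longlonglongrightarrow> (g(i := \<mu>)) j" if "j \<in> ?J" for j
        using lim[OF that] LIMSEQ_subseq_LIMSEQ[OF m(1) r] by (cases "j = i") (simp_all add: comp_def)
    qed
    moreover have "(\<lambda>k. F i (h (r k))) \<longlonglongrightarrow> F i g" by (rule F_lim[OF i lim])
    ultimately have "F i (g(i := \<mu>)) \<le> F i g" by (intro LIMSEQ_le) auto
    moreover have "finite_profile L G (g(i := \<mu>))" using g \<mu>1 by (simp add: finite_profile_def)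
    ultimately show ?thesis
      using g by (simp add: expected_payoff_eq[OF cpt L i] F_def)
  qed
  with g show ?thesis unfolding finite_nash_def by blast
qed

section \<open>Concentration of the realized action distribution\<close>

lemma integral_profile_measure_pair:
  fixes f :: "'j \<Rightarrow> 'a::metric_space \<Rightarrow> real"
  assumes cpt: "compact (UNIV :: 'a set)" and J: "finite J" "j \<in> J" "l \<in> J" "j \<noteq> l"
    and f: "\<And>j. continuous_on UNIV (f j)"
  shows "(\<integral>a. f j (a j) * f l (a l) \<partial>profile_measure J h) = mean (h j) (f j) * mean (h l) (f l)"
    and "integrable (profile_measure J h) (\<lambda>a. f j (a j) * f l (a l))"
proof -
  define F where "F k = (if k = j \<or> k = l then f k else (\<lambda>_. 1))" for k
  have cont: "continuous_on UNIV (F k)" for k using f by (simp add: F_def)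
  have split: "(\<Prod>k\<in>J. X k) = X j * X l" if "\<And>k. k \<in> J \<Longrightarrow> k \<noteq> j \<Longrightarrow> k \<noteq> l \<Longrightarrow> X k = 1" for X :: "'j \<Rightarrow> real"
  proof -
    have "(\<Prod>k\<in>J. X k) = X j * (\<Prod>k\<in>J - {j}. X k)" by (rule prod.remove) fact+
    also have "(\<Prod>k\<in>J - {j}. X k) = X l * (\<Prod>k\<in>J - {j} - {l}. X k)"
      using J by (intro prod.remove) auto
    also have "(\<Prod>k\<in>J - {j} - {l}. X k) = 1" using that by (intro prod.neutral) auto
    finally show ?thesis by simp
  qed
  have 1: "(\<Prod>k\<in>J. F k (a k)) = f j (a j) * f l (a l)" for a
    by (subst split) (simp_all add: F_def)
  have 2: "(\<Prod>k\<in>J. mean (h k) (F k)) = mean (h j) (f j) * mean (h l) (f l)"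
    by (subst split) (simp_all add: F_def)
  show "(\<integral>a. f j (a j) * f l (a l) \<partial>profile_measure J h) = mean (h j) (f j) * mean (h l) (f l)"
    using integral_profile_measure_prod(1)[OF cpt J(1), of F h, OF cont] unfolding 1 2 .
  show "integrable (profile_measure J h) (\<lambda>a. f j (a j) * f l (a l))"
    using integral_profile_measure_prod(2)[OF cpt J(1), of F h, OF cont] unfolding 1 .
qed

text \<open>Bias and variance: the cross terms of the centred summands vanish by independence, and
  the sum of \<open>(w j)^2\<close> times a variance is at most
  \<open>(norm f)^2 * \<Lambda>\<close>, since one factor \<open>w j\<close> is bounded by \<Lambda>
  and the other sums to 1. The free constant \<open>c\<close> will be the test integral of the limit
  \<tau>.\<close>

lemma integral_square_deviation_le:
  fixes f :: "'a::metric_space \<Rightarrow>\<^sub>C real"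
  assumes cpt: "compact (UNIV :: 'a set)" and L: "finite_player_space n L"
    and \<Lambda>: "\<And>j. j \<in> space L \<Longrightarrow> measure L {j} \<le> \<Lambda>"
  shows "(\<integral>a. ((\<Sum>j\<in>space L. measure L {j} * f (a j)) - c)\<^sup>2 \<partial>profile_measure (space L) h)
      \<le> (norm f)\<^sup>2 * \<Lambda> + ((\<Sum>j\<in>space L. measure L {j} * mean (h j) f) - c)\<^sup>2"
    and "integrable (profile_measure (space L) h) (\<lambda>a. ((\<Sum>j\<in>space L. measure L {j} * f (a j)) - c)\<^sup>2)"
proof -
  let ?J = "space L" and ?P = "profile_measure (space L) h"
  define w where "w j = measure L {j}" for j
  define g where "g j = (\<lambda>x. f x - mean (h j) f)" for j
  define b where "b = (\<Sum>j\<in>?J. w j * mean (h j) f) - c"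
  interpret P: prob_space ?P by (rule prob_space_profile_measure)
  have J: "finite ?J" and w0: "0 \<le> w j" and w1: "(\<Sum>j\<in>?J. w j) = 1" for j
    using finite_player_spaceD[OF L] by (simp_all add: w_def)
  have g: "continuous_on UNIV (g j)" for j unfolding g_def by (intro continuous_intros) auto
  have g2: "continuous_on UNIV (\<lambda>x. g j x * g j x)" for j using g by (intro continuous_intros)
  have g_mean: "mean (h j) (g j) = 0" for j
    unfolding g_def
    by (subst Bochner_Integration.integral_diff[OF integrable_bcontfun integrable_const_as_measure]) simp
  have int1: "integrable ?P (\<lambda>a. g j (a j))" if "j \<in> ?J" for j
    by (rule integral_profile_measure_component(2)[OF cpt J g that])
  have int2: "integrable ?P (\<lambda>a. g j (a j) * g l (a l))" if "j \<in> ?J" "l \<in> ?J" for j l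
  proof (cases "j = l")
    case True
    then show ?thesis using integral_profile_measure_component(2)[OF cpt J g2 that(1)] by simp
  next
    case False
    show ?thesis by (rule integral_profile_measure_pair(2)[OF cpt J that False g])
  qed
  have var: "(\<integral>a. g j (a j) * g j (a j) \<partial>?P) \<le> (norm f)\<^sup>2" if "j \<in> ?J" for j
  proof -
    have f2: "integrable (as_measure (h j)) (\<lambda>x. f x * f x)"
      by (intro integrable_continuous[OF cpt] continuous_intros) auto
    have "(\<integral>a. g j (a j) * g j (a j) \<partial>?P) = mean (h j) (\<lambda>x. g j x * g j x)"
      by (rule integral_profile_measure_component(1)[OF cpt J g2 that])
    also have "\<dots> = mean (h j) (\<lambda>x. f x * f x - 2 * mean (h j) f * f x + mean (h j) f * mean (h j) f)"
      by (simp add: g_def algebra_simps)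
    also have "\<dots> = mean (h j) (\<lambda>x. f x * f x) - mean (h j) f * mean (h j) f"
      using f2 integrable_bcontfun[of "h j" f] finite_measure.integrable_const[OF prob_space.finite_measure[OF prob_space_as_measure]]
      by (simp add: algebra_simps)
    also have "\<dots> \<le> mean (h j) (\<lambda>x. f x * f x)" by simp
    also have "\<dots> \<le> \<bar>mean (h j) (\<lambda>x. f x * f x)\<bar>" by simp
    also have "\<dots> \<le> (norm f)\<^sup>2"
    proof (rule abs_mean_le)
      show "\<bar>f x * f x\<bar> \<le> (norm f)\<^sup>2" for x
        unfolding power2_eq_square abs_mult by (intro mult_mono bcontfun_bound) auto
    qed
    finally show ?thesis .
  qed
  define T where "T a = (\<Sum>j\<in>?J. w j * g j (a j))" for a
  have T2_eq: "(T a)\<^sup>2 = (\<Sum>j\<in>?J. \<Sum>l\<in>?J. w j * w l * (g j (a j) * g l (a l)))" for a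
    unfolding T_def power2_eq_square sum_product by (intro sum.cong) auto
  have T_int: "integrable ?P T" unfolding T_def using int1 by auto
  have T2_int: "integrable ?P (\<lambda>a. (T a)\<^sup>2)"
    unfolding T2_eq by (intro Bochner_Integration.integrable_sum integrable_mult_right int2)
  have T_0: "(\<integral>a. T a \<partial>?P) = 0"
    unfolding T_def using int1
    by (simp add: integral_profile_measure_component(1)[OF cpt J g] g_mean)
  have "(\<integral>a. (T a)\<^sup>2 \<partial>?P) = (\<Sum>j\<in>?J. \<Sum>l\<in>?J. w j * w l * (\<integral>a. g j (a j) * g l (a l) \<partial>?P))"
    unfolding T2_eq using int2 by (simp add: Bochner_Integration.integrable_sum)
  also have "\<dots> = (\<Sum>j\<in>?J. w j * w j * (\<integral>a. g j (a j) * g j (a j) \<partial>?P))"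
  proof (rule sum.cong[OF refl])
    fix j assume j: "j \<in> ?J"
    have "(\<Sum>l\<in>?J. w j * w l * (\<integral>a. g j (a j) * g l (a l) \<partial>?P)) =
        (\<Sum>l\<in>?J. if l = j then w j * w j * (\<integral>a. g j (a j) * g j (a j) \<partial>?P) else 0)"
    proof (rule sum.cong[OF refl])
      fix l assume l: "l \<in> ?J"
      show "w j * w l * (\<integral>a. g j (a j) * g l (a l) \<partial>?P) =
          (if l = j then w j * w j * (\<integral>a. g j (a j) * g j (a j) \<partial>?P) else 0)"
      proof (cases "l = j")
        case False
        then have "(\<integral>a. g j (a j) * g l (a l) \<partial>?P) = mean (h j) (g j) * mean (h l) (g l)"
          using integral_profile_measure_pair(1)[OF cpt J j l, of g h] g by auto
        then show ?thesis using False by (simp add: g_mean)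
      qed simp
    qed
    then show "(\<Sum>l\<in>?J. w j * w l * (\<integral>a. g j (a j) * g l (a l) \<partial>?P)) =
        w j * w j * (\<integral>a. g j (a j) * g j (a j) \<partial>?P)"
      using J j by simp
  qed
  also have "\<dots> \<le> (\<Sum>j\<in>?J. w j * ((norm f)\<^sup>2 * \<Lambda>))"
  proof (rule sum_mono)
    fix j assume j: "j \<in> ?J"
    have "w j * (\<integral>a. g j (a j) * g j (a j) \<partial>?P) \<le> \<Lambda> * (norm f)\<^sup>2"
      using order_trans[OF w0[of j]] \<Lambda>[OF j] w0[of j] var[OF j] by (intro mult_mono) (auto simp: w_def)
    then have "w j * (w j * (\<integral>a. g j (a j) * g j (a j) \<partial>?P)) \<le> w j * (\<Lambda> * (norm f)\<^sup>2)"
      by (rule mult_left_mono) (rule w0)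
    then show "w j * w j * (\<integral>a. g j (a j) * g j (a j) \<partial>?P) \<le> w j * ((norm f)\<^sup>2 * \<Lambda>)"
      by (simp add: mult_ac)
  qed
  also have "\<dots> = (norm f)\<^sup>2 * \<Lambda>" unfolding sum_distrib_right[symmetric] w1 by simp
  finally have T2_le: "(\<integral>a. (T a)\<^sup>2 \<partial>?P) \<le> (norm f)\<^sup>2 * \<Lambda>" .
  have S_eq: "(\<Sum>j\<in>?J. measure L {j} * f (a j)) - c = T a + b" for a
    by (simp add: T_def b_def g_def w_def right_diff_distrib sum_subtractf)
  have sq: "((\<Sum>j\<in>?J. measure L {j} * f (a j)) - c)\<^sup>2 = (T a)\<^sup>2 + 2 * b * T a + b\<^sup>2" for a
    unfolding S_eq power2_sum by simp
  show "integrable ?P (\<lambda>a. ((\<Sum>j\<in>?J. measure L {j} * f (a j)) - c)\<^sup>2)"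
    unfolding sq using T_int T2_int by simp
  have "(\<integral>a. ((\<Sum>j\<in>?J. measure L {j} * f (a j)) - c)\<^sup>2 \<partial>?P) = (\<integral>a. (T a)\<^sup>2 \<partial>?P) + b\<^sup>2"
    unfolding sq using T_int T2_int T_0 P.prob_space by simp
  then show "(\<integral>a. ((\<Sum>j\<in>?J. measure L {j} * f (a j)) - c)\<^sup>2 \<partial>?P)
      \<le> (norm f)\<^sup>2 * \<Lambda> + ((\<Sum>j\<in>?J. measure L {j} * mean (h j) f) - c)\<^sup>2"
    using T2_le by (simp add: b_def w_def)
qed

section \<open>Approximate optimality in large finite games\<close>

definition osc :: "'a::metric_space payoff \<Rightarrow> 'a prob_measure \<Rightarrow> 'a prob_measure set \<Rightarrow> real" where
  "osc u \<tau> V = (SUP x\<in>UNIV \<times> V. \<bar>u x - u (fst x, \<tau>)\<bar>)"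

lemma osc_term_le: "\<bar>apply_bcontfun u (a, \<nu>) - u (a, \<tau>)\<bar> \<le> 2 * norm u"
  for u :: "'a::metric_space payoff"
  using bcontfun_bound[of u "(a, \<nu>)"] bcontfun_bound[of u "(a, \<tau>)"] by linarith

lemma osc_upper:
  fixes u :: "'a::metric_space payoff"
  assumes "\<nu> \<in> V"
  shows "\<bar>u (a, \<nu>) - u (a, \<tau>)\<bar> \<le> osc u \<tau> V"
proof -
  have "bdd_above ((\<lambda>x. \<bar>u x - u (fst x, \<tau>)\<bar>) ` (UNIV \<times> V))"
    by (rule bdd_aboveI2[where M="2 * norm u"]) (use osc_term_le in auto)
  from cSUP_upper[OF _ this, of "(a, \<nu>)"] assms show ?thesis by (simp add: osc_def)
qed

lemma osc_least:
  fixes u :: "'a::metric_space payoff"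
  assumes "V \<noteq> {}" "\<And>a \<nu>. \<nu> \<in> V \<Longrightarrow> \<bar>u (a, \<nu>) - u (a, \<tau>)\<bar> \<le> c"
  shows "osc u \<tau> V \<le> c"
  unfolding osc_def using assms by (intro cSUP_least) auto

lemma osc_nonneg: "\<tau> \<in> V \<Longrightarrow> 0 \<le> osc u \<tau> V"
  using osc_upper[of \<tau> V u undefined \<tau>] by simp

text \<open>Makes the oscillation a continuous function of the characteristic, so that it can be
  averaged along converging laws. The factor 2 counts the two values of \<open>u\<close> that are
  replaced.\<close>

lemma osc_lipschitz:
  fixes u v :: "'a::metric_space payoff"
  assumes "V \<noteq> {}"
  shows "osc u \<tau> V \<le> osc v \<tau> V + 2 * dist u v"
proof (rule osc_least[OF assms])
  fix a \<nu> assume "\<nu> \<in> V"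
  then have "\<bar>v (a, \<nu>) - v (a, \<tau>)\<bar> \<le> osc v \<tau> V" by (rule osc_upper)
  with dist_bounded[of u "(a, \<nu>)" v] dist_bounded[of u "(a, \<tau>)" v]
  show "\<bar>u (a, \<nu>) - u (a, \<tau>)\<bar> \<le> osc v \<tau> V + 2 * dist u v"
    unfolding dist_real_def by linarith
qed

text \<open>Compactness of the action space makes continuity at summary \<tau> uniform in the
  action: actions and summaries witnessing a lasting oscillation would have a subsequence converging
  to some \<open>(a, \<tau>)\<close>, where \<open>u\<close> is continuous.\<close>

lemma osc_nbhd_seq_tendsto_0:
  fixes u :: "'a::metric_space payoff"
  assumes cpt: "compact (UNIV :: 'a set)" and F: "dense_seq F"
  shows "(\<lambda>k. osc u \<tau> (nbhd_seq F \<tau> k)) \<longlonglongrightarrow> 0"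
proof (rule ccontr)
  assume "\<not> ?thesis"
  then obtain e where e: "e > 0" "\<not> (\<exists>N. \<forall>k\<ge>N. norm (osc u \<tau> (nbhd_seq F \<tau> k) - 0) < e)"
    unfolding LIMSEQ_iff by (auto simp only: not_all not_imp)
  have nn: "0 \<le> osc u \<tau> (nbhd_seq F \<tau> k)" for k by (rule osc_nonneg) simp
  have "\<exists>a \<nu>. \<nu> \<in> nbhd_seq F \<tau> N \<and> e/2 < \<bar>u (a, \<nu>) - u (a, \<tau>)\<bar>" for N
  proof (rule ccontr)
    assume neg: "\<not> ?thesis"
    have "osc u \<tau> (nbhd_seq F \<tau> k) < e" if "k \<ge> N" for k
    proof -
      have "nbhd_seq F \<tau> k \<subseteq> nbhd_seq F \<tau> N"
      proof
        fix \<nu> assume \<nu>: "\<nu> \<in> nbhd_seq F \<tau> k"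
        have "1 / real (Suc k) \<le> 1 / real (Suc N)" using that by (simp add: frac_le)
        then show "\<nu> \<in> nbhd_seq F \<tau> N"
          unfolding nbhd_seq_def
        proof (intro CollectI allI impI)
          fix j assume "j \<le> N"
          then have "\<bar>mean \<nu> (F j) - mean \<tau> (F j)\<bar> < 1 / real (Suc k)"
            using \<nu> that by (simp only: nbhd_seq_def mem_Collect_eq)
          with \<open>1 / real (Suc k) \<le> 1 / real (Suc N)\<close>
          show "\<bar>mean \<nu> (F j) - mean \<tau> (F j)\<bar> < 1 / real (Suc N)" by (rule less_le_trans[rotated])
        qed
      qed
      moreover have "nbhd_seq F \<tau> k \<noteq> {}" using nbhd_seq_self by blast
      ultimately have "osc u \<tau> (nbhd_seq F \<tau> k) \<le> e/2"
        using neg by (intro osc_least) (auto simp: not_less)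
      then show ?thesis using e(1) by simp
    qed
    then have "\<exists>N. \<forall>k\<ge>N. norm (osc u \<tau> (nbhd_seq F \<tau> k) - 0) < e" using nn by auto
    with e(2) show False ..
  qed
  then have "\<forall>N. \<exists>x. snd x \<in> nbhd_seq F \<tau> N \<and> e/2 < \<bar>u (fst x, snd x) - u (fst x, \<tau>)\<bar>" by simp
  from choice[OF this] obtain x where x: "\<And>k. snd (x k) \<in> nbhd_seq F \<tau> k"
    "\<And>k. e/2 < \<bar>u (fst (x k), snd (x k)) - u (fst (x k), \<tau>)\<bar>" by blast
  obtain a r where r: "strict_mono (r :: nat \<Rightarrow> nat)" "((\<lambda>k. fst (x k)) \<circ> r) \<longlonglongrightarrow> a"
    using cpt[unfolded compact_eq_seq_compact_metric] by (rule seq_compactE) auto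
  have \<nu>: "(\<lambda>k. snd (x (r k))) \<longlonglongrightarrow> \<tau>"
    using LIMSEQ_subseq_LIMSEQ[OF tendsto_of_mem_nbhd_seq[OF F x(1)] r(1)] by (simp add: comp_def)
  have u_lim: "(\<lambda>k. u (X k)) \<longlonglongrightarrow> u l" if "X \<longlonglongrightarrow> l" for X l
    by (rule continuous_on_tendsto_compose[OF continuous_on_apply_bcontfun[where T=UNIV] that]) auto
  have a: "(\<lambda>k. fst (x (r k))) \<longlonglongrightarrow> a" using r(2) by (simp add: comp_def)
  have "(\<lambda>k. \<bar>u (fst (x (r k)), snd (x (r k))) - u (fst (x (r k)), \<tau>)\<bar>) \<longlonglongrightarrow> \<bar>u (a, \<tau>) - u (a, \<tau>)\<bar>"
    by (rule tendsto_rabs, rule tendsto_diff; rule u_lim; rule tendsto_Pair) (use a \<nu> in simp_all)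
  then have "\<forall>\<^sub>F k in sequentially. \<bar>u (fst (x (r k)), snd (x (r k))) - u (fst (x (r k)), \<tau>)\<bar> < e/2"
    using e(1) by (intro order_tendstoD) auto
  then obtain k where "\<bar>u (fst (x (r k)), snd (x (r k))) - u (fst (x (r k)), \<tau>)\<bar> < e/2"
    by (auto simp: eventually_sequentially)
  with x(2)[of "r k"] show False by simp
qed

lemma continuous_on_payoff_section: "continuous_on S (\<lambda>a. apply_bcontfun u (a, \<tau>))"
  by (rule continuous_on_compose2[of UNIV u]) (auto intro!: continuous_intros)

text \<open>If the realized distribution lies in \<open>nbhd_seq F \<tau> k\<close>, the error is an
  oscillation. Otherwise some test fails by at least 1/(k+1), so the sum of the
  \<open>(k+1)^2\<close> multiples of squared deviations is at least 1 and dominates the trivial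
  bound \<open>2 * norm u\<close> after scaling. This is Chebyshev's inequality in pointwise form,
  followed by the variance bound.\<close>

lemma expected_payoff_deviation_le:
  fixes G :: "('j, 'a::metric_space) game" and F :: "nat \<Rightarrow> ('a \<Rightarrow>\<^sub>C real)"
  assumes cpt: "compact (UNIV :: 'a set)" and L: "finite_player_space n L" and i: "i \<in> space L"
    and \<Lambda>: "\<And>j. j \<in> space L \<Longrightarrow> measure L {j} \<le> \<Lambda>"
  shows "\<bar>(\<integral>a. realized_payoff L G i a \<partial>profile_measure (space L) h) - mean (h i) (\<lambda>a. payoff G i a \<tau>)\<bar>
    \<le> osc (snd (G i)) \<tau> (nbhd_seq F \<tau> k) + 2 * norm (snd (G i)) * (\<Sum>j\<le>k. (real (Suc k))\<^sup>2 *
        ((norm (F j))\<^sup>2 * \<Lambda> + ((\<Sum>l\<in>space L. measure L {l} * mean (h l) (F j)) - mean \<tau> (F j))\<^sup>2))"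
proof -
  let ?J = "space L" and ?P = "profile_measure (space L) h" and ?u = "snd (G i)"
  let ?q = "osc ?u \<tau> (nbhd_seq F \<tau> k)"
  interpret P: prob_space ?P by (rule prob_space_profile_measure)
  have J: "finite ?J" by (rule finite_player_spaceD[OF L])
  define D where "D j a = ((\<Sum>l\<in>?J. measure L {l} * F j (a l)) - mean \<tau> (F j))\<^sup>2" for j a
  have D_int: "integrable ?P (D j)" for j
    unfolding D_def by (rule integral_square_deviation_le(2)[OF cpt L \<Lambda>])
  have U_int: "integrable ?P (realized_payoff L G i)"
    by (rule integrable_uniform_on_profiles[OF cpt J uniform_on_profiles_realized_payoff[OF cpt L i] realized_payoff_bound])
  note sec = integral_profile_measure_component[OF cpt J continuous_on_payoff_section i]
  have q0: "0 \<le> ?q" by (rule osc_nonneg) simp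
  have pw: "\<bar>realized_payoff L G i a - payoff G i (a i) \<tau>\<bar> \<le> ?q + 2 * norm ?u * (\<Sum>j\<le>k. (real (Suc k))\<^sup>2 * D j a)" for a
  proof -
    let ?\<nu> = "finite_summary L (\<lambda>j. dirac (a j))"
    have Dnu: "D j a = (mean ?\<nu> (F j) - mean \<tau> (F j))\<^sup>2" for j
      by (simp add: D_def mean_finite_summary_dirac[OF L borel_measurable_bcontfun bcontfun_bound])
    have D0: "0 \<le> (real (Suc k))\<^sup>2 * D j a" for j by (simp add: D_def)
    show ?thesis
    proof (cases "?\<nu> \<in> nbhd_seq F \<tau> k")
      case True
      have "\<bar>realized_payoff L G i a - payoff G i (a i) \<tau>\<bar> \<le> ?q"
        unfolding realized_payoff_def by (rule osc_upper[OF True])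
      moreover have "0 \<le> 2 * norm ?u * (\<Sum>j\<le>k. (real (Suc k))\<^sup>2 * D j a)"
        by (intro mult_nonneg_nonneg sum_nonneg D0) auto
      ultimately show ?thesis by linarith
    next
      case False
      then obtain j where j: "j \<le> k" "1 / real (Suc k) \<le> \<bar>mean ?\<nu> (F j) - mean \<tau> (F j)\<bar>"
        by (auto simp: nbhd_seq_def not_less)
      then have "(1 / real (Suc k))\<^sup>2 \<le> D j a"
        unfolding Dnu using power_mono[OF j(2), of 2] by simp
      then have "(real (Suc k))\<^sup>2 * (1 / real (Suc k))\<^sup>2 \<le> (real (Suc k))\<^sup>2 * D j a" by (rule mult_left_mono) simp
      then have "1 \<le> (real (Suc k))\<^sup>2 * D j a" by (simp add: power_divide del: of_nat_Suc)
      also have "\<dots> \<le> (\<Sum>j\<le>k. (real (Suc k))\<^sup>2 * D j a)" using j(1) D0 by (intro member_le_sum) auto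
      finally have "2 * norm ?u * 1 \<le> 2 * norm ?u * (\<Sum>j\<le>k. (real (Suc k))\<^sup>2 * D j a)" by (intro mult_left_mono) auto
      moreover have "\<bar>realized_payoff L G i a - payoff G i (a i) \<tau>\<bar> \<le> 2 * norm ?u"
        unfolding realized_payoff_def by (rule osc_term_le)
      ultimately show ?thesis using q0 by linarith
    qed
  qed
  have "\<bar>(\<integral>a. realized_payoff L G i a \<partial>?P) - mean (h i) (\<lambda>a. payoff G i a \<tau>)\<bar>
      = \<bar>\<integral>a. realized_payoff L G i a - payoff G i (a i) \<tau> \<partial>?P\<bar>"
    unfolding sec(1)[symmetric] by (simp add: Bochner_Integration.integral_diff[OF U_int sec(2)])
  also have "\<dots> \<le> (\<integral>a. \<bar>realized_payoff L G i a - payoff G i (a i) \<tau>\<bar> \<partial>?P)" by (rule integral_abs_bound)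
  also have "\<dots> \<le> (\<integral>a. ?q + 2 * norm ?u * (\<Sum>j\<le>k. (real (Suc k))\<^sup>2 * D j a) \<partial>?P)"
    by (intro integral_mono pw integrable_abs Bochner_Integration.integrable_diff U_int sec(2)
        Bochner_Integration.integrable_add P.integrable_const integrable_mult_right
        Bochner_Integration.integrable_sum D_int)
  also have "\<dots> = ?q + 2 * norm ?u * (\<Sum>j\<le>k. (real (Suc k))\<^sup>2 * (\<integral>a. D j a \<partial>?P))"
    using D_int by (simp add: P.prob_space del: of_nat_Suc)
  also have "\<dots> \<le> ?q + 2 * norm ?u * (\<Sum>j\<le>k. (real (Suc k))\<^sup>2 *
        ((norm (F j))\<^sup>2 * \<Lambda> + ((\<Sum>l\<in>space L. measure L {l} * mean (h l) (F j)) - mean \<tau> (F j))\<^sup>2))"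
    unfolding D_def
    by (intro add_left_mono mult_left_mono sum_mono integral_square_deviation_le(1)[OF cpt L \<Lambda>]) auto
  finally show ?thesis .
qed

section \<open>Best replies to a fixed summary and the penalty for missing them\<close>

definition best :: "'a::metric_space compacts \<times> 'a payoff \<Rightarrow> 'a prob_measure \<Rightarrow> real" where
  "best x \<tau> = (SUP b\<in>set_of_compacts (fst x). snd x (b, \<tau>))"

lemma best_upper: "b \<in> set_of_compacts (fst x) \<Longrightarrow> snd x (b, \<tau>) \<le> best x \<tau>"
  for x :: "'a::metric_space compacts \<times> 'a payoff"
  unfolding best_def
  by (intro cSUP_upper bdd_aboveI2[where M="norm (snd x)"]) (use bcontfun_bound abs_le_D1 in blast)+

lemma best_attained: "\<exists>b\<in>set_of_compacts (fst x). snd x (b, \<tau>) = best x \<tau>"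
  for x :: "'a::metric_space compacts \<times> 'a payoff"
proof -
  obtain b where b: "b \<in> set_of_compacts (fst x)" "\<forall>c\<in>set_of_compacts (fst x). snd x (c, \<tau>) \<le> snd x (b, \<tau>)"
    using continuous_attains_sup[OF compact_set_of_compacts set_of_compacts_nonempty continuous_on_payoff_section] by blast
  then have "best x \<tau> \<le> snd x (b, \<tau>)" unfolding best_def by (intro cSUP_least) auto
  with best_upper[OF b(1), of \<tau>] b(1) show ?thesis by (intro bexI[of _ b]) auto
qed

text \<open>The penalty of \<open>a\<close> vanishes iff \<open>a\<close> is a feasible best reply to the action distribution \<open>\<tau>\<close>.\<close>

definition penalty :: "'a::metric_space prob_measure \<Rightarrow> 'a compacts \<times> 'a payoff \<Rightarrow> 'a \<Rightarrow> real" where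
  "penalty \<tau> x a = min 1 (max 0 (best x \<tau> - snd x (a, \<tau>)) + infdist a (set_of_compacts (fst x)))"

lemma penalty_bounds: "0 \<le> penalty \<tau> x a" "penalty \<tau> x a \<le> 1"
  by (auto simp: penalty_def infdist_nonneg)

lemma continuous_on_penalty: "continuous_on S (penalty \<tau> x)"
  unfolding penalty_def by (intro continuous_intros continuous_on_payoff_section)

lemma penalty_in_bcontfun: "penalty \<tau> x \<in> bcontfun"
  by (rule bcontfun_normI[OF continuous_on_penalty, of _ _ 1]) (simp add: penalty_bounds)

text \<open>Compare the equilibrium with the deviation to a best reply \<open>b\<close> against
  \<tau>. Both expected payoffs are within \<open>osc + 2 * norm u * D\<close> of the payoffs at
  \<tau>, and the equilibrium inequality lets these errors add up to the stated bound. The term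
  \<open>2 * norm (F j) * \<Lambda>\<close> in \<open>D\<close> accounts for the shift of the
  summary caused by one deviating player.\<close>

lemma finite_nash_penalty_le:
  fixes G :: "('j, 'a::metric_space) game" and F :: "nat \<Rightarrow> ('a \<Rightarrow>\<^sub>C real)"
  assumes cpt: "compact (UNIV :: 'a set)" and L: "finite_player_space n L" and i: "i \<in> space L"
    and \<Lambda>: "\<And>j. j \<in> space L \<Longrightarrow> measure L {j} \<le> \<Lambda>" and g: "finite_nash L G g"
    and D: "(\<Sum>j\<le>k. (real (Suc k))\<^sup>2 * ((norm (F j))\<^sup>2 * \<Lambda> +
        (\<bar>mean (finite_summary L g) (F j) - mean \<tau> (F j)\<bar> + 2 * norm (F j) * \<Lambda>)\<^sup>2)) \<le> D"
  shows "mean (g i) (penalty \<tau> (G i)) \<le> min 1 (2 * osc (snd (G i)) \<tau> (nbhd_seq F \<tau> k) + 4 * norm (snd (G i)) * D)"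
proof -
  let ?J = "space L" and ?u = "snd (G i)"
  let ?q = "osc ?u \<tau> (nbhd_seq F \<tau> k)"
  have J: "finite ?J" by (rule finite_player_spaceD[OF L])
  have prof: "finite_profile L G g" using g by (simp add: finite_nash_def)
  have \<Lambda>0: "0 \<le> \<Lambda>" using \<Lambda>[OF i] measure_nonneg[of L "{i}"] by linarith
  obtain b where b: "b \<in> actions G i" "payoff G i b \<tau> = best (G i) \<tau>" using best_attained by blast
  \<comment> \<open>Covers the deviation to \<open>dirac b\<close> and, with \<open>g i\<close> for
    \<mu>, the equilibrium itself.\<close>
  have near: "\<bar>(\<integral>a. realized_payoff L G i a \<partial>profile_measure ?J h) - mean (h i) (\<lambda>a. payoff G i a \<tau>)\<bar>
      \<le> ?q + 2 * norm ?u * D" if h: "h = g(i := \<mu>)" for h \<mu>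
  proof -
    have "(\<Sum>j\<le>k. (real (Suc k))\<^sup>2 * ((norm (F j))\<^sup>2 * \<Lambda> +
        ((\<Sum>l\<in>?J. measure L {l} * mean (h l) (F j)) - mean \<tau> (F j))\<^sup>2)) \<le> D"
    proof (rule order_trans[OF _ D], intro sum_mono mult_left_mono add_left_mono)
      fix j
      have s: "mean (finite_summary L g) (F j) = (\<Sum>l\<in>?J. measure L {l} * mean (g l) (F j))"
        by (rule mean_finite_summary[OF L borel_measurable_bcontfun bcontfun_bound])
      have "(\<Sum>l\<in>?J. measure L {l} * mean (h l) (F j)) - mean (finite_summary L g) (F j)
          = (\<Sum>l\<in>?J. measure L {l} * (mean (h l) (F j) - mean (g l) (F j)))"
        by (simp add: s right_diff_distrib sum_subtractf)
      also have "\<dots> = (\<Sum>l\<in>?J. if l = i then measure L {i} * (mean \<mu> (F j) - mean (g i) (F j)) else 0)"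
        by (rule sum.cong) (auto simp: h)
      also have "\<dots> = measure L {i} * (mean \<mu> (F j) - mean (g i) (F j))" using J i by simp
      finally have eq: "(\<Sum>l\<in>?J. measure L {l} * mean (h l) (F j)) - mean (finite_summary L g) (F j)
          = measure L {i} * (mean \<mu> (F j) - mean (g i) (F j))" .
      have "\<bar>mean \<mu> (F j) - mean (g i) (F j)\<bar> \<le> 2 * norm (F j)"
        using abs_mean_le[of "F j", OF bcontfun_bound, of \<mu>] abs_mean_le[of "F j", OF bcontfun_bound, of "g i"] by linarith
      then have "\<bar>measure L {i} * (mean \<mu> (F j) - mean (g i) (F j))\<bar> \<le> \<Lambda> * (2 * norm (F j))"
        unfolding abs_mult using \<Lambda>[OF i] \<Lambda>0 by (intro mult_mono) auto
      then have "\<bar>(\<Sum>l\<in>?J. measure L {l} * mean (h l) (F j)) - mean \<tau> (F j)\<bar>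
          \<le> \<bar>mean (finite_summary L g) (F j) - mean \<tau> (F j)\<bar> + 2 * norm (F j) * \<Lambda>"
        using eq by (simp add: mult.commute mult.left_commute)
      from power_mono[OF this abs_ge_zero, of 2]
      show "((\<Sum>l\<in>?J. measure L {l} * mean (h l) (F j)) - mean \<tau> (F j))\<^sup>2
          \<le> (\<bar>mean (finite_summary L g) (F j) - mean \<tau> (F j)\<bar> + 2 * norm (F j) * \<Lambda>)\<^sup>2" by simp
    qed auto
    then have "2 * norm ?u * (\<Sum>j\<le>k. (real (Suc k))\<^sup>2 * ((norm (F j))\<^sup>2 * \<Lambda> +
        ((\<Sum>l\<in>?J. measure L {l} * mean (h l) (F j)) - mean \<tau> (F j))\<^sup>2)) \<le> 2 * norm ?u * D"
      by (rule mult_left_mono) simp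
    with expected_payoff_deviation_le[OF cpt L i \<Lambda>, where G=G and h=h and \<tau>=\<tau> and F=F and k=k] show ?thesis by linarith
  qed
  have b_meas: "measure (as_measure (dirac b)) (actions G i) = 1"
    using b(1) by (simp add: measure_return borel_closed compact_imp_closed)
  then have prof': "finite_profile L G (g(i := dirac b))" using prof by (simp add: finite_profile_def)
  have "expected_payoff L G (g(i := dirac b)) i \<le> expected_payoff L G g i"
    using g i b_meas by (simp add: finite_nash_def prob_measures_on_def)
  then have nash: "(\<integral>a. realized_payoff L G i a \<partial>profile_measure ?J (g(i := dirac b)))
      \<le> (\<integral>a. realized_payoff L G i a \<partial>profile_measure ?J g)"
    by (simp add: expected_payoff_eq[OF cpt L i prof] expected_payoff_eq[OF cpt L i prof'])
  have "mean (dirac b) (\<lambda>a. payoff G i a \<tau>) = best (G i) \<tau>"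
    using b(2) by (subst mean_dirac[OF borel_measurable_continuous_onI[OF continuous_on_payoff_section]]) simp
  then have le: "best (G i) \<tau> - mean (g i) (\<lambda>a. payoff G i a \<tau>) \<le> 2 * ?q + 4 * norm ?u * D"
    using near[of "g(i := dirac b)" "dirac b"] near[of g "g i"] nash by simp
  have int: "integrable (as_measure (g i)) (\<lambda>a. payoff G i a \<tau>)"
    by (rule integrable_continuous[OF cpt continuous_on_payoff_section])
  have AE: "AE a in as_measure (g i). a \<in> actions G i"
    using prof i by (intro measure_eq_1_imp_AE) (auto simp: finite_profile_def compact_imp_closed)
  have "mean (g i) (penalty \<tau> (G i)) \<le> mean (g i) (\<lambda>a. best (G i) \<tau> - payoff G i a \<tau>)"
  proof (rule integral_mono_AE)
    show "integrable (as_measure (g i)) (penalty \<tau> (G i))"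
      by (rule integrable_continuous[OF cpt continuous_on_penalty])
    show "integrable (as_measure (g i)) (\<lambda>a. best (G i) \<tau> - payoff G i a \<tau>)"
      by (intro integrable_continuous[OF cpt] continuous_intros continuous_on_payoff_section)
    show "AE a in as_measure (g i). penalty \<tau> (G i) a \<le> best (G i) \<tau> - payoff G i a \<tau>"
      using AE by eventually_elim (use best_upper[of _ "G i" \<tau>] in \<open>simp add: penalty_def\<close>)
  qed
  also have "\<dots> = best (G i) \<tau> - mean (g i) (\<lambda>a. payoff G i a \<tau>)"
    by (subst Bochner_Integration.integral_diff[OF _ int])
      (simp_all add: finite_measure.integrable_const prob_space.finite_measure)
  also note le
  finally show ?thesis
    using abs_mean_le[of "penalty \<tau> (G i)" 1 "g i"] by (simp add: penalty_bounds)
qed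

lemma continuous_on_osc: "continuous_on UNIV (\<lambda>u. osc u \<tau> V)" if "V \<noteq> {}"
  unfolding continuous_on_iff
proof (intro ballI allI impI)
  fix u :: "'a::metric_space payoff" and e :: real assume "e > 0"
  show "\<exists>d>0. \<forall>v\<in>UNIV. dist v u < d \<longrightarrow> dist (osc v \<tau> V) (osc u \<tau> V) < e"
  proof (intro exI[of _ "e/2"] conjI ballI impI)
    fix v assume "dist v u < e/2"
    then show "dist (osc v \<tau> V) (osc u \<tau> V) < e"
      using osc_lipschitz[OF that, of u \<tau> v] osc_lipschitz[OF that, of v \<tau> u]
      by (simp add: dist_real_def dist_commute abs_less_iff)
  qed (use \<open>e > 0\<close> in simp)
qed

lemma law_tendsto_average:
  fixes X :: "'i \<Rightarrow> 'x::metric_space" and Ln :: "nat \<Rightarrow> 'j measure"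
  assumes L: "prob_space L" and X: "X \<in> borel_measurable L"
    and Ln: "\<And>n::nat. finite_player_space (N n) (Ln n)"
    and lim: "(\<lambda>n. law (Ln n) (Xn n)) \<longlonglongrightarrow> law L X"
    and f: "continuous_on UNIV f" "\<And>x. \<bar>f x :: real\<bar> \<le> B"
  shows "(\<lambda>n. \<Sum>i\<in>space (Ln n). measure (Ln n) {i} * f (Xn n i)) \<longlonglongrightarrow> (\<integral>i. f (X i) \<partial>L)"
proof -
  have "f \<in> bcontfun" using f by (intro bcontfun_normI[of _ B]) auto
  then have bf: "apply_bcontfun (Bcontfun f) = f" by (rule Bcontfun_inverse)
  have meas: "f \<in> borel_measurable borel" by (rule borel_measurable_continuous_onI[OF f(1)])
  have "mean (law (Ln n) (Xn n)) f = (\<Sum>i\<in>space (Ln n). measure (Ln n) {i} * f (Xn n i))" for n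
  proof -
    have Xn: "Xn n \<in> borel_measurable (Ln n)" by (rule finite_player_spaceD(6)[OF Ln])
    have "mean (law (Ln n) (Xn n)) f = (\<integral>i. f (Xn n i) \<partial>Ln n)"
      unfolding as_measure_law[OF finite_player_spaceD(1)[OF Ln] Xn] by (rule integral_distr[OF Xn meas])
    also have "\<dots> = (\<Sum>i\<in>space (Ln n). measure (Ln n) {i} * f (Xn n i))"
      by (rule finite_player_spaceD(7)[OF Ln])
    finally show ?thesis .
  qed
  moreover have "mean (law L X) f = (\<integral>i. f (X i) \<partial>L)"
    using meas X by (simp add: as_measure_law[OF L X] integral_distr)
  ultimately show ?thesis
    using lim[unfolded tendsto_prob_measure_iff, THEN spec, of "Bcontfun f"] by (simp add: bf)
qed

text \<open>The limits are taken in order: for fixed \<open>k\<close> the average penalty is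
  eventually below an average of \<open>Q k\<close>, which converges with the laws as
  \<open>n\<close> grows; only then does \<open>k\<close> grow and dominated convergence on the
  large game finish.\<close>

theorem average_penalty_tendsto_0:
  fixes G :: "('i, 'a::metric_space) game" and Ln :: "nat \<Rightarrow> 'j measure" and Gn :: "nat \<Rightarrow> ('j, 'a) game"
  assumes cpt: "compact (UNIV :: 'a set)" and L: "prob_space L" and G: "G \<in> borel_measurable L"
    and Ln: "\<And>n. finite_player_space (N n) (Ln n)"
    and small: "(\<lambda>n. SUP i\<in>space (Ln n). measure (Ln n) {i}) \<longlonglongrightarrow> 0"
    and lim: "(\<lambda>n. law (Ln n) (Gn n)) \<longlonglongrightarrow> law L G"
    and nash: "\<And>n. finite_nash (Ln n) (Gn n) (g n)"
    and \<tau>: "(\<lambda>n. finite_summary (Ln n) (g n)) \<longlonglongrightarrow> \<tau>"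
  shows "(\<lambda>n. \<Sum>i\<in>space (Ln n). measure (Ln n) {i} * mean (g n i) (penalty \<tau> (Gn n i))) \<longlonglongrightarrow> 0"
proof -
  obtain F :: "nat \<Rightarrow> ('a \<Rightarrow>\<^sub>C real)" where F: "dense_seq F" using ex_dense_seq[OF cpt] by blast
  define \<Lambda> where "\<Lambda> n = (SUP i\<in>space (Ln n). measure (Ln n) {i})" for n
  have \<Lambda>: "measure (Ln n) {i} \<le> \<Lambda> n" if "i \<in> space (Ln n)" for n i
    unfolding \<Lambda>_def using that finite_player_spaceD(2)[OF Ln] by (intro cSUP_upper) auto
  \<comment> \<open>The bound of \<open>finite_nash_penalty_le\<close> with 1/(k+1) for
    \<open>D\<close>, hence free of \<open>n\<close>. Being continuous in the characteristic and at
    most 1, it is an admissible test function although payoff norms are unbounded.\<close>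
  define Q where "Q k x = min 1 (2 * osc (snd x) \<tau> (nbhd_seq F \<tau> k) + 4 * norm (snd x) * (1 / real (Suc k)))"
    for k and x :: "'a compacts \<times> 'a payoff"
  have ne: "nbhd_seq F \<tau> k \<noteq> {}" for k using nbhd_seq_self by blast
  have osc0: "0 \<le> osc u \<tau> (nbhd_seq F \<tau> k)" for u k by (rule osc_nonneg) simp
  have Q01: "0 \<le> Q k x" "Q k x \<le> 1" for k x using osc0[of "snd x" k] by (simp_all add: Q_def)
  have Q_cont: "continuous_on UNIV (Q k)" for k
    unfolding Q_def
    by (intro continuous_intros continuous_on_compose2[OF continuous_on_osc[OF ne]]) auto
  define w where "w n = (\<Sum>i\<in>space (Ln n). measure (Ln n) {i} * mean (g n i) (penalty \<tau> (Gn n i)))" for n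
  have w0: "0 \<le> w n" for n
    unfolding w_def by (intro sum_nonneg mult_nonneg_nonneg Bochner_Integration.integral_nonneg) (auto simp: penalty_bounds)
  have ev: "\<forall>\<^sub>F n in sequentially. w n \<le> (\<Sum>i\<in>space (Ln n). measure (Ln n) {i} * Q k (Gn n i))" for k
  proof -
    define D where "D n = (\<Sum>j\<le>k. (real (Suc k))\<^sup>2 * ((norm (F j))\<^sup>2 * \<Lambda> n +
        (\<bar>mean (finite_summary (Ln n) (g n)) (F j) - mean \<tau> (F j)\<bar> + 2 * norm (F j) * \<Lambda> n)\<^sup>2))" for n
    have \<Lambda>0: "\<Lambda> \<longlonglongrightarrow> 0" using small by (simp add: \<Lambda>_def[abs_def])
    have s0: "(\<lambda>n. \<bar>mean (finite_summary (Ln n) (g n)) (F j) - mean \<tau> (F j)\<bar>) \<longlonglongrightarrow> 0" for j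
      using tendsto_rabs[OF LIM_zero[OF \<tau>[unfolded tendsto_prob_measure_iff, THEN spec, of "F j"]]] by simp
    have "D \<longlonglongrightarrow> (\<Sum>j\<le>k. (real (Suc k))\<^sup>2 * ((norm (F j))\<^sup>2 * 0 + (0 + 2 * norm (F j) * 0)\<^sup>2))"
      unfolding D_def
      by (intro tendsto_sum tendsto_mult tendsto_add tendsto_power tendsto_const s0 \<Lambda>0)
    then have "D \<longlonglongrightarrow> 0" by simp
    then have "\<forall>\<^sub>F n in sequentially. D n < 1 / real (Suc k)" by (rule order_tendstoD) simp
    then show ?thesis
    proof eventually_elim
      case (elim n)
      show ?case unfolding w_def
      proof (intro sum_mono mult_left_mono)
        fix i assume i: "i \<in> space (Ln n)"
        show "mean (g n i) (penalty \<tau> (Gn n i)) \<le> Q k (Gn n i)"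
          unfolding Q_def
          by (rule finite_nash_penalty_le[OF cpt Ln i \<Lambda> nash]) (use elim in \<open>simp_all only: D_def less_imp_le\<close>)
      qed auto
    qed
  qed
  have Q_meas: "(\<lambda>i. Q k (G i)) \<in> borel_measurable L" for k
    by (rule measurable_compose[OF G borel_measurable_continuous_onI[OF Q_cont]])
  have "(\<lambda>k. \<integral>i. Q k (G i) \<partial>L) \<longlonglongrightarrow> (\<integral>i. 0 \<partial>L)"
  proof (rule integral_dominated_convergence[where w="\<lambda>_. 1"])
    show "integrable L (\<lambda>_. 1 :: real)" using L by (simp add: finite_measure.integrable_const prob_space.finite_measure)
    show "AE i in L. (\<lambda>k. Q k (G i)) \<longlonglongrightarrow> 0"
    proof (rule AE_I2)
      fix i
      have "(\<lambda>k. Q k (G i)) \<longlonglongrightarrow> min 1 (2 * 0 + 4 * norm (snd (G i)) * 0)"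
        unfolding Q_def
        by (intro tendsto_min tendsto_add tendsto_mult tendsto_const osc_nbhd_seq_tendsto_0[OF cpt F])
          (use LIMSEQ_inverse_real_of_nat in \<open>simp add: inverse_eq_divide\<close>)
      then show "(\<lambda>k. Q k (G i)) \<longlonglongrightarrow> 0" by simp
    qed
  qed (use Q_meas Q01 in auto)
  then have Q_lim: "(\<lambda>k. \<integral>i. Q k (G i) \<partial>L) \<longlonglongrightarrow> 0" by simp
  have "w \<longlonglongrightarrow> 0"
  proof (rule tendstoI)
    fix e :: real assume "e > 0"
    then have "\<forall>\<^sub>F k in sequentially. (\<integral>i. Q k (G i) \<partial>L) < e" using Q_lim by (intro order_tendstoD)
    then obtain k where k: "(\<integral>i. Q k (G i) \<partial>L) < e" by (auto simp: eventually_sequentially)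
    have "(\<lambda>n. \<Sum>i\<in>space (Ln n). measure (Ln n) {i} * Q k (Gn n i)) \<longlonglongrightarrow> (\<integral>i. Q k (G i) \<partial>L)"
      by (rule law_tendsto_average[OF L G Ln lim Q_cont, of _ 1]) (use Q01 in simp)
    then have "\<forall>\<^sub>F n in sequentially. (\<Sum>i\<in>space (Ln n). measure (Ln n) {i} * Q k (Gn n i)) < e"
      using k by (rule order_tendstoD)
    with ev[of k] show "\<forall>\<^sub>F n in sequentially. dist (w n) 0 < e"
      by eventually_elim (use w0 in \<open>simp add: dist_real_def\<close>)
  qed
  then show ?thesis by (simp add: w_def[abs_def])
qed

section \<open>Transfer of profiles from finite games to the large game\<close>

lemma infdist_compacts_attained: "\<exists>p\<in>set_of_compacts K. infdist a (set_of_compacts K) = dist a p"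
proof -
  have "continuous_on (set_of_compacts K) (\<lambda>p. dist a p)" by (intro continuous_intros)
  then obtain p where p: "p \<in> set_of_compacts K" "\<forall>q\<in>set_of_compacts K. dist a p \<le> dist a q"
    using continuous_attains_inf[of "set_of_compacts K" "\<lambda>p. dist a p"] by auto
  have "dist a p \<le> infdist a (set_of_compacts K)"
    unfolding infdist_notempty[OF set_of_compacts_nonempty] using p by (intro cINF_greatest) auto
  with infdist_le[OF p(1), of a] p(1) show ?thesis by (intro bexI[of _ p]) auto
qed

lemma abs_infdist_diff_le_dist_compacts:
  "\<bar>infdist a (set_of_compacts K) - infdist a (set_of_compacts K')\<bar> \<le> dist K K'"
proof -
  have le: "infdist a (set_of_compacts K') \<le> infdist a (set_of_compacts K) + dist K K'" for K K'
  proof -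
    obtain p where p: "p \<in> set_of_compacts K" "infdist a (set_of_compacts K) = dist a p"
      using infdist_compacts_attained by blast
    have "infdist a (set_of_compacts K') \<le> infdist p (set_of_compacts K') + dist a p" by (rule infdist_triangle)
    with infdist_le_dist_compacts[OF p(1), of K'] p(2) show ?thesis by linarith
  qed
  from le[of K K'] le[of K' K] show ?thesis by (simp add: dist_commute abs_le_iff)
qed

text \<open>A quantitative maximum theorem: a maximizer over one action set has a point of the other
  within \<open>d\<close>, which changes the payoff \<open>u\<close> by less than \<open>e\<close>;
  exchanging the payoff functions costs their distance.\<close>

lemma best_le:
  fixes u v :: "'a::metric_space payoff"
  assumes mod: "\<And>a b. dist a b < d \<Longrightarrow> \<bar>u (a, \<tau>) - u (b, \<tau>)\<bar> < e" and K: "dist K K' < d"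
  shows "best (K, u) \<tau> \<le> best (K', v) \<tau> + e + dist u v"
    and "best (K', v) \<tau> \<le> best (K, u) \<tau> + e + dist u v"
proof -
  have step: "\<exists>c\<in>set_of_compacts Q. dist b c < d" if "b \<in> set_of_compacts P" "dist P Q < d" for b and P Q :: "'a compacts"
  proof -
    obtain c where "c \<in> set_of_compacts Q" "infdist b (set_of_compacts Q) = dist b c"
      using infdist_compacts_attained by blast
    with infdist_le_dist_compacts[OF that(1), of Q] that(2) show ?thesis by (intro bexI[of _ c]) auto
  qed
  have uv: "\<bar>u x - v x\<bar> \<le> dist u v" for x using dist_bounded[of u x v] by (simp add: dist_real_def)
  show "best (K, u) \<tau> \<le> best (K', v) \<tau> + e + dist u v"
  proof -
    obtain b where b: "b \<in> set_of_compacts K" "u (b, \<tau>) = best (K, u) \<tau>"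
      using best_attained[of "(K, u)" \<tau>] by auto
    obtain c where c: "c \<in> set_of_compacts K'" "dist b c < d" using step[OF b(1) K] by blast
    from best_upper[of c "(K', v)" \<tau>] c(1) have "v (c, \<tau>) \<le> best (K', v) \<tau>" by simp
    with mod[OF c(2)] uv[of "(c, \<tau>)"] b(2) show ?thesis by linarith
  qed
  show "best (K', v) \<tau> \<le> best (K, u) \<tau> + e + dist u v"
  proof -
    obtain b where b: "b \<in> set_of_compacts K'" "v (b, \<tau>) = best (K', v) \<tau>"
      using best_attained[of "(K', v)" \<tau>] by auto
    obtain c where c: "c \<in> set_of_compacts K" "dist b c < d" using step[OF b(1), of K] K by (auto simp: dist_commute)
    from best_upper[of c "(K, u)" \<tau>] c(1) have "u (c, \<tau>) \<le> best (K, u) \<tau>" by simp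
    with mod[OF c(2)] uv[of "(b, \<tau>)"] b(2) show ?thesis by linarith
  qed
qed

text \<open>Continuity for the sup norm, not merely at each action. It lets a characteristic act
  through its penalty function alone, a point of the separable space of test functions, where
  partitions into small pieces are available.\<close>

lemma continuous_on_Bcontfun_penalty:
  assumes cpt: "compact (UNIV :: 'a::metric_space set)"
  shows "continuous_on UNIV (\<lambda>x :: 'a compacts \<times> 'a payoff. Bcontfun (penalty \<tau> x))"
  unfolding continuous_on_iff
proof (intro ballI allI impI)
  fix x :: "'a compacts \<times> 'a payoff" and e :: real assume e: "e > 0"
  obtain K u where x: "x = (K, u)" by (cases x)
  obtain d where d: "d > 0" "\<And>a b. dist a b < d \<Longrightarrow> \<bar>u (a, \<tau>) - u (b, \<tau>)\<bar> < e/8"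
    by (rule compact_UNIV_uniformly_continuous[OF cpt continuous_on_payoff_section[of UNIV u \<tau>], of "e/8"]) (use e in auto)
  show "\<exists>d>0. \<forall>y\<in>UNIV. dist y x < d \<longrightarrow> dist (Bcontfun (penalty \<tau> y)) (Bcontfun (penalty \<tau> x)) < e"
  proof (intro exI[of _ "min d (e/8)"] conjI ballI impI)
    fix y assume dy: "dist y x < min d (e/8)"
    obtain K' v where y: "y = (K', v)" by (cases y)
    have dK: "dist K K' < d" "dist K K' < e/8" and du: "dist u v < e/8"
      using dist_fst_le[of y x] dist_snd_le[of y x] dy by (auto simp: x y dist_commute)
    have "\<bar>best y \<tau> - best x \<tau>\<bar> \<le> e/8 + dist u v"
      using best_le[where e="e/8", OF d(2) dK(1), of v] by (simp add: x y abs_le_iff)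
    moreover have "\<bar>u (a, \<tau>) - v (a, \<tau>)\<bar> \<le> dist u v" for a
      using dist_bounded[of u "(a, \<tau>)" v] by (simp add: dist_real_def)
    moreover have "\<bar>infdist a (set_of_compacts K) - infdist a (set_of_compacts K')\<bar> \<le> dist K K'" for a
      by (rule abs_infdist_diff_le_dist_compacts)
    ultimately have "\<bar>penalty \<tau> y a - penalty \<tau> x a\<bar> \<le> e/2" for a
    proof -
      assume 1: "\<bar>best y \<tau> - best x \<tau>\<bar> \<le> e/8 + dist u v"
        and 2: "\<And>a. \<bar>u (a, \<tau>) - v (a, \<tau>)\<bar> \<le> dist u v"
        and 3: "\<And>a. \<bar>infdist a (set_of_compacts K) - infdist a (set_of_compacts K')\<bar> \<le> dist K K'"
      define p where "p = best y \<tau> - v (a, \<tau>)"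
      define q where "q = best x \<tau> - u (a, \<tau>)"
      define s where "s = infdist a (set_of_compacts K')"
      define t where "t = infdist a (set_of_compacts K)"
      \<comment> \<open>One \<open>e/8\<close> comes from the modulus of \<open>u\<close> in the
        comparison of best values; the distance of the payoffs enters twice, once there and once at
        the action \<open>a\<close>.\<close>
      have "\<bar>p - q\<bar> \<le> 3 * (e/8)" using 1 2[of a] du unfolding p_def q_def by linarith
      moreover have "\<bar>s - t\<bar> \<le> e/8" using 3[of a] dK(2) unfolding s_def t_def by linarith
      ultimately have "\<bar>min 1 (max 0 p + s) - min 1 (max 0 q + t)\<bar> \<le> e/2" by linarith
      then show ?thesis by (simp add: penalty_def p_def q_def s_def t_def x y)
    qed
    then have "dist (Bcontfun (penalty \<tau> y)) (Bcontfun (penalty \<tau> x)) \<le> e/2"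
      by (intro dist_bound) (simp add: Bcontfun_inverse[OF penalty_in_bcontfun] dist_real_def)
    with e show "dist (Bcontfun (penalty \<tau> y)) (Bcontfun (penalty \<tau> x)) < e" by simp
  qed (use d(1) e in simp)
qed

section \<open>Partitioning characteristics by their penalty functions\<close>

lemma stick_breaking_sum:
  fixes b :: "nat \<Rightarrow> real"
  shows "(\<Sum>c<N. b c * (\<Prod>l<c. 1 - b l)) = 1 - (\<Prod>l<N. 1 - b l)"
  by (induction N) (simp_all add: algebra_simps)

lemma abs_mean_diff_le_dist:
  "\<bar>mean \<mu> (apply_bcontfun f) - mean \<mu> (apply_bcontfun g)\<bar> \<le> dist f g"
  by (rule abs_mean_diff_le[OF integrable_bcontfun integrable_bcontfun])
    (use dist_bounded[of f _ g] in \<open>simp add: dist_real_def\<close>)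

lemma mean_le_mean_add_dist: "mean \<mu> (apply_bcontfun f) \<le> mean \<mu> (apply_bcontfun g) + dist f g"
  using abs_mean_diff_le_dist[of \<mu> f g] by linarith

text \<open>The space of test functions is not compact, so finitely many small pieces cannot cover
  it. Breaking a stick along the dense sequence puts all that is left after \<open>N\<close> pieces
  into the piece \<open>N\<close>; this remainder tends to 0 pointwise, hence in mean over the
  players.\<close>

lemma ex_small_partition:
  fixes w :: "'i \<Rightarrow> ('a::metric_space \<Rightarrow>\<^sub>C real)"
  assumes F: "dense_seq F" and L: "prob_space L" and w: "w \<in> borel_measurable L" and d: "d > 0"
  obtains N and \<psi> :: "nat \<Rightarrow> ('a \<Rightarrow>\<^sub>C real) \<Rightarrow> real"
  where "\<And>c. continuous_on UNIV (\<psi> c)" "\<And>c v. 0 \<le> \<psi> c v" "\<And>c v. \<psi> c v \<le> 1"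
    "\<And>v. (\<Sum>c\<le>N. \<psi> c v) = 1" "\<And>c v. c < N \<Longrightarrow> 0 < \<psi> c v \<Longrightarrow> dist v (F c) < d"
    "(\<integral>i. \<psi> N (w i) \<partial>L) < d"
proof -
  \<comment> \<open>Equal to 1 within d/2 of \<open>F c\<close> and to 0 beyond \<open>d\<close>:
    the first property makes the remainder vanish, the second keeps the pieces small.\<close>
  define b where "b c v = max 0 (min 1 (2 - 2 * dist v (F c) / d))" for c v
  define rest where "rest N v = (\<Prod>l<N. 1 - b l v)" for N v
  have b01: "0 \<le> b c v" "b c v \<le> 1" for c v by (simp_all add: b_def)
  have b_cont: "continuous_on UNIV (b c)" for c unfolding b_def by (intro continuous_intros) (use d in auto)
  have rest01: "0 \<le> rest N v" "rest N v \<le> 1" for N v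
    unfolding rest_def by (auto intro!: prod_nonneg prod_le_1 simp: b01)
  have rest_cont: "continuous_on UNIV (rest N)" for N
    unfolding rest_def by (intro continuous_intros b_cont)
  have rest_0: "(\<lambda>N. rest N v) \<longlonglongrightarrow> 0" for v
  proof -
    obtain c where "dist (F c) v < d/2" using F d unfolding dense_seq_def by (meson half_gt_zero)
    then have "2 * dist v (F c) / d \<le> 1" using d by (simp add: dist_commute field_simps)
    then have "b c v = 1" by (simp add: b_def)
    then have "rest N v = 0" if "N > c" for N
      unfolding rest_def using that \<open>b c v = 1\<close> by (intro prod_zero) auto
    then have "\<forall>\<^sub>F N in sequentially. rest N v = 0"
      using eventually_gt_at_top[of c] by (rule eventually_mono[rotated])
    then show ?thesis by (simp add: tendsto_eventually)
  qed
  have "(\<lambda>N. \<integral>i. rest N (w i) \<partial>L) \<longlonglongrightarrow> (\<integral>i. 0 \<partial>L)"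
  proof (rule integral_dominated_convergence[where w="\<lambda>_. 1"])
    show "integrable L (\<lambda>_. 1 :: real)" using L by (simp add: finite_measure.integrable_const prob_space.finite_measure)
    show "(\<lambda>i. rest N (w i)) \<in> borel_measurable L" for N
      by (rule measurable_compose[OF w borel_measurable_continuous_onI[OF rest_cont]])
  qed (use rest_0 rest01 in auto)
  then have "\<forall>\<^sub>F N in sequentially. (\<integral>i. rest N (w i) \<partial>L) < d" using d by (intro order_tendstoD) auto
  then obtain N where N: "(\<integral>i. rest N (w i) \<partial>L) < d" by (auto simp: eventually_sequentially)
  define \<psi> where "\<psi> c v = (if c < N then b c v * rest c v else rest N v)" for c v
  show thesis
  proof (rule that[of \<psi> N])
    show "continuous_on UNIV (\<psi> c)" for c
      unfolding \<psi>_def by (cases "c < N") (simp_all add: continuous_on_mult b_cont rest_cont)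
    show "0 \<le> \<psi> c v" for c v by (simp add: \<psi>_def b01 rest01)
    show "\<psi> c v \<le> 1" for c v by (simp add: \<psi>_def b01 rest01 mult_le_one)
    show "(\<Sum>c\<le>N. \<psi> c v) = 1" for v
    proof -
      have "(\<Sum>c\<le>N. \<psi> c v) = (\<Sum>c<N. b c v * rest c v) + rest N v"
        by (simp add: \<psi>_def flip: lessThan_Suc_atMost)
      then show ?thesis using stick_breaking_sum[of "\<lambda>c. b c v" N] by (simp add: rest_def)
    qed
    show "dist v (F c) < d" if "c < N" "0 < \<psi> c v" for c v
    proof (rule ccontr)
      assume "\<not> dist v (F c) < d"
      then have "2 * dist v (F c) / d \<ge> 2" using d by (simp add: field_simps)
      then have "b c v = 0" by (simp add: b_def)
      with that show False by (simp add: \<psi>_def)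
    qed
    show "(\<integral>i. \<psi> N (w i) \<partial>L) < d" using N by (simp add: \<psi>_def)
  qed
qed

text \<open>For each piece \<open>c\<close>, \<open>\<mu> c\<close> averages the strategies of the
  players of game \<open>n\<close> over that piece, and a player of the large game mixes the
  \<open>\<mu> c\<close> with the weights of her own characteristic. Masses of pieces nearly agree
  in the two games. On a small piece all penalty functions are nearly \<open>F c\<close>, so the
  mean penalty nearly agrees too; the remaining piece has small mass.\<close>

lemma transfer_profile:
  fixes X :: "'i \<Rightarrow> 'x::metric_space" and Ln :: "nat \<Rightarrow> 'j measure"
    and W :: "'x \<Rightarrow> ('a::metric_space \<Rightarrow>\<^sub>C real)"
  assumes cpt: "compact (UNIV :: 'a set)" and F: "dense_seq F"
    and L: "prob_space L" and X: "X \<in> borel_measurable L"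
    and Ln: "\<And>n. finite_player_space (N n) (Ln n)"
    and lim: "(\<lambda>n. law (Ln n) (Xn n)) \<longlonglongrightarrow> law L X"
    and W: "continuous_on UNIV W" "\<And>x a. 0 \<le> W x a" "\<And>x a. W x a \<le> 1"
    and small: "(\<lambda>n. \<Sum>i\<in>space (Ln n). measure (Ln n) {i} * mean (g n i) (W (Xn n i))) \<longlonglongrightarrow> 0"
    and \<tau>: "(\<lambda>n. finite_summary (Ln n) (g n)) \<longlonglongrightarrow> \<tau>" and e: "e > 0"
  shows "\<exists>\<kappa>\<in>borel_measurable L. (\<integral>i. mean (\<kappa> i) (W (X i)) \<partial>L) \<le> e \<and>
    (\<forall>j<m. \<bar>(\<integral>i. mean (\<kappa> i) (F j) \<partial>L) - mean \<tau> (F j)\<bar> \<le> e)"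
proof -
  \<comment> \<open>The penalty estimate uses up five times \<open>d\<close>, the estimate of the
    tests two times.\<close>
  define d where "d = e/8"
  have d: "d > 0" using e by (simp add: d_def)
  interpret prob_space L by (rule L)
  have WX: "(\<lambda>i. W (X i)) \<in> borel_measurable L"
    by (rule measurable_compose[OF X borel_measurable_continuous_onI[OF W(1)]])
  obtain M \<psi> where \<psi>: "\<And>c. continuous_on UNIV (\<psi> c)" "\<And>c v. 0 \<le> \<psi> c v" "\<And>c v. \<psi> c v \<le> 1"
      "\<And>v. (\<Sum>c\<le>M. \<psi> c v) = 1" "\<And>c v. c < M \<Longrightarrow> 0 < \<psi> c v \<Longrightarrow> dist v (F c) < d"
      "(\<integral>i. \<psi> M (W (X i)) \<partial>L) < d"
    by (rule ex_small_partition[OF F L WX d]) (rule that)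
  define \<Psi> where "\<Psi> c x = \<psi> c (W x)" for c x
  have \<Psi>_cont: "continuous_on UNIV (\<Psi> c)" for c
    unfolding \<Psi>_def by (rule continuous_on_compose2[OF \<psi>(1) W(1)]) auto
  have \<Psi>0: "0 \<le> \<Psi> c x" and \<Psi>1: "\<Psi> c x \<le> 1" for c x by (simp_all add: \<Psi>_def \<psi>)
  have \<Psi>_sum: "(\<Sum>c\<le>M. \<Psi> c x) = 1" for x by (simp add: \<Psi>_def \<psi>)
  have \<Psi>_meas: "(\<lambda>i. \<Psi> c (X i)) \<in> borel_measurable L" for c
    by (rule measurable_compose[OF X borel_measurable_continuous_onI[OF \<Psi>_cont]])
  have \<Psi>_int: "integrable L (\<lambda>i. \<Psi> c (X i))" for c
    by (rule integrable_const_bound[of _ 1]) (use \<Psi>_meas \<Psi>0 \<Psi>1 in auto)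
  define p where "p c = (\<integral>i. \<Psi> c (X i) \<partial>L)" for c
  define pn where "pn n c = (\<Sum>i\<in>space (Ln n). measure (Ln n) {i} * \<Psi> c (Xn n i))" for n c
  have pn_lim: "(\<lambda>n. pn n c) \<longlonglongrightarrow> p c" for c
    unfolding pn_def p_def by (rule law_tendsto_average[OF L X Ln lim \<Psi>_cont, of _ 1]) (use \<Psi>0 \<Psi>1 in simp)
  define wn where "wn n = (\<Sum>i\<in>space (Ln n). measure (Ln n) {i} * mean (g n i) (W (Xn n i)))" for n
  have diff_lim: "(\<lambda>n. \<Sum>c\<le>M. \<bar>p c - pn n c\<bar> * B c) \<longlonglongrightarrow> 0" for B :: "nat \<Rightarrow> real"
  proof -
    have "(\<lambda>n. \<Sum>c\<le>M. \<bar>p c - pn n c\<bar> * B c) \<longlonglongrightarrow> (\<Sum>c\<le>M. \<bar>p c - p c\<bar> * B c)"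
      by (intro tendsto_sum tendsto_mult tendsto_rabs tendsto_diff tendsto_const pn_lim)
    then show ?thesis by simp
  qed
  have ev1: "\<forall>\<^sub>F n in sequentially. wn n < d"
    using small d unfolding wn_def by (intro order_tendstoD) auto
  have ev2: "\<forall>\<^sub>F n in sequentially. (\<Sum>c\<le>M. \<bar>p c - pn n c\<bar> * norm (F c)) < d"
    using diff_lim d by (rule order_tendstoD)
  have ev3: "\<forall>\<^sub>F n in sequentially. \<forall>j\<in>{..<m}. (\<Sum>c\<le>M. \<bar>p c - pn n c\<bar> * norm (F j)) < d"
    by (rule eventually_ball_finite) (use order_tendstoD(2)[OF diff_lim d] in auto)
  have ev4: "\<forall>\<^sub>F n in sequentially. \<forall>j\<in>{..<m}. \<bar>mean (finite_summary (Ln n) (g n)) (F j) - mean \<tau> (F j)\<bar> < d"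
  proof (rule eventually_ball_finite)
    show "\<forall>j\<in>{..<m}. \<forall>\<^sub>F n in sequentially. \<bar>mean (finite_summary (Ln n) (g n)) (F j) - mean \<tau> (F j)\<bar> < d"
    proof
      fix j
      have "(\<lambda>n. mean (finite_summary (Ln n) (g n)) (F j)) \<longlonglongrightarrow> mean \<tau> (F j)"
        using \<tau> unfolding tendsto_prob_measure_iff ..
      from tendstoD[OF this d] show "\<forall>\<^sub>F n in sequentially. \<bar>mean (finite_summary (Ln n) (g n)) (F j) - mean \<tau> (F j)\<bar> < d"
        by (simp add: dist_real_def)
    qed
  qed simp
  from eventually_happens[OF eventually_conj[OF eventually_conj[OF ev1 ev2] eventually_conj[OF ev3 ev4]]]
  obtain n where n1: "wn n < d" and n2: "(\<Sum>c\<le>M. \<bar>p c - pn n c\<bar> * norm (F c)) < d"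
    and n3: "\<And>j. j < m \<Longrightarrow> (\<Sum>c\<le>M. \<bar>p c - pn n c\<bar> * norm (F j)) < d"
    and n4: "\<And>j. j < m \<Longrightarrow> \<bar>mean (finite_summary (Ln n) (g n)) (F j) - mean \<tau> (F j)\<bar> < d"
    by auto
  let ?J = "space (Ln n)" and ?w = "\<lambda>i. measure (Ln n) {i}"
  note J = finite_player_spaceD[OF Ln[of n]]
  \<comment> \<open>On a piece without mass the players' own weights serve as a fallback, so that
    the weights always sum to 1. The identity \<open>\<mu>\<close> below is stated without division
    and holds there with both sides 0.\<close>
  define \<mu> where "\<mu> c = mix ?J (\<lambda>i. if pn n c = 0 then ?w i else ?w i * \<Psi> c (Xn n i) / pn n c) (g n)" for c
  have pn0: "0 \<le> pn n c" for c unfolding pn_def using \<Psi>0 by (intro sum_nonneg) auto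
  have \<mu>: "pn n c * mean (\<mu> c) f = (\<Sum>i\<in>?J. ?w i * \<Psi> c (Xn n i) * mean (g n i) f)" for c and f :: "'a \<Rightarrow>\<^sub>C real"
  proof (cases "pn n c = 0")
    case True
    then have "?w i * \<Psi> c (Xn n i) = 0" if "i \<in> ?J" for i
      unfolding pn_def using that J(2) \<Psi>0 by (subst (asm) sum_nonneg_eq_0_iff) auto
    then have "(\<Sum>i\<in>?J. ?w i * \<Psi> c (Xn n i) * mean (g n i) f) = 0"
      by (intro sum.neutral ballI) (simp only: mult_zero_left)
    then show ?thesis using True by simp
  next
    case False
    have "mean (\<mu> c) f = (\<Sum>i\<in>?J. ?w i * \<Psi> c (Xn n i) / pn n c * mean (g n i) f)"
      unfolding \<mu>_def if_not_P[OF False]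
    proof (rule mean_mix[OF J(2) _ _ borel_measurable_bcontfun bcontfun_bound])
      show "0 \<le> ?w i * \<Psi> c (Xn n i) / pn n c" for i using \<Psi>0 pn0 by simp
      show "(\<Sum>i\<in>?J. ?w i * \<Psi> c (Xn n i) / pn n c) = 1"
        using False by (simp add: pn_def flip: sum_divide_distrib)
    qed
    then show ?thesis using False by (simp add: sum_distrib_left)
  qed
  define \<kappa> where "\<kappa> i = mix {..M} (\<lambda>c. \<Psi> c (X i)) \<mu>" for i
  have \<kappa>: "mean (\<kappa> i) f = (\<Sum>c\<le>M. \<Psi> c (X i) * mean (\<mu> c) f)" for i and f :: "'a \<Rightarrow>\<^sub>C real"
    unfolding \<kappa>_def by (rule mean_mix[OF _ \<Psi>0 \<Psi>_sum borel_measurable_bcontfun bcontfun_bound]) simp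
  have \<kappa>_meas: "\<kappa> \<in> borel_measurable L"
    by (rule measurable_prob_measureI[OF F], unfold \<kappa>,
        intro borel_measurable_sum borel_measurable_times borel_measurable_const \<Psi>_meas)
  have Wb: "mean \<nu> (W x) \<le> 1" "0 \<le> mean \<nu> (W x)" for \<nu> x
    using abs_mean_le[of "W x" 1 \<nu>] W(2,3) by (auto simp: abs_le_iff intro!: Bochner_Integration.integral_nonneg)
  have near: "\<Psi> c x * mean \<nu> (W x) \<le> \<Psi> c x * (mean \<nu> (F c) + d)"
      "\<Psi> c x * mean \<nu> (F c) \<le> \<Psi> c x * (mean \<nu> (W x) + d)" if "c < M" for c x \<nu>
  proof -
    have *: "dist (W x) (F c) < d" if "0 < \<Psi> c x" using \<psi>(5)[OF \<open>c < M\<close>, of "W x"] that by (simp add: \<Psi>_def)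
    show "\<Psi> c x * mean \<nu> (W x) \<le> \<Psi> c x * (mean \<nu> (F c) + d)"
      using * mean_le_mean_add_dist[of \<nu> "W x" "F c"] \<Psi>0[of c x]
      by (cases "\<Psi> c x = 0") (auto intro!: mult_left_mono)
    show "\<Psi> c x * mean \<nu> (F c) \<le> \<Psi> c x * (mean \<nu> (W x) + d)"
      using * mean_le_mean_add_dist[of \<nu> "F c" "W x"] \<Psi>0[of c x]
      by (cases "\<Psi> c x = 0") (auto simp: dist_commute intro!: mult_left_mono)
  qed
  have sub1: "(\<Sum>c<M. \<Psi> c x) \<le> 1" for x
    using \<Psi>_sum[of x] \<Psi>0[of M x] by (simp add: lessThan_Suc_atMost[symmetric])
  \<comment> \<open>On pieces below \<open>M\<close> the exchange of the penalty function for
    \<open>F c\<close> costs \<open>d\<close>; the last piece costs at most its mass. Next the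
    masses \<open>p c\<close> give way to those of game \<open>n\<close>, and finally
    \<open>F c\<close> to the penalty functions of its players.\<close>
  have "(\<integral>i. mean (\<kappa> i) (W (X i)) \<partial>L) \<le> (\<integral>i. (\<Sum>c<M. \<Psi> c (X i) * mean (\<mu> c) (F c)) + d + \<Psi> M (X i) \<partial>L)"
  proof (rule integral_mono')
    show "integrable L (\<lambda>i. (\<Sum>c<M. \<Psi> c (X i) * mean (\<mu> c) (F c)) + d + \<Psi> M (X i))"
      using \<Psi>_int by simp
    fix i
    have "mean (\<kappa> i) (W (X i)) = (\<Sum>c<M. \<Psi> c (X i) * mean (\<mu> c) (W (X i))) + \<Psi> M (X i) * mean (\<mu> M) (W (X i))"
      unfolding \<kappa> by (simp flip: lessThan_Suc_atMost)
    also have "\<dots> \<le> (\<Sum>c<M. \<Psi> c (X i) * (mean (\<mu> c) (F c) + d)) + \<Psi> M (X i) * 1"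
    proof (rule add_mono)
      show "(\<Sum>c<M. \<Psi> c (X i) * mean (\<mu> c) (W (X i))) \<le> (\<Sum>c<M. \<Psi> c (X i) * (mean (\<mu> c) (F c) + d))"
        by (intro sum_mono near(1)) simp
      show "\<Psi> M (X i) * mean (\<mu> M) (W (X i)) \<le> \<Psi> M (X i) * 1"
        by (intro mult_left_mono Wb(1) \<Psi>0)
    qed
    also have "\<dots> = (\<Sum>c<M. \<Psi> c (X i) * mean (\<mu> c) (F c)) + (\<Sum>c<M. \<Psi> c (X i)) * d + \<Psi> M (X i)"
      by (simp add: distrib_left sum.distrib sum_distrib_right)
    also have "\<dots> \<le> (\<Sum>c<M. \<Psi> c (X i) * mean (\<mu> c) (F c)) + d + \<Psi> M (X i)"
      using mult_right_mono[OF sub1[of "X i"], of d] d by simp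
    finally show le: "mean (\<kappa> i) (W (X i)) \<le> (\<Sum>c<M. \<Psi> c (X i) * mean (\<mu> c) (F c)) + d + \<Psi> M (X i)" .
    show "0 \<le> (\<Sum>c<M. \<Psi> c (X i) * mean (\<mu> c) (F c)) + d + \<Psi> M (X i)"
      using order_trans[OF Wb(2) le] .
  qed
  also have "\<dots> = (\<Sum>c<M. p c * mean (\<mu> c) (F c)) + d + p M"
    using \<Psi>_int by (simp add: p_def prob_space)
  also have "\<dots> \<le> ((\<Sum>c<M. pn n c * mean (\<mu> c) (F c)) + d) + d + d"
  proof -
    have "(\<Sum>c<M. p c * mean (\<mu> c) (F c)) - (\<Sum>c<M. pn n c * mean (\<mu> c) (F c)) = (\<Sum>c<M. (p c - pn n c) * mean (\<mu> c) (F c))"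
      by (simp add: left_diff_distrib sum_subtractf)
    also have "\<dots> \<le> (\<Sum>c<M. \<bar>p c - pn n c\<bar> * norm (F c))"
    proof (rule sum_mono)
      fix c
      have "(p c - pn n c) * mean (\<mu> c) (F c) \<le> \<bar>p c - pn n c\<bar> * \<bar>mean (\<mu> c) (F c)\<bar>"
        using abs_ge_self[of "(p c - pn n c) * mean (\<mu> c) (F c)"] by (simp add: abs_mult)
      also have "\<dots> \<le> \<bar>p c - pn n c\<bar> * norm (F c)"
        using abs_mean_le[of "F c", OF bcontfun_bound, of "\<mu> c"] by (intro mult_left_mono) auto
      finally show "(p c - pn n c) * mean (\<mu> c) (F c) \<le> \<bar>p c - pn n c\<bar> * norm (F c)" .
    qed
    also have "\<dots> \<le> (\<Sum>c\<le>M. \<bar>p c - pn n c\<bar> * norm (F c))" by (intro sum_mono2) auto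
    finally have "(\<Sum>c<M. p c * mean (\<mu> c) (F c)) \<le> (\<Sum>c<M. pn n c * mean (\<mu> c) (F c)) + d" using n2 by linarith
    moreover have "p M \<le> d" using \<psi>(6) by (simp add: p_def \<Psi>_def)
    ultimately show ?thesis by linarith
  qed
  also have "(\<Sum>c<M. pn n c * mean (\<mu> c) (F c)) \<le> wn n + d"
  proof -
    have "(\<Sum>c<M. pn n c * mean (\<mu> c) (F c)) = (\<Sum>c<M. \<Sum>i\<in>?J. ?w i * (\<Psi> c (Xn n i) * mean (g n i) (F c)))"
      by (simp add: \<mu> mult.assoc)
    also have "\<dots> = (\<Sum>i\<in>?J. ?w i * (\<Sum>c<M. \<Psi> c (Xn n i) * mean (g n i) (F c)))"
      by (subst sum.swap) (simp add: sum_distrib_left)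
    also have "\<dots> \<le> (\<Sum>i\<in>?J. ?w i * (mean (g n i) (W (Xn n i)) + d))"
    proof (intro sum_mono mult_left_mono)
      fix i
      have "(\<Sum>c<M. \<Psi> c (Xn n i) * mean (g n i) (F c)) \<le> (\<Sum>c<M. \<Psi> c (Xn n i) * (mean (g n i) (W (Xn n i)) + d))"
        by (intro sum_mono near(2)) simp
      also have "\<dots> = (\<Sum>c<M. \<Psi> c (Xn n i)) * (mean (g n i) (W (Xn n i)) + d)" by (simp add: sum_distrib_right)
      also have "\<dots> \<le> mean (g n i) (W (Xn n i)) + d"
        using mult_right_mono[OF sub1[of "Xn n i"], of "mean (g n i) (W (Xn n i)) + d"] Wb(2)[of "g n i" "Xn n i"] d by simp
      finally show "(\<Sum>c<M. \<Psi> c (Xn n i) * mean (g n i) (F c)) \<le> mean (g n i) (W (Xn n i)) + d" .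
    qed simp
    also have "\<dots> = wn n + (\<Sum>i\<in>?J. ?w i) * d"
      by (simp add: wn_def distrib_left sum.distrib sum_distrib_right)
    finally show ?thesis using J(5) by simp
  qed
  finally have "(\<integral>i. mean (\<kappa> i) (W (X i)) \<partial>L) \<le> wn n + d + d + d + d" by simp
  then have part1: "(\<integral>i. mean (\<kappa> i) (W (X i)) \<partial>L) \<le> e" using n1 d_def e by linarith
  have part2: "\<bar>(\<integral>i. mean (\<kappa> i) (F j) \<partial>L) - mean \<tau> (F j)\<bar> \<le> e" if "j < m" for j
  proof -
    have "(\<integral>i. mean (\<kappa> i) (F j) \<partial>L) = (\<Sum>c\<le>M. p c * mean (\<mu> c) (F j))"
      unfolding \<kappa> using \<Psi>_int by (simp add: p_def)
    moreover have "mean (finite_summary (Ln n) (g n)) (F j) = (\<Sum>c\<le>M. pn n c * mean (\<mu> c) (F j))"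
    proof -
      have "(\<Sum>c\<le>M. pn n c * mean (\<mu> c) (F j)) = (\<Sum>i\<in>?J. \<Sum>c\<le>M. ?w i * \<Psi> c (Xn n i) * mean (g n i) (F j))"
        unfolding \<mu> by (rule sum.swap)
      also have "\<dots> = (\<Sum>i\<in>?J. ?w i * mean (g n i) (F j) * (\<Sum>c\<le>M. \<Psi> c (Xn n i)))"
        by (simp add: sum_distrib_left mult_ac)
      also have "\<dots> = mean (finite_summary (Ln n) (g n)) (F j)"
        by (simp add: \<Psi>_sum mean_finite_summary[OF Ln borel_measurable_bcontfun bcontfun_bound])
      finally show ?thesis ..
    qed
    ultimately have "\<bar>(\<integral>i. mean (\<kappa> i) (F j) \<partial>L) - mean (finite_summary (Ln n) (g n)) (F j)\<bar>
        = \<bar>\<Sum>c\<le>M. (p c - pn n c) * mean (\<mu> c) (F j)\<bar>"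
      by (simp add: left_diff_distrib sum_subtractf)
    also have "\<dots> \<le> (\<Sum>c\<le>M. \<bar>p c - pn n c\<bar> * norm (F j))"
    proof (intro order_trans[OF sum_abs] sum_mono)
      fix c
      show "\<bar>(p c - pn n c) * mean (\<mu> c) (F j)\<bar> \<le> \<bar>p c - pn n c\<bar> * norm (F j)"
        unfolding abs_mult using abs_mean_le[of "F j", OF bcontfun_bound, of "\<mu> c"] by (intro mult_left_mono) auto
    qed
    finally show ?thesis using n3[OF that] n4[OF that] d_def e by linarith
  qed
  show ?thesis using \<kappa>_meas part1 part2 by blast
qed

section \<open>Almost sure limits of randomized profiles\<close>

text \<open>Measure and integrand both vary with the player. Discretizing the measure on nets
  separates them into finite sums of products of measurable functions, whose limit is the
  mean.\<close>

lemma borel_measurable_mean_of_measurable_function: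
  fixes \<kappa> :: "'i \<Rightarrow> 'a::metric_space prob_measure" and w :: "'i \<Rightarrow> ('a \<Rightarrow>\<^sub>C real)"
  assumes cpt: "compact (UNIV :: 'a set)" and \<kappa>: "\<kappa> \<in> borel_measurable L"
    and w: "\<And>a. (\<lambda>i. w i a) \<in> borel_measurable L"
  shows "(\<lambda>i. mean (\<kappa> i) (w i)) \<in> borel_measurable L"
proof -
  have "\<forall>k. \<exists>C \<phi>. partition_of_unity (UNIV :: 'a set) (inverse (real (Suc k))) C \<phi>"
    by (intro allI ex_partition_of_unity[OF cpt]) simp
  then obtain C :: "nat \<Rightarrow> 'a set" and \<phi>
    where pou: "\<And>k. partition_of_unity UNIV (inverse (real (Suc k))) (C k) (\<phi> k)" by metis
  note C = partition_of_unityD[OF pou]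
  note approx = tendsto_partition_mix[OF cpt cpt measure_as_measure_UNIV pou]
  have mix: "mean (mix (C k) (\<lambda>c. mean (\<kappa> i) (\<phi> k c)) dirac) (w i) = (\<Sum>c\<in>C k. mean (\<kappa> i) (\<phi> k c) * w i c)" for k i
    by (subst mean_mix[OF C(1) approx(2,3) borel_measurable_bcontfun bcontfun_bound])
      (simp add: integral_return borel_measurable_bcontfun)
  have "(\<lambda>k. \<Sum>c\<in>C k. mean (\<kappa> i) (\<phi> k c) * w i c) \<longlonglongrightarrow> mean (\<kappa> i) (w i)" for i
    unfolding mix[symmetric] by (rule approx(1)[unfolded tendsto_prob_measure_iff, THEN spec])
  then show ?thesis
  proof (rule borel_measurable_LIMSEQ_real)
    show "(\<lambda>i. \<Sum>c\<in>C k. mean (\<kappa> i) (\<phi> k c) * w i c) \<in> borel_measurable L" for k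
      by (intro borel_measurable_sum borel_measurable_times w borel_measurable_mean[OF \<kappa>]
          borel_measurable_continuous_onI C(4))
  qed
qed

definition midpoint_measure :: "'a::metric_space prob_measure \<Rightarrow> 'a prob_measure \<Rightarrow> 'a prob_measure" where
  "midpoint_measure \<mu> \<nu> = mix UNIV (\<lambda>_ :: bool. 1/2) (\<lambda>b. if b then \<mu> else \<nu>)"

lemma mean_midpoint_measure:
  fixes f :: "'a::metric_space \<Rightarrow>\<^sub>C real"
  shows "mean (midpoint_measure \<mu> \<nu>) f = (mean \<mu> f + mean \<nu> f) / 2"
  unfolding midpoint_measure_def
  by (subst mean_mix[OF _ _ _ borel_measurable_bcontfun bcontfun_bound])
    (simp_all add: UNIV_bool add_divide_distrib)

text \<open>Minimizers of the strictly convex functional \<open>\<Phi>\<close> over decreasing convex sets of profiles form,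
  by the parallelogram law, a Cauchy sequence in the space \<open>L\<^sup>2\<close> over players and test functions.\<close>

lemma ex_AE_convergent_selection:
  fixes \<C> :: "nat \<Rightarrow> ('i \<Rightarrow> 'a::metric_space prob_measure) set"
  assumes cpt: "compact (UNIV :: 'a set)" and L: "prob_space L"
    and ne: "\<And>k. \<C> k \<noteq> {}" and meas: "\<And>k. \<C> k \<subseteq> borel_measurable L"
    and dec: "\<And>k l. k \<le> l \<Longrightarrow> \<C> l \<subseteq> \<C> k"
    and mid: "\<And>k \<kappa> \<kappa>'. \<kappa> \<in> \<C> k \<Longrightarrow> \<kappa>' \<in> \<C> k \<Longrightarrow> (\<lambda>i. midpoint_measure (\<kappa> i) (\<kappa>' i)) \<in> \<C> k"
  shows "\<exists>\<kappa>s r \<kappa>. (\<forall>k. \<kappa>s k \<in> \<C> k) \<and> strict_mono (r :: nat \<Rightarrow> nat) \<and> \<kappa> \<in> borel_measurable L \<and>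
    (AE i in L. (\<lambda>k. \<kappa>s (r k) i) \<longlonglongrightarrow> \<kappa> i)"
proof -
  obtain F :: "nat \<Rightarrow> ('a \<Rightarrow>\<^sub>C real)" where F: "dense_seq F" using ex_dense_seq[OF cpt] by blast
  \<comment> \<open>Chosen to charge every natural number, so that a property holding almost surely
    in \<open>E\<close> holds for every test function. Together with the normalization in
    \<open>s\<close> this turns countably many tests into one bounded function on a product
    probability space.\<close>
  define E where "E = measure_pmf (geometric_pmf (1/2))"
  interpret L: prob_space L by (rule L)
  interpret E: prob_space E unfolding E_def by (rule prob_space_measure_pmf)
  interpret LE: pair_prob_space L E ..
  let ?M = "L \<Otimes>\<^sub>M E"
  define s where "s \<kappa> = (\<lambda>(i, j). mean (\<kappa> i) (F j) / (1 + norm (F j)))" for \<kappa> :: "'i \<Rightarrow> 'a prob_measure"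
  have pos: "1 + norm (F j) > 0" for j by (simp add: add_pos_nonneg)
  have s1: "\<bar>s \<kappa> x\<bar> \<le> 1" for \<kappa> x
  proof (cases x)
    case (Pair i j)
    have "\<bar>mean (\<kappa> i) (F j)\<bar> \<le> 1 + norm (F j)"
      using abs_mean_le[of "F j", OF bcontfun_bound, of "\<kappa> i"] by simp
    then show ?thesis using pos[of j] by (simp add: s_def Pair abs_divide)
  qed
  have s_meas: "s \<kappa> \<in> borel_measurable ?M" if "\<kappa> \<in> borel_measurable L" for \<kappa>
  proof -
    have "(\<lambda>p. s \<kappa> (fst p, snd p)) \<in> borel_measurable (L \<Otimes>\<^sub>M count_space UNIV)"
    proof (rule measurable_compose_countable[where g=snd and f="\<lambda>j p. s \<kappa> (fst p, j)"])
      show "(\<lambda>p. s \<kappa> (fst p, j)) \<in> borel_measurable (L \<Otimes>\<^sub>M count_space UNIV)" for j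
        unfolding s_def prod.case
        by (intro borel_measurable_divide borel_measurable_const
            measurable_compose[OF measurable_fst borel_measurable_mean[OF that borel_measurable_bcontfun]])
    qed simp
    moreover have "sets ?M = sets (L \<Otimes>\<^sub>M count_space UNIV)"
      unfolding E_def by (intro sets_pair_measure_cong) auto
    ultimately show ?thesis by (simp cong: measurable_cong_sets)
  qed
  have int: "integrable ?M (\<lambda>x. s \<kappa> x * s \<kappa>' x)" "integrable ?M (s \<kappa>)"
    if "\<kappa> \<in> borel_measurable L" "\<kappa>' \<in> borel_measurable L" for \<kappa> \<kappa>'
  proof -
    have "\<bar>s \<kappa> x * s \<kappa>' x\<bar> \<le> 1" for x
      unfolding abs_mult by (intro mult_le_one s1) auto
    then show "integrable ?M (\<lambda>x. s \<kappa> x * s \<kappa>' x)"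
      by (intro LE.integrable_const_bound[where B=1]) (use s_meas that in auto)
    show "integrable ?M (s \<kappa>)"
      by (intro LE.integrable_const_bound[where B=1]) (use s_meas s1 that in auto)
  qed
  define \<Phi> where "\<Phi> \<kappa> = (\<integral>x. s \<kappa> x * s \<kappa> x \<partial>?M)" for \<kappa>
  have \<Phi>0: "0 \<le> \<Phi> \<kappa>" for \<kappa> unfolding \<Phi>_def by (intro Bochner_Integration.integral_nonneg) simp
  have \<Phi>1: "\<Phi> \<kappa> \<le> 1" for \<kappa>
  proof -
    have "\<Phi> \<kappa> \<le> (\<integral>x. 1 \<partial>?M)"
      unfolding \<Phi>_def
    proof (rule integral_mono')
      show "s \<kappa> x * s \<kappa> x \<le> 1" for x
        using mult_le_one[OF s1[of \<kappa> x] abs_ge_zero s1[of \<kappa> x]] by (simp flip: abs_mult)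
    qed auto
    then show ?thesis by (simp add: LE.prob_space)
  qed
  define v where "v k = Inf (\<Phi> ` \<C> k)" for k
  have bdd: "bdd_below (\<Phi> ` \<C> k)" for k using \<Phi>0 by (intro bdd_belowI2[where m=0])
  have v_le: "v k \<le> \<Phi> \<kappa>" if "\<kappa> \<in> \<C> k" for k \<kappa>
    unfolding v_def using that bdd by (intro cINF_lower)
  have v_mono: "v k \<le> v l" if "k \<le> l" for k l
    unfolding v_def by (rule cINF_superset_mono[OF ne bdd dec[OF that]]) simp
  have v1: "v k \<le> 1" for k using ne[of k] v_le[of _ k] \<Phi>1 by (meson ex_in_conv order_trans)
  obtain vl where vl: "v \<longlonglongrightarrow> vl" "\<And>k. v k \<le> vl"
    using incseq_convergent[of v 1] v_mono v1 by (auto simp: incseq_def)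
  have "\<exists>\<kappa>\<in>\<C> k. \<Phi> \<kappa> < v k + inverse (real (Suc k))" for k
  proof -
    have "Inf (\<Phi> ` \<C> k) < v k + inverse (real (Suc k))" by (simp add: v_def)
    then show ?thesis using cInf_lessD[of "\<Phi> ` \<C> k"] ne by blast
  qed
  then obtain \<kappa>s where \<kappa>s: "\<And>k. \<kappa>s k \<in> \<C> k" "\<And>k. \<Phi> (\<kappa>s k) < v k + inverse (real (Suc k))" by metis
  have \<kappa>s_meas: "\<kappa>s k \<in> borel_measurable L" for k using \<kappa>s(1) meas by blast
  define D where "D k l = (\<integral>x. (s (\<kappa>s k) x - s (\<kappa>s l) x)\<^sup>2 \<partial>?M)" for k l
  have D_int: "integrable ?M (\<lambda>x. (s (\<kappa>s k) x - s (\<kappa>s l) x)\<^sup>2)" for k l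
    using int(1)[OF \<kappa>s_meas[of k] \<kappa>s_meas[of k]] int(1)[OF \<kappa>s_meas[of l] \<kappa>s_meas[of l]] int(1)[OF \<kappa>s_meas[of k] \<kappa>s_meas[of l]]
    by (simp add: power2_diff power2_eq_square[of "s _ _"] mult.assoc)
  \<comment> \<open>By the parallelogram law the squared distance is \<open>2 * \<Phi>\<close> at
    both ends minus \<open>4 * \<Phi>\<close> at the midpoint. The midpoint stays in the larger set
    \<open>\<C> k\<close>, so its value is at least \<open>v k\<close>, while both ends are nearly
    minimal in their own sets.\<close>
  have D_le: "D k l \<le> 2 * (vl - v k) + 4 * inverse (real (Suc k))" if kl: "k \<le> l" for k l
  proof -
    let ?m = "\<lambda>i. midpoint_measure (\<kappa>s k i) (\<kappa>s l i)"
    have m: "?m \<in> \<C> k" using \<kappa>s(1)[of k] \<kappa>s(1)[of l] dec[OF kl] by (intro mid) auto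
    then have m_meas: "?m \<in> borel_measurable L" using meas by blast
    have s_mid: "s ?m x = (s (\<kappa>s k) x + s (\<kappa>s l) x) / 2" for x
      by (cases x) (simp add: s_def mean_midpoint_measure add_divide_distrib mult.commute)
    have "(s (\<kappa>s k) x - s (\<kappa>s l) x)\<^sup>2 = 2 * (s (\<kappa>s k) x * s (\<kappa>s k) x) + 2 * (s (\<kappa>s l) x * s (\<kappa>s l) x) - 4 * (s ?m x * s ?m x)" for x
      unfolding s_mid by (simp add: power2_eq_square algebra_simps)
    then have D_eq: "D k l = 2 * \<Phi> (\<kappa>s k) + 2 * \<Phi> (\<kappa>s l) - 4 * \<Phi> ?m"
      unfolding D_def \<Phi>_def using int(1)[OF \<kappa>s_meas \<kappa>s_meas] int(1)[OF m_meas m_meas] by simp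
    have inv: "inverse (real (Suc l)) \<le> inverse (real (Suc k))" using kl by (intro le_imp_inverse_le) auto
    have "D' \<le> 2 * (v' - a) + 4 * b"
      if "D' = 2 * p + 2 * q - 4 * m" "c \<le> b" "p < a + b" "q < a' + c" "a \<le> m" "a' \<le> v'"
      for D' p q m a b c a' v' :: real
      using that by argo
    from this[OF D_eq inv \<kappa>s(2) \<kappa>s(2) v_le[OF m] vl(2)] show ?thesis .
  qed
  have D_small: "\<exists>K. \<forall>k\<ge>K. \<forall>l\<ge>K. D k l < \<eta>" if "\<eta> > 0" for \<eta>
  proof -
    have "(\<lambda>k. 2 * (vl - v k) + 4 * inverse (real (Suc k))) \<longlonglongrightarrow> 2 * (vl - vl) + 4 * 0"
      by (intro tendsto_intros vl(1) LIMSEQ_inverse_real_of_nat)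
    then have "\<forall>\<^sub>F k in sequentially. 2 * (vl - v k) + 4 * inverse (real (Suc k)) < \<eta>"
      using that by (intro order_tendstoD) auto
    then obtain K where K: "\<And>k. k \<ge> K \<Longrightarrow> 2 * (vl - v k) + 4 * inverse (real (Suc k)) < \<eta>"
      by (auto simp: eventually_sequentially)
    have "D k l < \<eta>" if "k \<ge> K" "l \<ge> K" for k l
    proof (cases "k \<le> l")
      case True then show ?thesis using D_le[OF True] K[OF that(1)] by linarith
    next
      case False
      then have "D l k < \<eta>" using D_le[of l k] K[OF that(2)] by linarith
      then show ?thesis by (simp add: D_def power2_commute)
    qed
    then show ?thesis by blast
  qed
  \<comment> \<open>Almost sure convergence is extracted from the Cauchy property in mean, obtained
    from the squared distances through \<open>|y| \<le> y^2 / (2 * e) + e / 2\<close>.\<close>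
  have "\<exists>N. \<forall>k\<ge>N. \<forall>l\<ge>N. (\<integral>x. norm (s (\<kappa>s k) x - s (\<kappa>s l) x) \<partial>?M) < e" if e: "e > 0" for e
  proof -
    obtain K where K: "\<And>k l. k \<ge> K \<Longrightarrow> l \<ge> K \<Longrightarrow> D k l < e * e" using D_small[of "e * e"] e by auto
    have "(\<integral>x. norm (s (\<kappa>s k) x - s (\<kappa>s l) x) \<partial>?M) < e" if "k \<ge> K" "l \<ge> K" for k l
    proof -
      have "(\<integral>x. norm (s (\<kappa>s k) x - s (\<kappa>s l) x) \<partial>?M) \<le> (\<integral>x. (s (\<kappa>s k) x - s (\<kappa>s l) x)\<^sup>2 / (2 * e) + e/2 \<partial>?M)"
      proof (rule integral_mono')
        show "integrable ?M (\<lambda>x. (s (\<kappa>s k) x - s (\<kappa>s l) x)\<^sup>2 / (2 * e) + e/2)" using D_int by simp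
        fix x
        let ?y = "s (\<kappa>s k) x - s (\<kappa>s l) x"
        have "0 \<le> (\<bar>?y\<bar> - e)\<^sup>2" by simp
        also have "(\<bar>?y\<bar> - e)\<^sup>2 = ?y\<^sup>2 + e\<^sup>2 - 2 * \<bar>?y\<bar> * e" by (simp only: power2_diff power2_abs)
        finally have "\<bar>?y\<bar> * (2 * e) \<le> ?y\<^sup>2 + e\<^sup>2" by argo
        then have "\<bar>?y\<bar> \<le> (?y\<^sup>2 + e\<^sup>2) / (2 * e)" using e by (subst pos_le_divide_eq) simp_all
        also have "\<dots> = ?y\<^sup>2 / (2 * e) + e/2" using e by (simp add: add_divide_distrib power2_eq_square)
        finally show "norm ?y \<le> ?y\<^sup>2 / (2 * e) + e/2" by simp
        show "0 \<le> ?y\<^sup>2 / (2 * e) + e/2" using e by simp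
      qed
      also have "\<dots> = D k l / (2 * e) + e/2" using D_int by (simp add: D_def LE.prob_space)
      also have "\<dots> < e * e / (2 * e) + e/2" using e by (intro add_strict_right_mono divide_strict_right_mono K[OF that]) simp
      also have "\<dots> = e" using e by simp
      finally show ?thesis .
    qed
    then show ?thesis by blast
  qed
  note L1_Cauchy = this
  obtain r where r: "strict_mono r" and AE_pair: "AE x in ?M. Cauchy (\<lambda>k. s (\<kappa>s (r k)) x)"
    by (rule cauchy_L1_AE_cauchy_subseq[where s="\<lambda>k. s (\<kappa>s k)", OF int(2)[OF \<kappa>s_meas \<kappa>s_meas] L1_Cauchy])
  have "AE i in L. AE j in E. Cauchy (\<lambda>k. s (\<kappa>s (r k)) (i, j))" by (rule LE.AE_pair[OF AE_pair])
  then have AE_C: "AE i in L. \<forall>j. Cauchy (\<lambda>k. mean (\<kappa>s (r k) i) (F j))"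
  proof eventually_elim
    case (elim i)
    show ?case
    proof
      fix j
      have "Cauchy (\<lambda>k. s (\<kappa>s (r k)) (i, j))"
        using elim unfolding E_def AE_measure_pmf_iff by (simp add: set_pmf_geometric)
      then have "Cauchy (\<lambda>k. (1 + norm (F j)) * s (\<kappa>s (r k)) (i, j))"
        unfolding Cauchy_convergent_iff by (rule convergent_mult[OF convergent_const])
      then show "Cauchy (\<lambda>k. mean (\<kappa>s (r k) i) (F j))" using pos[of j] by (simp add: s_def)
    qed
  qed
  \<comment> \<open>On this measurable set of full mass all test integrals converge and a limit
    strategy exists. Elsewhere \<open>\<kappa>\<close> takes a constant value, so that it is a limit
    of measurable test integrals everywhere.\<close>
  define A where "A = {i \<in> space L. \<forall>j. Cauchy (\<lambda>k. mean (\<kappa>s (r k) i) (F j))}"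
  have m_meas: "(\<lambda>i. mean (\<kappa>s (r k) i) (F j)) \<in> borel_measurable L" for k j
    by (rule borel_measurable_mean[OF \<kappa>s_meas borel_measurable_bcontfun])
  have A: "A \<in> sets L"
    unfolding A_def by (intro sets.sets_Collect_countable_All sets_Collect_Cauchy m_meas)
  have "\<forall>i. \<exists>\<mu>. i \<in> A \<longrightarrow> (\<lambda>k. \<kappa>s (r k) i) \<longlonglongrightarrow> \<mu>"
  proof
    fix i
    show "\<exists>\<mu>. i \<in> A \<longrightarrow> (\<lambda>k. \<kappa>s (r k) i) \<longlonglongrightarrow> \<mu>"
    proof (cases "i \<in> A")
      case True
      then have C: "Cauchy (\<lambda>k. mean (\<kappa>s (r k) i) (F j))" for j by (simp add: A_def)
      obtain \<mu> where "(\<lambda>k. \<kappa>s (r k) i) \<longlonglongrightarrow> \<mu>"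
        by (rule tendsto_of_tendsto_means[OF cpt F C])
      then show ?thesis by blast
    qed simp
  qed
  from choice[OF this] obtain \<kappa>0 where \<kappa>0: "\<And>i. i \<in> A \<Longrightarrow> (\<lambda>k. \<kappa>s (r k) i) \<longlonglongrightarrow> \<kappa>0 i" by blast
  define \<kappa> where "\<kappa> i = (if i \<in> A then \<kappa>0 i else dirac undefined)" for i
  have lim: "(\<lambda>k. \<kappa>s (r k) i) \<longlonglongrightarrow> \<kappa> i" if "i \<in> A" for i using \<kappa>0[OF that] that by (simp add: \<kappa>_def)
  have "\<kappa> \<in> borel_measurable L"
  proof (rule measurable_prob_measureI[OF F])
    fix j
    let ?h = "\<lambda>k i. if i \<in> A then mean (\<kappa>s (r k) i) (F j) else mean (dirac undefined) (F j)"
    have "(\<lambda>k. ?h k i) \<longlonglongrightarrow> mean (\<kappa> i) (F j)" for i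
      using lim[of i, unfolded tendsto_prob_measure_iff] by (cases "i \<in> A") (simp_all add: \<kappa>_def)
    then show "(\<lambda>i. mean (\<kappa> i) (F j)) \<in> borel_measurable L"
      by (rule borel_measurable_LIMSEQ_real) (use A m_meas in \<open>auto intro!: measurable_If_set\<close>)
  qed
  moreover have "AE i in L. (\<lambda>k. \<kappa>s (r k) i) \<longlonglongrightarrow> \<kappa> i"
    using AE_C AE_space by eventually_elim (simp add: lim A_def)
  ultimately show ?thesis using \<kappa>s(1) r by blast
qed

section \<open>Limits of equilibria are equilibria\<close>

text \<open>Zero mean penalty concentrates the strategy on feasible actions attaining
  \<open>best\<close>, and no strategy on the feasible set can earn more than that.\<close>

lemma large_nashI:
  fixes G :: "('i, 'a::metric_space) game"
  assumes cpt: "compact (UNIV :: 'a set)"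
    and \<kappa>: "\<kappa> \<in> borel_measurable L"
    and pen: "AE i in L. mean (\<kappa> i) (penalty (large_summary L \<kappa>) (G i)) = 0"
  shows "large_nash L G \<kappa>"
proof -
  let ?\<tau> = "large_summary L \<kappa>"
  have opt: "(AE a in as_measure (\<kappa> i). a \<in> actions G i \<and> payoff G i a ?\<tau> = best (G i) ?\<tau>)"
    if "mean (\<kappa> i) (penalty ?\<tau> (G i)) = 0" for i
  proof -
    have "AE a in as_measure (\<kappa> i). penalty ?\<tau> (G i) a = 0"
      using that integral_nonneg_eq_0_iff_AE[OF integrable_continuous[OF cpt continuous_on_penalty[of UNIV ?\<tau> "G i"]], of "\<kappa> i"]
      by (simp add: penalty_bounds)
    then show ?thesis
    proof eventually_elim
      case (elim a)
      have "0 \<le> max 0 (best (G i) ?\<tau> - payoff G i a ?\<tau>)" "0 \<le> infdist a (actions G i)" by (simp_all add: infdist_nonneg)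
      then have "infdist a (actions G i) = 0" "best (G i) ?\<tau> \<le> payoff G i a ?\<tau>"
        using elim by (auto simp: penalty_def min_def split: if_splits)
      then have "a \<in> actions G i" by (simp add: in_closed_iff_infdist_zero compact_imp_closed)
      with best_upper[OF this, of ?\<tau>] \<open>best (G i) ?\<tau> \<le> payoff G i a ?\<tau>\<close> show ?case by simp
    qed
  qed
  have meas_K: "actions G i \<in> sets borel" for i by (simp add: borel_closed compact_imp_closed)
  have pay_meas: "(\<lambda>a. indicator (actions G i) a *\<^sub>R payoff G i a ?\<tau>) \<in> borel_measurable (as_measure \<mu>)" for i \<mu>
  proof -
    have "(\<lambda>a. indicator (actions G i) a *\<^sub>R payoff G i a ?\<tau>) \<in> borel_measurable borel"
      by (intro borel_measurable_scaleR borel_measurable_indicator meas_K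
          borel_measurable_continuous_onI[OF continuous_on_payoff_section])
    then show ?thesis by (simp cong: measurable_cong_sets)
  qed
  have meas1: "measure (as_measure (\<kappa> i)) (actions G i) = 1" if "mean (\<kappa> i) (penalty ?\<tau> (G i)) = 0" for i
    using opt[OF that] meas_K prob_space.prob_eq_1[OF prob_space_as_measure, of "actions G i" "\<kappa> i"]
    by (auto elim: eventually_mono)
  have eq: "(LINT a:actions G i|as_measure (\<kappa> i). payoff G i a ?\<tau>) = best (G i) ?\<tau>"
    if "mean (\<kappa> i) (penalty ?\<tau> (G i)) = 0" for i
  proof -
    have "(LINT a:actions G i|as_measure (\<kappa> i). payoff G i a ?\<tau>) = mean (\<kappa> i) (\<lambda>_. best (G i) ?\<tau>)"
      unfolding set_lebesgue_integral_def
    proof (rule integral_cong_AE[OF pay_meas])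
      show "AE a in as_measure (\<kappa> i). indicator (actions G i) a *\<^sub>R payoff G i a ?\<tau> = best (G i) ?\<tau>"
        using opt[OF that] by eventually_elim simp
    qed simp
    then show ?thesis by simp
  qed
  have le: "(LINT a:actions G i|as_measure \<mu>. payoff G i a ?\<tau>) \<le> best (G i) ?\<tau>"
    if "\<mu> \<in> prob_measures_on (actions G i)" for i \<mu>
  proof -
    have AE: "AE a in as_measure \<mu>. a \<in> actions G i"
      using that by (intro measure_eq_1_imp_AE) (auto simp: prob_measures_on_def compact_imp_closed)
    have "mean \<mu> (\<lambda>a. indicator (actions G i) a *\<^sub>R payoff G i a ?\<tau>) \<le> mean \<mu> (\<lambda>_. best (G i) ?\<tau>)"
    proof (rule integral_mono_AE)
      show "integrable (as_measure \<mu>) (\<lambda>a. indicator (actions G i) a *\<^sub>R payoff G i a ?\<tau>)"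
      proof (rule integrable_bounded_borel)
        show "(\<lambda>a. indicator (actions G i) a *\<^sub>R payoff G i a ?\<tau>) \<in> borel_measurable borel"
          using pay_meas[of i \<mu>] by (simp cong: measurable_cong_sets)
        show "\<bar>indicator (actions G i) a *\<^sub>R payoff G i a ?\<tau>\<bar> \<le> norm (snd (G i))" for a
          using bcontfun_bound[of "snd (G i)" "(a, ?\<tau>)"] by (simp add: indicator_def)
      qed
      show "AE a in as_measure \<mu>. indicator (actions G i) a *\<^sub>R payoff G i a ?\<tau> \<le> best (G i) ?\<tau>"
        using AE by eventually_elim (simp add: best_upper)
    qed simp
    then show ?thesis by (simp add: set_lebesgue_integral_def)
  qed
  show ?thesis
    unfolding large_nash_def large_profile_def
  proof (intro conjI \<kappa>)
    show "AE i in L. measure (as_measure (\<kappa> i)) (actions G i) = 1"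
      using pen by eventually_elim (rule meas1)
    show "AE i in L. \<forall>\<mu>\<in>prob_measures_on (actions G i).
        (LINT a:actions G i|as_measure \<mu>. payoff G i a ?\<tau>) \<le> (LINT a:actions G i|as_measure (\<kappa> i). payoff G i a ?\<tau>)"
      using pen by eventually_elim (simp add: eq le)
  qed
qed

text \<open>The player counts \<open>N n\<close> are arbitrary so that the result applies along
  subsequences of the given games.\<close>

theorem limit_of_finite_nash:
  fixes G :: "('i, 'a::metric_space) game" and Ln :: "nat \<Rightarrow> 'j measure" and Gn :: "nat \<Rightarrow> ('j, 'a) game"
  assumes cpt: "compact (UNIV :: 'a set)" and L: "prob_space L" and G: "G \<in> borel_measurable L"
    and Ln: "\<And>n. finite_player_space (N n) (Ln n)"
    and small: "(\<lambda>n. SUP i\<in>space (Ln n). measure (Ln n) {i}) \<longlonglongrightarrow> 0"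
    and lim: "(\<lambda>n. law (Ln n) (Gn n)) \<longlonglongrightarrow> law L G"
    and nash: "\<And>n. finite_nash (Ln n) (Gn n) (g n)"
    and \<tau>: "(\<lambda>n. finite_summary (Ln n) (g n)) \<longlonglongrightarrow> \<tau>"
  shows "\<tau> \<in> nash_action_distributions L G"
proof -
  interpret prob_space L by (rule L)
  obtain F :: "nat \<Rightarrow> ('a \<Rightarrow>\<^sub>C real)" where F: "dense_seq F" using ex_dense_seq[OF cpt] by blast
  define W where "W x = Bcontfun (penalty \<tau> x)" for x :: "'a compacts \<times> 'a payoff"
  have W: "apply_bcontfun (W x) = penalty \<tau> x" for x
    unfolding W_def by (rule Bcontfun_inverse[OF penalty_in_bcontfun])
  have W_cont: "continuous_on UNIV W" unfolding W_def by (rule continuous_on_Bcontfun_penalty[OF cpt])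
  have pen_meas: "(\<lambda>i. penalty \<tau> (G i) a) \<in> borel_measurable L" for a
  proof -
    have "continuous_on UNIV (\<lambda>w :: 'a \<Rightarrow>\<^sub>C real. w a)"
    proof (rule continuous_onI)
      fix w :: "'a \<Rightarrow>\<^sub>C real" and e :: real assume "e > 0"
      then show "\<exists>d>0. \<forall>v\<in>UNIV. dist v w < d \<longrightarrow> dist (v a) (w a) \<le> e"
        by (intro exI[of _ e]) (auto intro: order_trans[OF dist_bounded])
    qed
    then have "continuous_on UNIV (\<lambda>x. W x a)"
      by (rule continuous_on_compose2[OF _ W_cont]) auto
    then have "continuous_on UNIV (\<lambda>x. penalty \<tau> x a)" by (simp add: W)
    then show ?thesis by (intro measurable_compose[OF G] borel_measurable_continuous_onI)
  qed
  have mp_meas: "(\<lambda>i. mean (\<kappa> i) (W (G i))) \<in> borel_measurable L" if "\<kappa> \<in> borel_measurable L" for \<kappa>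
    by (rule borel_measurable_mean_of_measurable_function[OF cpt that]) (simp add: W pen_meas)
  have W01: "0 \<le> W x a" "W x a \<le> 1" for x a by (simp_all add: W penalty_bounds)
  have mp_bound: "\<bar>mean \<nu> (W x)\<bar> \<le> 1" for \<nu> x by (rule abs_mean_le) (use W01 in \<open>simp add: abs_le_iff order_trans[of _ 0]\<close>)
  have mp0: "0 \<le> mean \<nu> (W x)" for \<nu> x by (intro Bochner_Integration.integral_nonneg W01)
  have mp_int: "integrable L (\<lambda>i. mean (\<kappa> i) (W (G i)))" if "\<kappa> \<in> borel_measurable L" for \<kappa>
    by (rule integrable_const_bound[of _ 1]) (use mp_bound mp_meas[OF that] in auto)
  have mF_int: "integrable L (\<lambda>i. mean (\<kappa> i) (F j))" if "\<kappa> \<in> borel_measurable L" for \<kappa> j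
    by (rule integrable_const_bound[of _ "norm (F j)"])
      (use abs_mean_le[of "F j", OF bcontfun_bound] borel_measurable_mean[OF that borel_measurable_bcontfun] in auto)
  \<comment> \<open>Both constraints bound integrals that are affine in the profile, hence midpoints
    remain inside. The index \<open>k\<close> tightens the tolerance and adds tests at once, so the
    sets decrease, and \<open>transfer_profile\<close> keeps them nonempty.\<close>
  define \<C> where "\<C> k = {\<kappa> \<in> borel_measurable L. (\<integral>i. mean (\<kappa> i) (W (G i)) \<partial>L) \<le> inverse (real (Suc k)) \<and>
    (\<forall>j<k. \<bar>(\<integral>i. mean (\<kappa> i) (F j) \<partial>L) - mean \<tau> (F j)\<bar> \<le> inverse (real (Suc k)))}" for k
  have "\<exists>\<kappa>s r \<kappa>. (\<forall>k. \<kappa>s k \<in> \<C> k) \<and> strict_mono (r :: nat \<Rightarrow> nat) \<and> \<kappa> \<in> borel_measurable L \<and>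
      (AE i in L. (\<lambda>k. \<kappa>s (r k) i) \<longlonglongrightarrow> \<kappa> i)"
  proof (rule ex_AE_convergent_selection[OF cpt L])
    fix k
    have avg: "(\<lambda>n. \<Sum>i\<in>space (Ln n). measure (Ln n) {i} * mean (g n i) (W (Gn n i))) \<longlonglongrightarrow> 0"
      unfolding W by (rule average_penalty_tendsto_0[OF cpt L G Ln small lim nash \<tau>])
    have "\<exists>\<kappa>\<in>borel_measurable L. (\<integral>i. mean (\<kappa> i) (W (G i)) \<partial>L) \<le> inverse (real (Suc k)) \<and>
        (\<forall>j<k. \<bar>(\<integral>i. mean (\<kappa> i) (F j) \<partial>L) - mean \<tau> (F j)\<bar> \<le> inverse (real (Suc k)))"
      by (rule transfer_profile[OF cpt F L G Ln lim W_cont W01 avg \<tau>]) simp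
    then show "\<C> k \<noteq> {}" by (auto simp: \<C>_def)
    show "\<C> k \<subseteq> borel_measurable L" by (auto simp: \<C>_def)
    show "\<C> l \<subseteq> \<C> k" if "k \<le> l" for l
    proof -
      have "inverse (real (Suc l)) \<le> inverse (real (Suc k))" using that by (intro le_imp_inverse_le) auto
      with that show ?thesis
        unfolding \<C>_def by (intro Collect_mono) (meson less_le_trans order_trans)
    qed
    fix \<kappa> \<kappa>' assume \<kappa>: "\<kappa> \<in> \<C> k" and \<kappa>': "\<kappa>' \<in> \<C> k"
    have m: "\<kappa> \<in> borel_measurable L" "\<kappa>' \<in> borel_measurable L" using \<kappa> \<kappa>' by (auto simp: \<C>_def)
    show "(\<lambda>i. midpoint_measure (\<kappa> i) (\<kappa>' i)) \<in> \<C> k"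
      unfolding \<C>_def
    proof (intro CollectI conjI allI impI)
      show "(\<lambda>i. midpoint_measure (\<kappa> i) (\<kappa>' i)) \<in> borel_measurable L"
        by (rule measurable_prob_measureI[OF F], unfold mean_midpoint_measure,
            intro borel_measurable_divide borel_measurable_add borel_measurable_const
              borel_measurable_mean[OF _ borel_measurable_bcontfun] m)
      show "(\<integral>i. mean (midpoint_measure (\<kappa> i) (\<kappa>' i)) (W (G i)) \<partial>L) \<le> inverse (real (Suc k))"
        using \<kappa> \<kappa>' mp_int[OF m(1)] mp_int[OF m(2)] by (simp add: mean_midpoint_measure \<C>_def)
      fix j assume j: "j < k"
      have "(\<integral>i. mean (midpoint_measure (\<kappa> i) (\<kappa>' i)) (F j) \<partial>L)
          = ((\<integral>i. mean (\<kappa> i) (F j) \<partial>L) + (\<integral>i. mean (\<kappa>' i) (F j) \<partial>L)) / 2"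
        using mF_int[OF m(1)] mF_int[OF m(2)] by (simp add: mean_midpoint_measure)
      moreover have "\<bar>(\<integral>i. mean (\<kappa> i) (F j) \<partial>L) - mean \<tau> (F j)\<bar> \<le> inverse (real (Suc k))"
        "\<bar>(\<integral>i. mean (\<kappa>' i) (F j) \<partial>L) - mean \<tau> (F j)\<bar> \<le> inverse (real (Suc k))"
        using \<kappa> \<kappa>' j by (auto simp: \<C>_def simp del: of_nat_Suc)
      ultimately show "\<bar>(\<integral>i. mean (midpoint_measure (\<kappa> i) (\<kappa>' i)) (F j) \<partial>L) - mean \<tau> (F j)\<bar> \<le> inverse (real (Suc k))"
        unfolding abs_le_iff by argo
    qed
  qed
  then obtain \<kappa>s r \<kappa> where \<kappa>s: "\<And>k. \<kappa>s k \<in> \<C> k" and r: "strict_mono (r :: nat \<Rightarrow> nat)"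
    and \<kappa>: "\<kappa> \<in> borel_measurable L" and AE: "AE i in L. (\<lambda>k. \<kappa>s (r k) i) \<longlonglongrightarrow> \<kappa> i" by blast
  have \<kappa>s_meas: "\<kappa>s k \<in> borel_measurable L" for k using \<kappa>s[of k] by (simp add: \<C>_def)
  have inv: "(\<lambda>k. inverse (real (Suc (r k)))) \<longlonglongrightarrow> 0"
    using LIMSEQ_subseq_LIMSEQ[OF LIMSEQ_inverse_real_of_nat r] by (simp add: comp_def)
  have "(\<lambda>k. \<integral>i. mean (\<kappa>s (r k) i) (W (G i)) \<partial>L) \<longlonglongrightarrow> (\<integral>i. mean (\<kappa> i) (W (G i)) \<partial>L)"
  proof (rule integral_dominated_convergence[where w="\<lambda>_. 1"])
    show "AE i in L. (\<lambda>k. mean (\<kappa>s (r k) i) (W (G i))) \<longlonglongrightarrow> mean (\<kappa> i) (W (G i))"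
      using AE by eventually_elim (simp add: tendsto_prob_measure_iff)
  qed (use mp_meas \<kappa> \<kappa>s_meas mp_bound in auto)
  moreover have "(\<integral>i. mean (\<kappa>s (r k) i) (W (G i)) \<partial>L) \<le> inverse (real (Suc (r k)))" for k
    using \<kappa>s[of "r k"] by (simp add: \<C>_def)
  ultimately have "(\<integral>i. mean (\<kappa> i) (W (G i)) \<partial>L) \<le> 0" by (intro LIMSEQ_le[OF _ inv]) auto
  then have "(\<integral>i. mean (\<kappa> i) (W (G i)) \<partial>L) = 0"
    using Bochner_Integration.integral_nonneg[of L "\<lambda>i. mean (\<kappa> i) (W (G i))"] mp0 by (intro antisym) auto
  then have pen: "AE i in L. mean (\<kappa> i) (penalty \<tau> (G i)) = 0"
    using integral_nonneg_eq_0_iff_AE[OF mp_int[OF \<kappa>]] mp0 by (simp add: W)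
  \<comment> \<open>Equality is obtained as convergence of a constant sequence, which needs to be
    checked on the tests \<open>F j\<close> only.\<close>
  have "large_summary L \<kappa> = \<tau>"
  proof (rule tendsto_prob_measure_unique[OF tendsto_const])
    show "(\<lambda>_::nat. large_summary L \<kappa>) \<longlonglongrightarrow> \<tau>"
    proof (rule dense_seq_tendstoI[OF F])
      fix j
      have 1: "(\<lambda>k. \<integral>i. mean (\<kappa>s (r k) i) (F j) \<partial>L) \<longlonglongrightarrow> (\<integral>i. mean (\<kappa> i) (F j) \<partial>L)"
      proof (rule integral_dominated_convergence[where w="\<lambda>_. norm (F j)"])
        show "AE i in L. (\<lambda>k. mean (\<kappa>s (r k) i) (F j)) \<longlonglongrightarrow> mean (\<kappa> i) (F j)"
          using AE by eventually_elim (simp add: tendsto_prob_measure_iff)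
      qed (use mF_int \<kappa> \<kappa>s_meas abs_mean_le[of "F j", OF bcontfun_bound] in \<open>auto intro: borel_measurable_integrable\<close>)
      have "(\<lambda>k. (\<integral>i. mean (\<kappa>s (r k) i) (F j) \<partial>L) - mean \<tau> (F j)) \<longlonglongrightarrow> 0"
      proof (rule Lim_null_comparison[OF _ inv])
        show "\<forall>\<^sub>F k in sequentially. norm ((\<integral>i. mean (\<kappa>s (r k) i) (F j) \<partial>L) - mean \<tau> (F j)) \<le> inverse (real (Suc (r k)))"
          using eventually_gt_at_top[of j]
        proof eventually_elim
          case (elim k)
          then have "j < r k" using seq_suble[OF r, of k] by simp
          then show ?case using \<kappa>s[of "r k"] by (simp add: \<C>_def)
        qed
      qed
      then have "(\<lambda>k. \<integral>i. mean (\<kappa>s (r k) i) (F j) \<partial>L) \<longlonglongrightarrow> mean \<tau> (F j)" by (simp add: LIM_zero_iff)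
      with 1 have "(\<integral>i. mean (\<kappa> i) (F j) \<partial>L) = mean \<tau> (F j)" by (rule LIMSEQ_unique)
      then show "(\<lambda>_::nat. mean (large_summary L \<kappa>) (F j)) \<longlonglongrightarrow> mean \<tau> (F j)"
        by (simp add: mean_large_summary[OF L \<kappa> borel_measurable_bcontfun bcontfun_bound])
    qed
  qed
  moreover from this have "large_nash L G \<kappa>" using pen by (intro large_nashI[OF cpt \<kappa>]) simp
  ultimately show ?thesis unfolding nash_action_distributions_def by blast
qed

section \<open>From limits along subsequences to the sequence of games\<close>

theorem corollary1:
  fixes L :: "'i measure"
    and G :: "('i, 'a::metric_space) game"
    and Ln :: "nat \<Rightarrow> 'j measure"
    and Gn :: "nat \<Rightarrow> ('j, 'a) game"
  assumes "compact (UNIV :: 'a set)"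
    and "large_game L G"
    and "\<And>n. n \<ge> 1 \<Longrightarrow> finite_player_space n (Ln n)"
    and "(\<lambda>n. SUP i\<in>space (Ln n). measure (Ln n) {i}) \<longlonglongrightarrow> 0"
    and "(\<lambda>n. law (Ln n) (Gn n)) \<longlonglongrightarrow> law L G"
  shows "(\<exists>\<tau>\<in>nash_action_distributions L G. limit_point_of_equilibria Ln Gn \<tau>) \<and>
    (\<forall>\<tau>'. nash_action_distributions L G = {\<tau>'} \<longrightarrow>
       (\<forall>g. (\<forall>n\<ge>1. finite_nash (Ln n) (Gn n) (g n)) \<longrightarrow>
         (\<lambda>n. finite_summary (Ln n) (g n)) \<longlonglongrightarrow> \<tau>'))"
proof -
  have L: "prob_space L" "G \<in> borel_measurable L" using assms(2) by (simp_all add: large_game_def)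
  \<comment> \<open>Both claims rest on this: every subsequence of summaries of equilibria has a
    further subsequence converging to an equilibrium distribution of \<open>G\<close>.\<close>
  have subseq: "\<exists>\<tau> q. strict_mono (q :: nat \<Rightarrow> nat) \<and> \<tau> \<in> nash_action_distributions L G \<and>
      (\<lambda>k. finite_summary (Ln (r (q k))) (g (r (q k)))) \<longlonglongrightarrow> \<tau>"
    if nash: "\<forall>n\<ge>1. finite_nash (Ln n) (Gn n) (g n)" and r: "strict_mono r" "\<And>k. r k \<ge> 1"
    for g and r :: "nat \<Rightarrow> nat"
  proof -
    obtain \<tau> q where q: "strict_mono (q :: nat \<Rightarrow> nat)"
      and \<tau>: "((\<lambda>k. finite_summary (Ln (r k)) (g (r k))) \<circ> q) \<longlonglongrightarrow> \<tau>"
      using seq_compact_prob_measure[OF assms(1)] by (rule seq_compactE) auto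
    have rq: "strict_mono (r \<circ> q)" using r(1) q by (rule strict_mono_o)
    have "\<tau> \<in> nash_action_distributions L G"
    proof (rule limit_of_finite_nash[OF assms(1) L, where Ln="Ln \<circ> (r \<circ> q)" and Gn="Gn \<circ> (r \<circ> q)"
          and g="g \<circ> (r \<circ> q)" and N="r \<circ> q"])
      show "finite_player_space ((r \<circ> q) n) ((Ln \<circ> (r \<circ> q)) n)" for n using r(2) assms(3) by simp
      show "finite_nash ((Ln \<circ> (r \<circ> q)) n) ((Gn \<circ> (r \<circ> q)) n) ((g \<circ> (r \<circ> q)) n)" for n
        using nash r(2) by simp
      show "(\<lambda>n. SUP i\<in>space ((Ln \<circ> (r \<circ> q)) n). measure ((Ln \<circ> (r \<circ> q)) n) {i}) \<longlonglongrightarrow> 0"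
        using LIMSEQ_subseq_LIMSEQ[OF assms(4) rq] by (simp add: comp_def)
      show "(\<lambda>n. law ((Ln \<circ> (r \<circ> q)) n) ((Gn \<circ> (r \<circ> q)) n)) \<longlonglongrightarrow> law L G"
        using LIMSEQ_subseq_LIMSEQ[OF assms(5) rq] by (simp add: comp_def)
      show "(\<lambda>n. finite_summary ((Ln \<circ> (r \<circ> q)) n) ((g \<circ> (r \<circ> q)) n)) \<longlonglongrightarrow> \<tau>"
        using \<tau> by (simp add: comp_def)
    qed
    with q \<tau> show ?thesis unfolding comp_def by blast
  qed
  show ?thesis
  proof (intro conjI allI impI)
    have "\<forall>n. \<exists>g. n \<ge> 1 \<longrightarrow> finite_nash (Ln n) (Gn n) g"
      using ex_finite_nash[OF assms(1) assms(3)] by blast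
    from choice[OF this] obtain g where g: "\<forall>n\<ge>1. finite_nash (Ln n) (Gn n) (g n)" by blast
    \<comment> \<open>The subsequence \<open>Suc\<close> skips the index 0, at which no game is
      given.\<close>
    have Suc: "strict_mono Suc" by (simp add: strict_mono_def)
    from subseq[OF g Suc] obtain \<tau> q where q: "strict_mono (q :: nat \<Rightarrow> nat)" "\<tau> \<in> nash_action_distributions L G"
      "(\<lambda>k. finite_summary (Ln (Suc (q k))) (g (Suc (q k)))) \<longlonglongrightarrow> \<tau>" by auto
    have "limit_point_of_equilibria Ln Gn \<tau>"
      unfolding limit_point_of_equilibria_def
    proof (rule exI[of _ g], rule conjI[OF g], rule exI[of _ "\<lambda>k. Suc (q k)"], intro conjI)
      show "strict_mono (\<lambda>k. Suc (q k))" using q(1) by (simp add: strict_mono_def)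
    qed (use q(3) in auto)
    with q(2) show "\<exists>\<tau>\<in>nash_action_distributions L G. limit_point_of_equilibria Ln Gn \<tau>" by blast
  next
    fix \<tau>' and g :: "nat \<Rightarrow> 'j \<Rightarrow> 'a prob_measure"
    assume unique: "nash_action_distributions L G = {\<tau>'}" and g: "\<forall>n\<ge>1. finite_nash (Ln n) (Gn n) (g n)"
    show "(\<lambda>n. finite_summary (Ln n) (g n)) \<longlonglongrightarrow> \<tau>'"
    proof (rule topological_tendstoI, rule ccontr)
      fix S :: "'a prob_measure set"
      assume S: "open S" "\<tau>' \<in> S" and "\<not> (\<forall>\<^sub>F n in sequentially. finite_summary (Ln n) (g n) \<in> S)"
      then have "\<exists>\<^sub>F n in sequentially. finite_summary (Ln n) (g n) \<notin> S" by (simp add: frequently_def)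
      \<comment> \<open>Infinitely many summaries avoiding the neighbourhood \<open>S\<close> form a
        subsequence, whose further limit must be the unique \<tau>', a point of
        \<open>S\<close>.\<close>
      then have "\<exists>\<^sub>F n in sequentially. n \<ge> 1 \<and> finite_summary (Ln n) (g n) \<notin> S"
        using eventually_ge_at_top[of 1] by (rule frequently_eventually_conj)
      then have "infinite {n. n \<ge> 1 \<and> finite_summary (Ln n) (g n) \<notin> S}"
        by (simp add: frequently_cofinite[symmetric] cofinite_eq_sequentially)
      then obtain r :: "nat \<Rightarrow> nat" where r: "strict_mono r" "\<And>k. r k \<in> {n. n \<ge> 1 \<and> finite_summary (Ln n) (g n) \<notin> S}"
        using infinite_enumerate by blast
      obtain \<tau> q where q: "strict_mono (q :: nat \<Rightarrow> nat)" "\<tau> \<in> nash_action_distributions L G"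
        "(\<lambda>k. finite_summary (Ln (r (q k))) (g (r (q k)))) \<longlonglongrightarrow> \<tau>"
        using subseq[OF g r(1)] r(2) by auto
      have "\<tau> = \<tau>'" using q(2) unique by simp
      from topological_tendstoD[OF q(3)[unfolded this] S]
      obtain k where "finite_summary (Ln (r (q k))) (g (r (q k))) \<in> S" by (auto simp: eventually_sequentially)
      with r(2)[of "q k"] show False by simp
    qed
  qed
qed

end
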